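(* Let $X$ and $Y$ be anisotropic quasi-Pfister neighbours of the same dimension over $F$. Suppose that there are rational morphisms $X \dashrightarrow Y$ and $Y \dashrightarrow X$. Then $X$ and $Y$ are birational over $F$.
   Context: $p$ is a prime and $F$ is a non-perfect field of characteristic $p$. Rational morphisms are over the base field and need not be dominant. A quasilinear $p$-form over $F$ is a map $\varphi\colon V_\varphi \to F$ on a finite-dimensional $F$-vector space $V_\varphi$ with $\varphi(\lambda v)=\lambda^p\varphi(v)$ and $\varphi(v+w)=\varphi(v)+\varphi(w)$ for all $\lambda\in F$, $v,w\in V_\varphi$. Its dimension is $\dim V_\varphi$. It is isotropic if $\varphi(v)=0$ for some $v\ne 0$, and anisotropic otherwise. A subform of $\varphi$ is the restriction of $\varphi$ to a subspace of $V_\varphi$. Two forms $\varphi,\psi$ are proportional if $\varphi\simeq\lambda\psi$ for some $\lambda\in F^*$. For $a_1,\dots,a_n\in F^*$, the quasi-Pfister form $\langle\!\langle a_1,\dots,a_n\rangle\!\rangle$ is the quasilinear $p$-form $\sum_{0\le j_1,\dots,j_n\le p-1}\left(\prod_{i=1}^n a_i^{j_i}\right)x_{j_1,\dots,j_n}^p$ of dimension $p^n$ on $F^{p^n}$. A quasilinear $p$-form $\varphi$ of dimension $\ge 2$ is a quasi-Pfister neighbour if it is proportional to a subform of a quasi-Pfister form of dimension $p^n$, where $n$ is the unique positive integer with $p^{n-1}<\dim(\varphi)\le p^n$. For a quasilinear $p$-form $\varphi$ over $F$ of dimension $d+2\ge 2$, $X_\varphi=\{\varphi=0\}\subset\mathbb{P}(V_\varphi)$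 is the associated projective hypersurface, of dimension $d$. $X_\varphi$ is called anisotropic (resp. a quasi-Pfister neighbour) if $\varphi$ is. If $\varphi$ is anisotropic, $X_\varphi$ is integral. *)

theory Defs
  imports
    Complex_Main
    "HOL-Computational_Algebra.Primes"
    "HOL-Library.Poly_Mapping"
    "HOL-Library.Function_Algebras"
begin

section \<open>Quasilinear forms\<close>

text \<open>
  A form lives on a finite-dimensional subspace \<open>V\<close> of an arbitrary ambient \<open>F\<close>-vector space with
  scalar multiplication \<open>s\<close>, so that the subforms of \<open>(s, V, \<phi>)\<close> are the \<open>(s, U, \<phi>)\<close> with
  \<open>U\<close> a subspace of \<open>V\<close>. The values of \<open>\<phi>\<close> outside \<open>V\<close> are irrelevant.
\<close>

definition quasilinear_form ::
    "nat \<Rightarrow> ('a::field \<Rightarrow> 'v::ab_group_add \<Rightarrow> 'v) \<Rightarrow> 'v set \<Rightarrow> ('v \<Rightarrow> 'a) \<Rightarrow> bool" where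
  "quasilinear_form p s V \<phi> \<longleftrightarrow>
     vector_space s \<and> module.subspace s V \<and> (\<exists>B. finite B \<and> module.span s B = V) \<and>
     (\<forall>c. \<forall>v\<in>V. \<phi> (s c v) = c ^ p * \<phi> v) \<and>
     (\<forall>v\<in>V. \<forall>w\<in>V. \<phi> (v + w) = \<phi> v + \<phi> w)"

definition anisotropic :: "'v::zero set \<Rightarrow> ('v \<Rightarrow> 'a::zero) \<Rightarrow> bool" where
  "anisotropic V \<phi> \<longleftrightarrow> \<not> (\<exists>v\<in>V. v \<noteq> 0 \<and> \<phi> v = 0)"

definition isometric ::
    "('a::field \<Rightarrow> 'v::ab_group_add \<Rightarrow> 'v) \<Rightarrow> 'v set \<Rightarrow> ('v \<Rightarrow> 'a) \<Rightarrow>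
     ('a \<Rightarrow> 'w::ab_group_add \<Rightarrow> 'w) \<Rightarrow> 'w set \<Rightarrow> ('w \<Rightarrow> 'a) \<Rightarrow> bool" where
  "isometric s V \<phi> t W \<psi> \<longleftrightarrow>
     (\<exists>h. bij_betw h V W \<and>
          (\<forall>v\<in>V. \<forall>w\<in>V. h (v + w) = h v + h w) \<and>
          (\<forall>c. \<forall>v\<in>V. h (s c v) = t c (h v)) \<and>
          (\<forall>v\<in>V. \<psi> (h v) = \<phi> v))"

definition proportional ::
    "('a::field \<Rightarrow> 'v::ab_group_add \<Rightarrow> 'v) \<Rightarrow> 'v set \<Rightarrow> ('v \<Rightarrow> 'a) \<Rightarrow>
     ('a \<Rightarrow> 'w::ab_group_add \<Rightarrow> 'w) \<Rightarrow> 'w set \<Rightarrow> ('w \<Rightarrow> 'a) \<Rightarrow> bool" where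
  "proportional s V \<phi> t W \<psi> \<longleftrightarrow> (\<exists>c. c \<noteq> 0 \<and> isometric s V \<phi> t W (\<lambda>w. c * \<psi> w))"


section \<open>Quasi-Pfister forms and their neighbours\<close>

definition pfister_index :: "nat \<Rightarrow> nat \<Rightarrow> nat list set" where
  "pfister_index p n = {j. length j = n \<and> set j \<subseteq> {..<p}}"

definition coord_scale :: "'a::field \<Rightarrow> (nat list \<Rightarrow> 'a) \<Rightarrow> nat list \<Rightarrow> 'a" where
  "coord_scale c x = (\<lambda>j. c * x j)"

text \<open>\<open>F\<close> to the power \<open>p\<^sup>n\<close>, as the functions supported on the \<open>p\<^sup>n\<close> multi-indices.\<close>

definition pfister_space :: "nat \<Rightarrow> nat \<Rightarrow> (nat list \<Rightarrow> 'a::field) set" where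
  "pfister_space p n = {x. \<forall>j. j \<notin> pfister_index p n \<longrightarrow> x j = 0}"

definition quasi_pfister :: "nat \<Rightarrow> 'a::field list \<Rightarrow> (nat list \<Rightarrow> 'a) \<Rightarrow> 'a" where
  "quasi_pfister p as x =
     (\<Sum>j\<in>pfister_index p (length as). (\<Prod>i<length as. (as ! i) ^ (j ! i)) * x j ^ p)"

definition quasi_pfister_neighbour ::
    "nat \<Rightarrow> ('a::field \<Rightarrow> 'v::ab_group_add \<Rightarrow> 'v) \<Rightarrow> 'v set \<Rightarrow> ('v \<Rightarrow> 'a) \<Rightarrow> bool" where
  "quasi_pfister_neighbour p s V \<phi> \<longleftrightarrow>
     2 \<le> vector_space.dim s V \<and>
     (\<exists>n as U. 0 < n \<and> p ^ (n - 1) < vector_space.dim s V \<and> vector_space.dim s V \<le> p ^ n \<and>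
        length as = n \<and> 0 \<notin> set as \<and>
        U \<subseteq> pfister_space p n \<and> module.subspace coord_scale U \<and>
        proportional s V \<phi> coord_scale U (quasi_pfister p as))"


section \<open>Polynomials\<close>

text \<open>Polynomials in the variables \<open>x\<^sub>0, x\<^sub>1, \<dots>\<close>; exponent vectors are finitely supported maps.\<close>

type_synonym 'a mpoly = "(nat \<Rightarrow>\<^sub>0 nat) \<Rightarrow>\<^sub>0 'a"

definition mvar :: "nat \<Rightarrow> 'a::comm_ring_1 mpoly" where
  "mvar i = Poly_Mapping.single (Poly_Mapping.single i 1) 1"

definition mconst :: "'a::comm_ring_1 \<Rightarrow> 'a mpoly" where
  "mconst c = Poly_Mapping.single 0 c"

definition polys :: "nat \<Rightarrow> 'a::comm_ring_1 mpoly set" where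
  "polys n = {P. \<forall>m\<in>Poly_Mapping.keys P. Poly_Mapping.keys m \<subseteq> {..<n}}"

text \<open>As usual, \<open>0\<close> is homogeneous of every degree.\<close>

definition homogeneous :: "nat \<Rightarrow> nat \<Rightarrow> 'a::comm_ring_1 mpoly set" where
  "homogeneous n d = {P\<in>polys n. \<forall>m\<in>Poly_Mapping.keys P. (\<Sum>i\<in>Poly_Mapping.keys m. Poly_Mapping.lookup m i) = d}"

definition psubst :: "(nat \<Rightarrow> 'a::comm_ring_1 mpoly) \<Rightarrow> 'a mpoly \<Rightarrow> 'a mpoly" where
  "psubst f P = (\<Sum>m\<in>Poly_Mapping.keys P. mconst (Poly_Mapping.lookup P m) * (\<Prod>i\<in>Poly_Mapping.keys m. f i ^ Poly_Mapping.lookup m i))"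


section \<open>Projective varieties and rational morphisms\<close>

text \<open>
  An integral closed subscheme of the projective space with homogeneous coordinates
  \<open>x\<^sub>0, \<dots>, x\<^bsub>n-1\<^esub>\<close> is given by \<open>n\<close> and its homogeneous prime ideal in \<open>F[x\<^sub>0, \<dots>, x\<^bsub>n-1\<^esub>]\<close>.
  The definitions below are meant for such pairs. Working with ideals rather than with points
  is essential: anisotropic hypersurfaces have no rational points and are not geometrically
  reduced.
\<close>

type_synonym 'a proj_variety = "nat \<times> 'a mpoly set"

text \<open>
  A rational morphism over \<open>F\<close> from \<open>X\<close> to \<open>Y\<close> is represented by a tuple of homogeneous
  polynomials of one common degree which do not all vanish on \<open>X\<close> and which satisfy on \<open>X\<close> the
  equations of \<open>Y\<close>. Two tuples represent the same rational morphism iff they are proportional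
  over the function field of \<open>X\<close>. Only the entries with index below the number of
  coordinates of \<open>Y\<close> matter.
\<close>

definition rational_morphism ::
    "'a::comm_ring_1 proj_variety \<Rightarrow> 'a proj_variety \<Rightarrow> (nat \<Rightarrow> 'a mpoly) \<Rightarrow> bool" where
  "rational_morphism X Y f \<longleftrightarrow>
     (\<exists>d. \<forall>j<fst Y. f j \<in> homogeneous (fst X) d) \<and>
     (\<exists>j<fst Y. f j \<notin> snd X) \<and>
     (\<forall>P\<in>snd Y. psubst f P \<in> snd X)"

definition same_rational_morphism ::
    "'a::comm_ring_1 proj_variety \<Rightarrow> 'a proj_variety \<Rightarrow>
     (nat \<Rightarrow> 'a mpoly) \<Rightarrow> (nat \<Rightarrow> 'a mpoly) \<Rightarrow> bool" where
  "same_rational_morphism X Y f g \<longleftrightarrow>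
     (\<forall>i<fst Y. \<forall>j<fst Y. f i * g j - f j * g i \<in> snd X)"

text \<open>The only hypersurfaces of \<open>Y\<close>'s ambient space containing the image are those containing \<open>Y\<close>.\<close>

definition dominant ::
    "'a::comm_ring_1 proj_variety \<Rightarrow> 'a proj_variety \<Rightarrow> (nat \<Rightarrow> 'a mpoly) \<Rightarrow> bool" where
  "dominant X Y f \<longleftrightarrow>
     (\<forall>d. \<forall>P\<in>homogeneous (fst Y) d. psubst f P \<in> snd X \<longrightarrow> P \<in> snd Y)"

text \<open>First \<open>f\<close>, then \<open>g\<close>; it represents a rational morphism as soon as \<open>f\<close> is dominant.\<close>

definition composite ::
    "(nat \<Rightarrow> 'a::comm_ring_1 mpoly) \<Rightarrow> (nat \<Rightarrow> 'a mpoly) \<Rightarrow> nat \<Rightarrow> 'a mpoly" where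
  "composite g f = (\<lambda>j. psubst f (g j))"

definition birational :: "'a::comm_ring_1 proj_variety \<Rightarrow> 'a proj_variety \<Rightarrow> bool" where
  "birational X Y \<longleftrightarrow>
     (\<exists>f g. rational_morphism X Y f \<and> dominant X Y f \<and>
            rational_morphism Y X g \<and> dominant Y X g \<and>
            same_rational_morphism X X (composite g f) mvar \<and>
            same_rational_morphism Y Y (composite f g) mvar)"


section \<open>The hypersurface of a quasilinear form\<close>

definition ordered_basis ::
    "('a::field \<Rightarrow> 'v::ab_group_add \<Rightarrow> 'v) \<Rightarrow> 'v set \<Rightarrow> 'v list \<Rightarrow> bool" where
  "ordered_basis s V bs \<longleftrightarrow>
     distinct bs \<and> \<not> module.dependent s (set bs) \<and> module.span s (set bs) = V"

text \<open>\<open>\<phi>\<close> as a polynomial in the coordinates with respect to the ordered basis \<open>bs\<close>.\<close>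

definition form_poly :: "nat \<Rightarrow> ('v \<Rightarrow> 'a::comm_ring_1) \<Rightarrow> 'v list \<Rightarrow> 'a mpoly" where
  "form_poly p \<phi> bs = (\<Sum>i<length bs. mconst (\<phi> (bs ! i)) * mvar i ^ p)"

definition hypersurface :: "nat \<Rightarrow> ('v \<Rightarrow> 'a::comm_ring_1) \<Rightarrow> 'v list \<Rightarrow> 'a proj_variety" where
  "hypersurface p \<phi> bs =
     (length bs, {form_poly p \<phi> bs * Q |Q. Q \<in> polys (length bs)})"

text \<open>Used only for forms of dimension at least 2, so the subtraction does not truncate.\<close>

definition hypersurface_dim ::
    "('a::field \<Rightarrow> 'v::ab_group_add \<Rightarrow> 'v) \<Rightarrow> 'v set \<Rightarrow> nat" where
  "hypersurface_dim s V = vector_space.dim s V - 2"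

end

theory Submission
  imports Defs "HOL-Computational_Algebra.Polynomial"
begin

hide_const (open) Poly_Mapping.degree

text \<open>
  Scale both forms, of dimension \<open>r\<close>, to take the value \<open>1\<close>, with values \<open>u\<^sub>i\<close> and \<open>w\<^sub>i\<close> on the
  given bases. The \<open>w\<^sub>i\<close> lie in a field \<open>L\<close> of degree \<open>N = p \<kappa>\<close> over \<open>F\<^sup>p\<close> with \<open>\<kappa> < r\<close>, and the
  rational morphism \<open>X \<dashrightarrow> Y\<close> forces the \<open>u\<^sub>i\<close> into \<open>L\<close>. The function field of \<open>X\<close>, twisted by
  Frobenius, embeds in a purely transcendental extension of \<open>L\<close>, which has degree \<open>\<kappa>\<close> over it, and
  any \<open>\<kappa>\<close> elements of \<open>L\<close> independent over \<open>F\<^sup>p\<close> form a basis of this extension; this is Hoffmann's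
  separation theorem, proved by differentiating relations that vanish on the hyperplane
  \<open>\<Sum> u\<^sub>i x\<^sub>i = 0\<close>. Hence for given \<open>x\<^sub>\<kappa>, \<dots>, x\<^bsub>r-1\<^esub>\<close> the remaining coordinates of a point of \<open>X\<close>,
  and of a point of \<open>Y\<close>, are the unique solution of a linear system. Over the function field of \<open>X\<close>
  this gives the point of \<open>Y\<close> with the same last coordinates as the generic point of \<open>X\<close>, and vice
  versa. The two resulting maps are inverse to each other by uniqueness, as soon as one of the
  composites is defined.
\<close>


section \<open>Homomorphisms from polynomial rings\<close>

text \<open>No quotient ring or fraction field is ever formed. The Frobenius twist places every
  coordinate ring inside one polynomial ring, and linear algebra over its fraction field is done by
  clearing denominators; denominators can be chosen as \<open>p\<close>-th powers, which the twist
  makes into scalars. The bound \<open>\<kappa> < r\<close> comes from the neighbour condition: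
  \<open>N\<close> is at most \<open>p^n\<close>, while \<open>p^(n-1) < r\<close>. The main
  obstacle is the way back. The denominator of the map from \<open>Y\<close> to \<open>X\<close>
  might vanish on the image of the map from \<open>X\<close> to \<open>Y\<close>, which is not yet
  known to be dominant. Restricting the twisted equation to the hyperplane only tells that it
  vanishes. The order of vanishing tells more: along the first map the equation of \<open>Y\<close>
  pulls back to something that vanishes to order exactly one, and this makes the system for the
  second map solvable after specialisation along the first. Dominance of both maps is read off from
  the composites.\<close>

locale rhom =
  fixes h :: "'a::comm_ring_1 \<Rightarrow> 'b::comm_ring_1"
  assumes one: "h 1 = 1" and add: "h (x + y) = h x + h y" and mult: "h (x * y) = h x * h y"
begin

lemma zero: "h 0 = 0"
  using add[of 0 0] by simp

lemma uminus: "h (- x) = - h x"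
  using add[of x "- x"] zero by (simp add: eq_neg_iff_add_eq_0 add.commute)

lemma diff: "h (x - y) = h x - h y"
  using add[of x "- y"] uminus by simp

lemma power: "h (x ^ n) = h x ^ n"
  by (induction n) (auto simp: one mult)

lemma sum: "h (sum f A) = (\<Sum>x\<in>A. h (f x))"
  by (induction A rule: infinite_finite_induct) (auto simp: zero add)

lemma of_nat: "h (of_nat n) = of_nat n"
  by (induction n) (auto simp: zero one add)

lemma dvd: "x dvd y \<Longrightarrow> h x dvd h y"
  by (auto simp: dvd_def mult)

end

lemma rhom_comp: "rhom g \<Longrightarrow> rhom h \<Longrightarrow> rhom (\<lambda>x. g (h x))"
  by (simp add: rhom_def)

lemma rhom_id: "rhom (\<lambda>x. x)"
  by (simp add: rhom_def)

definition mon :: "(nat \<Rightarrow> 'b::comm_ring_1) \<Rightarrow> (nat \<Rightarrow>\<^sub>0 nat) \<Rightarrow> 'b" where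
  "mon f m = (\<Prod>i\<in>Poly_Mapping.keys m. f i ^ Poly_Mapping.lookup m i)"

lemma mon_superset:
  "finite A \<Longrightarrow> Poly_Mapping.keys m \<subseteq> A \<Longrightarrow> mon f m = (\<Prod>i\<in>A. f i ^ Poly_Mapping.lookup m i)"
  unfolding mon_def by (rule prod.mono_neutral_left) (auto simp: in_keys_iff)

lemma mon_add: "mon f (m + n) = mon f m * mon f n"
proof -
  let ?A = "Poly_Mapping.keys m \<union> Poly_Mapping.keys n"
  have "Poly_Mapping.keys (m + n) \<subseteq> ?A" by (rule keys_add)
  then show ?thesis
    by (simp add: mon_superset[of ?A] lookup_add power_add prod.distrib)
qed

lemma mon_0 [simp]: "mon f 0 = 1"
  by (simp add: mon_def)

lemma mon_single [simp]: "mon f (Poly_Mapping.single i k) = f i ^ k"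
  by (cases "k = 0") (auto simp: mon_def)

text \<open>Coefficients are transported along with the variables, so that the Frobenius twist, the
  Taylor shift and the passage to univariate polynomials in \<open>x_0\<close> are instances, as is
  \<open>psubst\<close>.\<close>

definition mp_eval :: "('a::comm_ring_1 \<Rightarrow> 'b::comm_ring_1) \<Rightarrow> (nat \<Rightarrow> 'b) \<Rightarrow> 'a mpoly \<Rightarrow> 'b" where
  "mp_eval c f P = (\<Sum>m\<in>Poly_Mapping.keys P. c (Poly_Mapping.lookup P m) * mon f m)"

lemma mp_eval_superset:
  assumes "rhom c" "finite A" "Poly_Mapping.keys P \<subseteq> A"
  shows "mp_eval c f P = (\<Sum>m\<in>A. c (Poly_Mapping.lookup P m) * mon f m)"
  unfolding mp_eval_def
  by (rule sum.mono_neutral_left) (use assms in \<open>auto simp: in_keys_iff rhom.zero\<close>)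

lemma mp_eval_add:
  assumes "rhom c"
  shows "mp_eval c f (P + Q) = mp_eval c f P + mp_eval c f Q"
proof -
  let ?A = "Poly_Mapping.keys P \<union> Poly_Mapping.keys Q"
  have "Poly_Mapping.keys (P + Q) \<subseteq> ?A" by (rule keys_add)
  then show ?thesis
    by (simp add: mp_eval_superset[OF assms, of ?A] lookup_add rhom.add[OF assms] distrib_right
        sum.distrib)
qed

lemma mp_eval_zero [simp]: "mp_eval c f 0 = 0"
  by (simp add: mp_eval_def)

lemma mp_eval_sum:
  assumes "rhom c"
  shows "mp_eval c f (sum g A) = (\<Sum>x\<in>A. mp_eval c f (g x))"
  by (induction A rule: infinite_finite_induct) (auto simp: mp_eval_add[OF assms])

lemma mp_eval_single:
  assumes "rhom c"
  shows "mp_eval c f (Poly_Mapping.single m a) = c a * mon f m"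
  by (cases "a = 0") (auto simp: mp_eval_def rhom.zero[OF assms])

lemma mpoly_sum_single:
  fixes P :: "'a::comm_ring_1 mpoly"
  shows "P = (\<Sum>m\<in>Poly_Mapping.keys P. Poly_Mapping.single m (Poly_Mapping.lookup P m))"
  by (rule poly_mapping_eqI) (auto simp: lookup_sum lookup_single when_def in_keys_iff)

lemma mp_eval_mult:
  assumes c: "rhom c"
  shows "mp_eval c f (P * Q) = mp_eval c f P * mp_eval c f Q"
proof -
  have "P * Q = (\<Sum>m\<in>Poly_Mapping.keys P. \<Sum>n\<in>Poly_Mapping.keys Q.
      Poly_Mapping.single (m + n) (Poly_Mapping.lookup P m * Poly_Mapping.lookup Q n))"
    by (subst (1) mpoly_sum_single[of P], subst (1) mpoly_sum_single[of Q])
       (simp add: sum_product mult_single)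
  then have "mp_eval c f (P * Q) = (\<Sum>m\<in>Poly_Mapping.keys P. \<Sum>n\<in>Poly_Mapping.keys Q.
      (c (Poly_Mapping.lookup P m) * mon f m) * (c (Poly_Mapping.lookup Q n) * mon f n))"
    by (simp add: mp_eval_sum[OF c] mp_eval_single[OF c] rhom.mult[OF c] mon_add mult_ac)
  then show ?thesis
    by (simp add: mp_eval_def sum_product)
qed

lemma mp_eval_mconst: "rhom c \<Longrightarrow> mp_eval c f (mconst a) = c a"
  by (simp add: mconst_def mp_eval_single)

lemma mp_eval_mvar: "rhom c \<Longrightarrow> mp_eval c f (mvar i) = f i"
  by (simp add: mvar_def mp_eval_single rhom.one)

lemma mconst_1: "mconst 1 = 1"
  by (simp add: mconst_def)

lemma rhom_mconst: "rhom mconst"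
  by unfold_locales (simp_all add: mconst_def single_add mult_single)

lemma rhom_mp_eval: "rhom c \<Longrightarrow> rhom (mp_eval c f)"
  using mp_eval_mconst[of c f 1]
  by unfold_locales (simp_all add: mp_eval_add mp_eval_mult rhom.one mconst_1)

lemma psubst_eq_mp_eval: "psubst = mp_eval mconst"
  by (simp add: psubst_def mp_eval_def mon_def fun_eq_iff)

lemma rhom_psubst: "rhom (psubst f)"
  unfolding psubst_eq_mp_eval by (rule rhom_mp_eval[OF rhom_mconst])

lemma psubst_mconst [simp]: "psubst f (mconst a) = mconst a"
  by (simp add: psubst_eq_mp_eval mp_eval_mconst rhom_mconst)

lemma psubst_mvar [simp]: "psubst f (mvar i) = f i"
  by (simp add: psubst_eq_mp_eval mp_eval_mvar rhom_mconst)

lemma lookup_mconst: "Poly_Mapping.lookup (mconst a) m = (a when m = 0)"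
  by (auto simp: mconst_def lookup_single when_def)

lemma mconst_eq_iff [simp]: "mconst a = mconst b \<longleftrightarrow> a = b"
  by (auto simp: mconst_def dest: injD[OF inj_single])

lemma mconst_0 [simp]: "mconst 0 = 0"
  by (simp add: mconst_def)

lemma mconst_eq_0_iff [simp]: "mconst a = 0 \<longleftrightarrow> a = 0"
  using mconst_eq_iff[of a 0] by (simp del: mconst_eq_iff)

lemma mvar_neq_0: "(mvar i :: 'a::comm_ring_1 mpoly) \<noteq> 0"
proof
  assume "(mvar i :: 'a mpoly) = 0"
  then have "Poly_Mapping.lookup (mvar i :: 'a mpoly) (Poly_Mapping.single i 1) = 0" by simp
  then show False by (simp add: mvar_def)
qed

lemma lookup_mult_single:
  fixes P :: "'a::comm_ring_1 mpoly"
  shows "Poly_Mapping.lookup (Poly_Mapping.single m a * P) (m + n) = a * Poly_Mapping.lookup P n"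
proof -
  have "Poly_Mapping.single m a * P =
      (\<Sum>k\<in>Poly_Mapping.keys P. Poly_Mapping.single (m + k) (a * Poly_Mapping.lookup P k))"
    by (subst (1) mpoly_sum_single[of P]) (simp add: sum_distrib_left mult_single)
  then show ?thesis
    by (auto simp: lookup_sum lookup_single when_def in_keys_iff)
qed

lemma lookup_mconst_mult: "Poly_Mapping.lookup (mconst a * P) n = a * Poly_Mapping.lookup P n"
  using lookup_mult_single[of 0 a P n] by (simp add: mconst_def)

lemma CHAR_mpoly: "CHAR('a::comm_ring_1 mpoly) = CHAR('a)"
proof (rule CHAR_eqI)
  show "of_nat CHAR('a) = (0 :: 'a mpoly)"
    by (metis mconst_0 of_nat_CHAR rhom.of_nat rhom_mconst)
  fix n assume "of_nat n = (0 :: 'a mpoly)"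
  then have "mconst (of_nat n :: 'a) = 0" by (simp add: rhom.of_nat[OF rhom_mconst])
  then show "CHAR('a) dvd n" by (simp add: of_nat_eq_0_iff_char_dvd)
qed

text \<open>Arbitrary index sets are allowed because the polynomials free of \<open>x_0\<close>,
  with index set \<open>{1..<r}\<close>, are as important as the whole coordinate ring.\<close>

definition mpolys :: "nat set \<Rightarrow> 'a::comm_ring_1 mpoly set" where
  "mpolys I = {P. \<forall>m\<in>Poly_Mapping.keys P. Poly_Mapping.keys m \<subseteq> I}"

lemma polys_eq_mpolys: "polys n = mpolys {..<n}"
  by (simp add: polys_def mpolys_def)

lemma mpolys_UNIV [simp]: "mpolys UNIV = UNIV"
  by (simp add: mpolys_def)

lemma mpolys_mono: "I \<subseteq> J \<Longrightarrow> mpolys I \<subseteq> mpolys J"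
  by (auto simp: mpolys_def)

lemma mpolys_mconst [simp]: "mconst c \<in> mpolys I"
  by (auto simp: mpolys_def mconst_def split: if_splits)

lemma mpolys_mvar [simp]: "i \<in> I \<Longrightarrow> mvar i \<in> mpolys I"
  by (auto simp: mpolys_def mvar_def split: if_splits)

lemma mpolys_0 [simp]: "0 \<in> mpolys I"
  by (simp add: mpolys_def)

lemma mpolys_1 [simp]: "1 \<in> mpolys I"
  using mpolys_mconst[of 1] by (simp add: mconst_1)

lemma mpolys_add: "P \<in> mpolys I \<Longrightarrow> Q \<in> mpolys I \<Longrightarrow> P + Q \<in> mpolys I"
  unfolding mpolys_def using keys_add[of P Q] by blast

lemma mpolys_uminus: "P \<in> mpolys I \<Longrightarrow> - P \<in> mpolys I"
  by (simp add: mpolys_def in_keys_iff)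

lemma mpolys_mult: "P \<in> mpolys I \<Longrightarrow> Q \<in> mpolys I \<Longrightarrow> P * Q \<in> mpolys I"
proof -
  assume P: "P \<in> mpolys I" and Q: "Q \<in> mpolys I"
  { fix m assume "m \<in> Poly_Mapping.keys (P * Q)"
    then obtain a b where "m = a + b" "a \<in> Poly_Mapping.keys P" "b \<in> Poly_Mapping.keys Q"
      using keys_mult[of P Q] by blast
    then have "Poly_Mapping.keys m \<subseteq> I"
      using keys_add[of a b] P Q by (force simp: mpolys_def) }
  then show ?thesis by (simp add: mpolys_def)
qed

lemma mpolys_diff: "P \<in> mpolys I \<Longrightarrow> Q \<in> mpolys I \<Longrightarrow> P - Q \<in> mpolys I"
  using mpolys_add[of P I "- Q"] mpolys_uminus[of Q I] by simp

lemma mpolys_power: "P \<in> mpolys I \<Longrightarrow> P ^ n \<in> mpolys I"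
  by (induction n) (auto simp: mpolys_mult)

lemma mpolys_sum: "(\<And>x. x \<in> A \<Longrightarrow> f x \<in> mpolys I) \<Longrightarrow> sum f A \<in> mpolys I"
  by (induction A rule: infinite_finite_induct) (auto simp: mpolys_add)

lemma mpolys_prod: "(\<And>x. x \<in> A \<Longrightarrow> f x \<in> mpolys I) \<Longrightarrow> prod f A \<in> mpolys I"
  by (induction A rule: infinite_finite_induct) (auto simp: mpolys_mult)

lemma single_eq_prod:
  "Poly_Mapping.single m a = mconst a * (\<Prod>i\<in>Poly_Mapping.keys m. mvar i ^ Poly_Mapping.lookup m i)"
proof -
  have pow: "(mvar i :: 'a mpoly) ^ n = Poly_Mapping.single (Poly_Mapping.single i n) 1" for i n
    by (induction n) (auto simp: mvar_def mult_single simp flip: single_add)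
  have "(\<Prod>i\<in>A. mvar i ^ Poly_Mapping.lookup m i) =
     (Poly_Mapping.single (\<Sum>i\<in>A. Poly_Mapping.single i (Poly_Mapping.lookup m i)) 1 :: 'a mpoly)"
    if "finite A" for A
    using that by induction (auto simp: pow mult_single)
  moreover have "(\<Sum>i\<in>Poly_Mapping.keys m. Poly_Mapping.single i (Poly_Mapping.lookup m i)) = m"
    by (rule poly_mapping_eqI) (auto simp: lookup_sum lookup_single when_def in_keys_iff)
  ultimately show ?thesis by (simp add: mconst_def mult_single)
qed

lemma mpolys_induct [consumes 1, case_names const var add mult]:
  assumes P: "P \<in> mpolys I"
    and const: "\<And>c. Q (mconst c)"
    and var: "\<And>i. i \<in> I \<Longrightarrow> Q (mvar i)"
    and add: "\<And>P R. P \<in> mpolys I \<Longrightarrow> R \<in> mpolys I \<Longrightarrow> Q P \<Longrightarrow> Q R \<Longrightarrow> Q (P + R)"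
    and mult: "\<And>P R. P \<in> mpolys I \<Longrightarrow> R \<in> mpolys I \<Longrightarrow> Q P \<Longrightarrow> Q R \<Longrightarrow> Q (P * R)"
  shows "Q P"
proof -
  have pow: "Q (mvar i ^ n)" if "i \<in> I" for i n
    by (induction n)
       (use that const[of 1] in \<open>auto simp: mconst_1 intro!: mult var mpolys_power\<close>)
  have mono: "Q (\<Prod>i\<in>A. mvar i ^ e i)" if "finite A" "A \<subseteq> I" for A e
    using that
  proof (induction A)
    case empty
    then show ?case using const[of 1] by (simp add: mconst_1)
  next
    case (insert x F)
    then show ?case by (auto intro!: mult pow mpolys_power mpolys_prod)
  qed
  have single: "Q (Poly_Mapping.single m a) \<and> Poly_Mapping.single m a \<in> mpolys I"
    if "Poly_Mapping.keys m \<subseteq> I" for m a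
    unfolding single_eq_prod using that
    by (auto intro!: mult const mono mpolys_mult mpolys_prod mpolys_power)
  have "Q (\<Sum>m\<in>A. Poly_Mapping.single m (f m)) \<and> (\<Sum>m\<in>A. Poly_Mapping.single m (f m)) \<in> mpolys I"
    if "finite A" "\<forall>m\<in>A. Poly_Mapping.keys m \<subseteq> I" for A f
    using that
  proof (induction A)
    case empty
    then show ?case using const[of 0] by simp
  next
    case (insert x F)
    then show ?case using single by (auto intro!: add mpolys_add)
  qed
  from this[of "Poly_Mapping.keys P" "Poly_Mapping.lookup P"] P show ?thesis
    by (simp add: mpolys_def flip: mpoly_sum_single)
qed

lemmas mpoly_induct [case_names const var add mult] =
  mpolys_induct[where I = UNIV, simplified]

lemma mpolys_hom_eqI:
  assumes "P \<in> mpolys I" "rhom g" "rhom h" "\<And>c. g (mconst c) = h (mconst c)"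
    "\<And>i. i \<in> I \<Longrightarrow> g (mvar i) = h (mvar i)"
  shows "g P = h P"
  using assms(1)
  by (induction rule: mpolys_induct)
     (auto simp: assms rhom.add[OF assms(2)] rhom.add[OF assms(3)] rhom.mult[OF assms(2)]
       rhom.mult[OF assms(3)])

lemmas mpoly_hom_eqI = mpolys_hom_eqI[where I = UNIV, simplified]

lemma mpolys_psubst:
  assumes "P \<in> mpolys I" "\<And>i. i \<in> I \<Longrightarrow> f i \<in> mpolys J"
  shows "psubst f P \<in> mpolys J"
  using assms(1)
  by (induction rule: mpolys_induct)
     (auto simp: assms rhom.add[OF rhom_psubst] rhom.mult[OF rhom_psubst] mpolys_add mpolys_mult)

lemma psubst_cong: "P \<in> mpolys I \<Longrightarrow> (\<And>i. i \<in> I \<Longrightarrow> f i = g i) \<Longrightarrow> psubst f P = psubst g P"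
  by (rule mpolys_hom_eqI) (auto simp: rhom_psubst)

lemma psubst_psubst: "psubst f (psubst g P) = psubst (\<lambda>i. psubst f (g i)) P"
  by (rule mpoly_hom_eqI[where g = "\<lambda>P. psubst f (psubst g P)"])
     (simp_all add: rhom_psubst rhom_comp[OF rhom_psubst rhom_psubst])

lemma psubst_id: "psubst mvar P = P"
  by (rule mpoly_hom_eqI[where h = "\<lambda>x. x"]) (simp_all add: rhom_psubst rhom_id)


section \<open>Partial derivatives\<close>

definition shift :: "nat \<Rightarrow> 'a::comm_ring_1 mpoly \<Rightarrow> 'a mpoly poly" where
  "shift i = mp_eval (\<lambda>c. [:mconst c:]) (\<lambda>j. if j = i then [:mvar j, 1:] else [:mvar j:])"

lemma rhom_pconst: "rhom (\<lambda>c. [:c:])"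
  by unfold_locales (simp_all add: one_pCons)

lemma rhom_shift: "rhom (shift i)"
  unfolding shift_def by (rule rhom_mp_eval, rule rhom_comp[OF rhom_pconst rhom_mconst])

lemma shift_mconst: "shift i (mconst c) = [:mconst c:]"
  unfolding shift_def by (rule mp_eval_mconst, rule rhom_comp[OF rhom_pconst rhom_mconst])

lemma shift_mvar: "shift i (mvar j) = (if j = i then [:mvar j, 1:] else [:mvar j:])"
  unfolding shift_def by (rule mp_eval_mvar, rule rhom_comp[OF rhom_pconst rhom_mconst])

text \<open>Taylor coefficient of \<open>P\<close> along \<open>x\<^sub>i\<close>: the Leibniz rule is the product rule for coefficients.\<close>

definition pdiff :: "nat \<Rightarrow> 'a::comm_ring_1 mpoly \<Rightarrow> 'a mpoly" where
  "pdiff i P = coeff (shift i P) 1"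

lemma rhom_coeff_0: "rhom (\<lambda>q::'a::comm_ring_1 poly. coeff q 0)"
  by unfold_locales (simp_all add: coeff_mult)

lemma coeff_shift_0: "coeff (shift i P) 0 = P"
  by (rule mpoly_hom_eqI[where g = "\<lambda>P. coeff (shift i P) 0" and h = "\<lambda>x. x"])
     (simp_all add: rhom_comp[OF rhom_coeff_0 rhom_shift] rhom_id shift_mconst shift_mvar)

lemma pdiff_add: "pdiff i (P + Q) = pdiff i P + pdiff i Q"
  by (simp add: pdiff_def rhom.add[OF rhom_shift])

lemma pdiff_mult: "pdiff i (P * Q) = pdiff i P * Q + P * pdiff i Q"
  by (simp add: pdiff_def rhom.mult[OF rhom_shift] coeff_mult atMost_Suc coeff_shift_0)

lemma pdiff_mconst [simp]: "pdiff i (mconst c) = 0"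
  by (simp add: pdiff_def shift_mconst)

lemma pdiff_mvar: "pdiff i (mvar j) = (if i = j then 1 else 0)"
  by (simp add: pdiff_def shift_mvar)

lemma pdiff_0 [simp]: "pdiff i 0 = 0"
  using pdiff_mconst[of i 0] by (simp del: pdiff_mconst)

lemma pdiff_sum: "pdiff i (sum f A) = (\<Sum>x\<in>A. pdiff i (f x))"
  by (induction A rule: infinite_finite_induct) (auto simp: pdiff_add)

lemma pdiff_mconst_mult: "pdiff i (mconst c * P) = mconst c * pdiff i P"
  by (simp add: pdiff_mult)

lemma pdiff_1 [simp]: "pdiff i 1 = 0"
  using pdiff_mconst[of i 1] by (simp add: mconst_1 del: pdiff_mconst)

lemma pdiff_power: "pdiff i (P ^ n) = of_nat n * P ^ (n - 1) * pdiff i P"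
proof (induction n)
  case (Suc n)
  then show ?case by (cases n) (auto simp: pdiff_mult algebra_simps)
qed simp

lemma mpolys_pdiff: "P \<in> mpolys I \<Longrightarrow> pdiff i P \<in> mpolys I"
  by (induction rule: mpolys_induct)
     (auto simp: pdiff_mvar pdiff_add pdiff_mult mpolys_add mpolys_mult)


section \<open>Homogeneous components\<close>

definition mdeg :: "(nat \<Rightarrow>\<^sub>0 nat) \<Rightarrow> nat" where
  "mdeg m = (\<Sum>i\<in>Poly_Mapping.keys m. Poly_Mapping.lookup m i)"

lemma mdeg_superset:
  "finite A \<Longrightarrow> Poly_Mapping.keys m \<subseteq> A \<Longrightarrow> mdeg m = (\<Sum>i\<in>A. Poly_Mapping.lookup m i)"
  unfolding mdeg_def by (rule sum.mono_neutral_left) (auto simp: in_keys_iff)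

lemma mdeg_add: "mdeg (m + n) = mdeg m + mdeg n"
proof -
  let ?A = "Poly_Mapping.keys m \<union> Poly_Mapping.keys n"
  have "Poly_Mapping.keys (m + n) \<subseteq> ?A" by (rule keys_add)
  then show ?thesis
    by (simp add: mdeg_superset[of ?A] lookup_add sum.distrib)
qed

lemma homogeneous_def': "homogeneous n d = {P\<in>polys n. \<forall>m\<in>Poly_Mapping.keys P. mdeg m = d}"
  by (simp add: homogeneous_def mdeg_def)

definition hcomp :: "nat \<Rightarrow> 'a::comm_ring_1 mpoly \<Rightarrow> 'a mpoly" where
  "hcomp d P = (\<Sum>m\<in>{m\<in>Poly_Mapping.keys P. mdeg m = d}. Poly_Mapping.single m (Poly_Mapping.lookup P m))"

lemma lookup_hcomp: "Poly_Mapping.lookup (hcomp d P) m = (Poly_Mapping.lookup P m when mdeg m = d)"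
  by (auto simp: hcomp_def lookup_sum lookup_single when_def in_keys_iff)

lemma hcomp_add: "hcomp d (P + Q) = hcomp d P + hcomp d Q"
  by (rule poly_mapping_eqI) (auto simp: lookup_hcomp lookup_add when_def)

lemma hcomp_0 [simp]: "hcomp d 0 = 0"
  by (simp add: hcomp_def)

lemma hcomp_sum: "hcomp d (sum f A) = (\<Sum>x\<in>A. hcomp d (f x))"
  by (induction A rule: infinite_finite_induct) (auto simp: hcomp_add)

lemma hcomp_homogeneous: "P \<in> polys n \<Longrightarrow> hcomp d P \<in> homogeneous n d"
  by (auto simp: homogeneous_def' polys_def in_keys_iff lookup_hcomp when_def split: if_splits)

lemma hcomp_single:
  "hcomp d (Poly_Mapping.single m a) = (if mdeg m = d then Poly_Mapping.single m a else 0)"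
  by (rule poly_mapping_eqI) (auto simp: lookup_hcomp lookup_single when_def)

lemma hcomp_mult:
  assumes "\<forall>m\<in>Poly_Mapping.keys L. mdeg m = e"
  shows "hcomp (d + e) (L * P) = L * hcomp d P"
proof -
  have LP: "L * P = (\<Sum>m\<in>Poly_Mapping.keys L. \<Sum>n\<in>Poly_Mapping.keys P.
      Poly_Mapping.single (m + n) (Poly_Mapping.lookup L m * Poly_Mapping.lookup P n))"
    by (subst (1) mpoly_sum_single[of L], subst (1) mpoly_sum_single[of P])
       (simp add: sum_product mult_single)
  have "L * hcomp d P = (\<Sum>m\<in>Poly_Mapping.keys L. \<Sum>n\<in>{n\<in>Poly_Mapping.keys P. mdeg n = d}.
      Poly_Mapping.single (m + n) (Poly_Mapping.lookup L m * Poly_Mapping.lookup P n))"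
    unfolding hcomp_def by (subst (1) mpoly_sum_single[of L]) (simp add: sum_product mult_single)
  also have "\<dots> = hcomp (d + e) (L * P)"
    unfolding LP hcomp_sum hcomp_single
    by (rule sum.cong, simp, rule sum.mono_neutral_cong_left) (use assms in \<open>auto simp: mdeg_add\<close>)
  finally show ?thesis by simp
qed

lemma homogeneousD: "P \<in> homogeneous n d \<Longrightarrow> P \<in> mpolys {..<n}"
  by (simp add: homogeneous_def polys_eq_mpolys)

lemma homogeneous_0: "0 \<in> homogeneous n d"
  by (simp add: homogeneous_def polys_eq_mpolys)

lemma homogeneous_add: "P \<in> homogeneous n d \<Longrightarrow> Q \<in> homogeneous n d \<Longrightarrow> P + Q \<in> homogeneous n d"
  using keys_add[of P Q] by (fastforce simp: homogeneous_def' polys_eq_mpolys mpolys_add)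

lemma homogeneous_mult:
  assumes "P \<in> homogeneous n d" "Q \<in> homogeneous n e"
  shows "P * Q \<in> homogeneous n (d + e)"
proof -
  have "mdeg m = d + e" if "m \<in> Poly_Mapping.keys (P * Q)" for m
    using that keys_mult[of P Q] assms by (force simp: homogeneous_def' mdeg_add)
  then show ?thesis using assms by (simp add: homogeneous_def' polys_eq_mpolys mpolys_mult)
qed

lemma homogeneous_mvar: "i < n \<Longrightarrow> mvar i \<in> homogeneous n 1"
  by (auto simp: homogeneous_def' polys_eq_mpolys) (auto simp: mvar_def mdeg_def split: if_splits)

lemma mon_mult: "mon (\<lambda>i. f * g i) m = f ^ mdeg m * mon g m"
  by (simp add: mon_def mdeg_def power_mult_distrib prod.distrib power_sum)

lemma psubst_mult_homogeneous:
  assumes "P \<in> homogeneous n d"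
  shows "psubst (\<lambda>i. f * g i) P = f ^ d * psubst g P"
  using assms unfolding psubst_eq_mp_eval mp_eval_def sum_distrib_left
  by (intro sum.cong) (auto simp: mon_mult homogeneous_def' mult_ac)

text \<open>Allows a denominator that survives \<open>h\<close> to be replaced by one of its
  homogeneous components without losing this property.\<close>

lemma hom_sum_hcomp:
  assumes "rhom h" "h P \<noteq> 0"
  shows "\<exists>d. h (hcomp d P) \<noteq> 0"
proof (rule ccontr)
  assume *: "\<not> ?thesis"
  have "P = (\<Sum>d\<in>mdeg ` Poly_Mapping.keys P. hcomp d P)"
  proof (rule poly_mapping_eqI)
    fix m
    show "Poly_Mapping.lookup P m =
        Poly_Mapping.lookup (\<Sum>d\<in>mdeg ` Poly_Mapping.keys P. hcomp d P) m"
      by (cases "m \<in> Poly_Mapping.keys P") (simp_all add: lookup_sum lookup_hcomp when_def in_keys_iff)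
  qed
  then have "h P = (\<Sum>d\<in>mdeg ` Poly_Mapping.keys P. h (hcomp d P))"
    using rhom.sum[OF assms(1), of "\<lambda>d. hcomp d P" "mdeg ` Poly_Mapping.keys P"] by simp
  with * assms(2) show False by simp
qed

section \<open>Linear algebra over a subring of an integral domain\<close>

locale subring =
  fixes A :: "'b::idom set"
  assumes one: "1 \<in> A" and diff: "x \<in> A \<Longrightarrow> y \<in> A \<Longrightarrow> x - y \<in> A"
    and mult: "x \<in> A \<Longrightarrow> y \<in> A \<Longrightarrow> x * y \<in> A"
begin

lemma zero: "0 \<in> A"
  using diff[OF one one] by simp

lemma uminus: "x \<in> A \<Longrightarrow> - x \<in> A"
  using diff[OF zero, of x] by simp

lemma add: "x \<in> A \<Longrightarrow> y \<in> A \<Longrightarrow> x + y \<in> A"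
  using diff[of x "- y"] uminus by simp

lemma sum: "(\<And>x. x \<in> X \<Longrightarrow> f x \<in> A) \<Longrightarrow> sum f X \<in> A"
  by (induction X rule: infinite_finite_induct) (auto simp: zero add)

lemma prod: "(\<And>x. x \<in> X \<Longrightarrow> f x \<in> A) \<Longrightarrow> prod f X \<in> A"
  by (induction X rule: infinite_finite_induct) (auto simp: one mult)

lemma power: "x \<in> A \<Longrightarrow> x ^ n \<in> A"
  by (induction n) (auto simp: one mult)

lemma of_nat: "of_nat n \<in> A"
  by (induction n) (auto simp: zero one add)

text \<open>Fraction-free Gaussian elimination, by induction on the number of equations: one
  equation is used up with a pivot, and the others are cross-multiplied with it.\<close>

lemma ex_linear_dependence:
  assumes "finite J" "finite I" "card J < card I"
    and "\<And>i j. i \<in> I \<Longrightarrow> j \<in> J \<Longrightarrow> c i j \<in> A"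
  shows "\<exists>a. (\<forall>i\<in>I. a i \<in> A) \<and> (\<exists>i\<in>I. a i \<noteq> 0) \<and> (\<forall>j\<in>J. (\<Sum>i\<in>I. a i * c i j) = 0)"
  using assms
proof (induction J arbitrary: I c rule: finite_induct)
  case empty
  then have "I \<noteq> {}" by auto
  then show ?case by (intro exI[of _ "\<lambda>_. 1"]) (auto simp: one)
next
  case (insert j J)
  show ?case
  proof (cases "\<forall>i\<in>I. c i j = 0")
    case True
    obtain a where "\<forall>i\<in>I. a i \<in> A" "\<exists>i\<in>I. a i \<noteq> 0" "\<forall>j\<in>J. (\<Sum>i\<in>I. a i * c i j) = 0"
      using insert.IH[of I c] insert.prems insert.hyps by auto
    with True show ?thesis by (intro exI[of _ a]) auto
  next
    case False
    then obtain i0 where i0: "i0 \<in> I" "c i0 j \<noteq> 0" by auto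
    define I' where "I' = I - {i0}"
    have I: "I = insert i0 I'" "finite I'" "i0 \<notin> I'"
      using i0 insert.prems by (auto simp: I'_def)
    define c' where "c' = (\<lambda>i k. c i0 j * c i k - c i j * c i0 k)"
    have "card J < card I'" using insert.hyps insert.prems I by auto
    moreover have "c' i k \<in> A" if "i \<in> I'" "k \<in> J" for i k
      using that insert.prems i0 I by (auto simp: c'_def intro!: diff mult)
    ultimately obtain a where a: "\<forall>i\<in>I'. a i \<in> A" "\<exists>i\<in>I'. a i \<noteq> 0"
        "\<forall>j\<in>J. (\<Sum>i\<in>I'. a i * c' i j) = 0"
      using insert.IH[of I' c'] I by auto
    \<comment> \<open>Back substitution: the old unknowns are scaled by the pivot, and the value at
      \<open>i0\<close> is the one that makes equation \<open>j\<close> hold.\<close>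
    define b where "b = (\<lambda>i. if i = i0 then - (\<Sum>i\<in>I'. a i * c i j) else a i * c i0 j)"
    have sb: "(\<Sum>i\<in>I. b i * c i k) = - (\<Sum>i\<in>I'. a i * c i j) * c i0 k + (\<Sum>i\<in>I'. a i * c i0 j * c i k)" for k
      using I by (auto simp: b_def intro!: sum.cong)
    have "(\<Sum>i\<in>I. b i * c i k) = 0" if "k \<in> insert j J" for k
    proof (cases "k = j")
      case True
      then show ?thesis by (simp add: sb sum_distrib_right mult_ac sum_distrib_left)
    next
      case False
      with that have "(\<Sum>i\<in>I'. a i * c' i k) = 0" using a by auto
      then show ?thesis
        by (simp add: sb c'_def sum_distrib_left sum_distrib_right sum_subtractf algebra_simps)
    qed
    moreover have "\<forall>i\<in>I. b i \<in> A"
      using a insert.prems i0 I by (auto simp: b_def intro!: uminus sum mult)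
    moreover have "\<exists>i\<in>I. b i \<noteq> 0"
      using a I i0 by (auto simp: b_def)
    ultimately show ?thesis by blast
  qed
qed

definition indep :: "'i set \<Rightarrow> ('i \<Rightarrow> 'b) \<Rightarrow> bool" where
  "indep J m \<longleftrightarrow>
     (\<forall>c. (\<forall>j\<in>J. c j \<in> A) \<and> (\<Sum>j\<in>J. c j * m j) = 0 \<longrightarrow> (\<forall>j\<in>J. c j = 0))"

text \<open>The trace on the ambient ring of the span over the field of fractions of \<open>A\<close>.\<close>

definition rspan :: "'i set \<Rightarrow> ('i \<Rightarrow> 'b) \<Rightarrow> 'b set" where
  "rspan J m = {z. \<exists>d c. d \<in> A \<and> d \<noteq> 0 \<and> (\<forall>j\<in>J. c j \<in> A) \<and> d * z = (\<Sum>j\<in>J. c j * m j)}"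

lemma indepD:
  "indep J m \<Longrightarrow> (\<And>j. j \<in> J \<Longrightarrow> c j \<in> A) \<Longrightarrow> (\<Sum>j\<in>J. c j * m j) = 0 \<Longrightarrow> j \<in> J \<Longrightarrow> c j = 0"
  unfolding indep_def by blast

lemma rspanI:
  "d \<in> A \<Longrightarrow> d \<noteq> 0 \<Longrightarrow> (\<And>j. j \<in> J \<Longrightarrow> c j \<in> A) \<Longrightarrow> d * z = (\<Sum>j\<in>J. c j * m j) \<Longrightarrow> z \<in> rspan J m"
  unfolding rspan_def by blast

lemma rspanE:
  assumes "z \<in> rspan J m"
  obtains d c where "d \<in> A" "d \<noteq> 0" "\<forall>j\<in>J. c j \<in> A" "d * z = (\<Sum>j\<in>J. c j * m j)"
  using assms unfolding rspan_def by blast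

lemma rspan_sumI: "(\<And>j. j \<in> J \<Longrightarrow> c j \<in> A) \<Longrightarrow> (\<Sum>j\<in>J. c j * m j) \<in> rspan J m"
  by (rule rspanI[of 1]) (auto simp: one)

lemma rspan_0: "0 \<in> rspan J m"
  by (rule rspanI[of 1 _ "\<lambda>_. 0"]) (auto simp: one zero)

lemma rspan_base: "finite J \<Longrightarrow> j \<in> J \<Longrightarrow> m j \<in> rspan J m"
  by (rule rspanI[of 1 _ "\<lambda>i. if i = j then 1 else 0"])
     (auto simp: one zero if_distrib[of "\<lambda>x. x * _"] cong: if_cong)

lemma rspan_add:
  assumes "x \<in> rspan J m" "y \<in> rspan J m"
  shows "x + y \<in> rspan J m"
proof -
  obtain d c where 1: "d \<in> A" "d \<noteq> 0" "\<forall>j\<in>J. c j \<in> A" "d * x = (\<Sum>j\<in>J. c j * m j)"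
    using assms(1) by (rule rspanE)
  obtain e b where 2: "e \<in> A" "e \<noteq> 0" "\<forall>j\<in>J. b j \<in> A" "e * y = (\<Sum>j\<in>J. b j * m j)"
    using assms(2) by (rule rspanE)
  show ?thesis
  proof (rule rspanI[of "d * e"])
    have "d * e * (x + y) = e * (d * x) + d * (e * y)" by (simp add: algebra_simps)
    also have "\<dots> = (\<Sum>j\<in>J. (e * c j + d * b j) * m j)"
      unfolding 1 2 by (simp add: sum_distrib_left sum.distrib algebra_simps)
    finally show "d * e * (x + y) = (\<Sum>j\<in>J. (e * c j + d * b j) * m j)" .
  qed (use 1 2 in \<open>auto intro!: mult add\<close>)
qed

lemma rspan_scale:
  assumes "a \<in> A" "x \<in> rspan J m"
  shows "a * x \<in> rspan J m"
proof -
  obtain d c where 1: "d \<in> A" "d \<noteq> 0" "\<forall>j\<in>J. c j \<in> A" "d * x = (\<Sum>j\<in>J. c j * m j)"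
    using assms(2) by (rule rspanE)
  have "d * (a * x) = (\<Sum>j\<in>J. (a * c j) * m j)"
    using 1(4) by (simp add: sum_distrib_left mult_ac flip: mult.left_commute[of a])
  then show ?thesis by (rule rspanI[rotated -1]) (use 1 assms in \<open>auto intro!: mult\<close>)
qed

lemma rspan_uminus: "x \<in> rspan J m \<Longrightarrow> - x \<in> rspan J m"
  using rspan_scale[of "- 1" x] uminus[OF one] by simp

lemma rspan_diff: "x \<in> rspan J m \<Longrightarrow> y \<in> rspan J m \<Longrightarrow> x - y \<in> rspan J m"
  using rspan_add[of x J m "- y"] rspan_uminus[of y J m] by simp

lemma rspan_sum: "(\<And>x. x \<in> X \<Longrightarrow> f x \<in> rspan J m) \<Longrightarrow> sum f X \<in> rspan J m"
  by (induction X rule: infinite_finite_induct) (auto simp: rspan_0 rspan_add)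

lemma rspan_cancel:
  assumes "a \<in> A" "a \<noteq> 0" "a * x \<in> rspan J m"
  shows "x \<in> rspan J m"
proof -
  obtain d c where 1: "d \<in> A" "d \<noteq> 0" "\<forall>j\<in>J. c j \<in> A" "d * (a * x) = (\<Sum>j\<in>J. c j * m j)"
    using assms(3) by (rule rspanE)
  show ?thesis by (rule rspanI[of "d * a" _ c]) (use 1 assms in \<open>auto intro!: mult simp: mult_ac\<close>)
qed

lemma rspan_trans:
  assumes "\<And>j. j \<in> J \<Longrightarrow> m j \<in> rspan J' m'" "z \<in> rspan J m"
  shows "z \<in> rspan J' m'"
proof -
  obtain d c where 1: "d \<in> A" "d \<noteq> 0" "\<forall>j\<in>J. c j \<in> A" "d * z = (\<Sum>j\<in>J. c j * m j)"
    using assms(2) by (rule rspanE)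
  have "(\<Sum>j\<in>J. c j * m j) \<in> rspan J' m'"
    using 1 assms by (intro rspan_sum rspan_scale) auto
  then show ?thesis using rspan_cancel[of d z] 1 by simp
qed

lemma rspan_mono:
  assumes "finite J" "I \<subseteq> J" "z \<in> rspan I m"
  shows "z \<in> rspan J m"
  by (rule rspan_trans[OF _ assms(3)]) (use assms in \<open>auto intro: rspan_base\<close>)

lemma indep_insert:
  assumes "finite I" "k \<notin> I" "indep I m" "m k \<notin> rspan I m"
  shows "indep (insert k I) m"
  unfolding indep_def
proof (intro allI impI; elim conjE)
  fix c assume c: "\<forall>j\<in>insert k I. c j \<in> A" and s: "(\<Sum>j\<in>insert k I. c j * m j) = 0"
  have s': "c k * m k + (\<Sum>j\<in>I. c j * m j) = 0" using s assms by simp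
  have "c k = 0"
  proof (rule ccontr)
    assume "c k \<noteq> 0"
    moreover have "c k * m k = (\<Sum>j\<in>I. (- c j) * m j)"
      using s' by (simp add: sum_negf eq_neg_iff_add_eq_0)
    ultimately have "m k \<in> rspan I m" using c
      by (intro rspanI[where d = "c k" and c = "\<lambda>j. - c j"]) (auto intro: uminus)
    with assms show False by simp
  qed
  with s' c assms(3) show "\<forall>j\<in>insert k I. c j = 0" by (auto intro: indepD)
qed

text \<open>Greedy selection. The basis is a set of indices, not of vectors, so repeated values of
  \<open>m\<close> do no harm.\<close>

lemma ex_basis:
  assumes "finite J"
  shows "\<exists>I\<subseteq>J. indep I m \<and> (\<forall>j\<in>J. m j \<in> rspan I m)"
  using assms
proof induction
  case empty
  then show ?case by (simp add: indep_def)
next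
  case (insert k J)
  then obtain I where I: "I \<subseteq> J" "indep I m" "\<forall>j\<in>J. m j \<in> rspan I m" by blast
  have fin: "finite I" using I insert by (auto intro: finite_subset)
  show ?case
  proof (cases "m k \<in> rspan I m")
    case True
    with I show ?thesis by (intro exI[of _ I]) auto
  next
    case False
    have "indep (insert k I) m"
      by (rule indep_insert) (use False I insert fin in auto)
    moreover have "m j \<in> rspan (insert k I) m" if "j \<in> insert k J" for j
      using that I fin rspan_mono[of "insert k I" I "m j" m] rspan_base[of "insert k I" k m] by auto
    ultimately show ?thesis using I by (intro exI[of _ "insert k I"]) auto
  qed
qed

text \<open>Elimination in which every pivot is chosen with nonzero image under \<open>h\<close>, so that the common
  denominator \<open>D\<close> survives \<open>h\<close>.\<close>

lemma ex_combination_hom: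
  fixes h :: "'b \<Rightarrow> 'c::idom" and v :: "'k \<Rightarrow> 'l \<Rightarrow> 'b"
  assumes h: "rhom h" and V: "finite V" and "finite I"
    and "\<And>k l. k \<in> V \<Longrightarrow> l \<in> I \<Longrightarrow> v k l \<in> A" and "\<And>l. l \<in> I \<Longrightarrow> u l \<in> A"
    and "\<And>i. i \<in> I \<Longrightarrow> \<exists>c d. d \<noteq> 0 \<and> (\<forall>l\<in>I. (\<Sum>k\<in>V. c k * h (v k l)) = (if l = i then d else 0))"
  shows "\<exists>D c. D \<in> A \<and> h D \<noteq> 0 \<and> (\<forall>k\<in>V. c k \<in> A) \<and> (\<forall>l\<in>I. D * u l = (\<Sum>k\<in>V. c k * v k l))"
  using assms(3-)
proof (induction I arbitrary: v u rule: finite_induct)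
  case empty
  then show ?case
    by (intro exI[of _ 1] exI[of _ "\<lambda>_. 0"]) (auto simp: one zero rhom.one[OF h])
next
  case (insert i I)
  obtain c0 d0 where c0: "d0 \<noteq> 0" "(\<Sum>k\<in>V. c0 k * h (v k i)) = d0"
    using insert.prems(3)[of i] by auto
  then obtain k0 where k0: "k0 \<in> V" "h (v k0 i) \<noteq> 0"
    by (metis (no_types, lifting) mult_not_zero sum.neutral)
  define a where "a = v k0 i"
  define v' where "v' = (\<lambda>k l. a * v k l - v k i * v k0 l)"
  define u' where "u' = (\<lambda>l. a * u l - u i * v k0 l)"
  have aA: "a \<in> A" using insert.prems(1) k0 by (auto simp: a_def)
  have "\<exists>D c. D \<in> A \<and> h D \<noteq> 0 \<and> (\<forall>k\<in>V. c k \<in> A) \<and> (\<forall>l\<in>I. D * u' l = (\<Sum>k\<in>V. c k * v' k l))"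
  proof (rule insert.IH)
    show "v' k l \<in> A" if "k \<in> V" "l \<in> I" for k l
      using that insert.prems(1) k0 aA by (auto simp: v'_def intro!: diff mult)
    show "u' l \<in> A" if "l \<in> I" for l
      using that insert.prems k0 aA by (auto simp: u'_def intro!: diff mult)
    fix i' assume i': "i' \<in> I"
    then obtain c d where cd: "d \<noteq> 0"
        "\<forall>l\<in>insert i I. (\<Sum>k\<in>V. c k * h (v k l)) = (if l = i' then d else 0)"
      using insert.prems(3)[of i'] by auto
    have ne: "i \<noteq> i'" using i' insert.hyps by auto
    have "(\<Sum>k\<in>V. c k * h (v' k l)) = (if l = i' then h a * d else 0)" if "l \<in> I" for l
    proof -
      have "(\<Sum>k\<in>V. c k * h (v' k l)) =
          h a * (\<Sum>k\<in>V. c k * h (v k l)) - (\<Sum>k\<in>V. c k * h (v k i)) * h (v k0 l)"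
        by (simp add: v'_def rhom.diff[OF h] rhom.mult[OF h] sum_distrib_left sum_distrib_right
            sum_subtractf algebra_simps)
      then show ?thesis using cd that ne by auto
    qed
    then show "\<exists>c d. d \<noteq> 0 \<and> (\<forall>l\<in>I. (\<Sum>k\<in>V. c k * h (v' k l)) = (if l = i' then d else 0))"
      using cd k0 by (intro exI[of _ c] exI[of _ "h a * d"]) (auto simp: a_def)
  qed
  then obtain D c where Dc: "D \<in> A" "h D \<noteq> 0" "\<forall>k\<in>V. c k \<in> A"
      "\<forall>l\<in>I. D * u' l = (\<Sum>k\<in>V. c k * v' k l)" by blast
  \<comment> \<open>\<open>e\<close> is the defect of the inductive combination in column
    \<open>i\<close>. After scaling by the pivot \<open>a\<close>, adding \<open>e\<close> times the
    pivot row repairs column \<open>i\<close>; in the other columns it undoes the elimination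
    contained in \<open>v'\<close> and \<open>u'\<close>.\<close>
  define e where "e = D * u i - (\<Sum>k\<in>V. c k * v k i)"
  define c' where "c' = (\<lambda>k. c k * a + (if k = k0 then e else 0))"
  have eA: "e \<in> A" unfolding e_def using Dc insert.prems by (intro diff mult sum) auto
  have c': "(\<Sum>k\<in>V. c' k * v k l) = a * (\<Sum>k\<in>V. c k * v k l) + e * v k0 l" for l
  proof -
    have "(\<Sum>k\<in>V. (if k = k0 then e else 0) * v k l) = e * v k0 l"
      using k0 V by (simp add: if_distrib[of "\<lambda>x. x * _"] cong: if_cong)
    moreover have "(\<Sum>k\<in>V. c k * a * v k l) = a * (\<Sum>k\<in>V. c k * v k l)"
      by (simp add: sum_distrib_left mult_ac)
    ultimately show ?thesis by (simp add: c'_def distrib_right sum.distrib)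
  qed
  have "D * a * u l = (\<Sum>k\<in>V. c' k * v k l)" if "l \<in> insert i I" for l
  proof (cases "l = i")
    case True
    then show ?thesis by (simp add: c' e_def a_def algebra_simps)
  next
    case False
    then have "D * u' l = (\<Sum>k\<in>V. c k * v' k l)" using Dc that by auto
    also have "\<dots> = a * (\<Sum>k\<in>V. c k * v k l) - (\<Sum>k\<in>V. c k * v k i) * v k0 l"
      by (simp add: v'_def sum_distrib_left sum_distrib_right sum_subtractf algebra_simps)
    finally show ?thesis by (simp add: c' e_def u'_def algebra_simps)
  qed
  moreover have "D * a \<in> A" "h (D * a) \<noteq> 0"
    using Dc aA k0 by (auto simp: rhom.mult[OF h] a_def intro!: mult)
  moreover have "\<forall>k\<in>V. c' k \<in> A"
    using Dc aA eA by (auto simp: c'_def intro!: add mult)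
  ultimately show ?case by blast
qed

end


section \<open>Purely inseparable elements of degree \<open>p\<close>\<close>

lemma of_nat_inverse_mod_char:
  assumes "prime p" "CHAR('b::comm_ring_1) = p" "0 < d" "d < p"
  shows "\<exists>m. of_nat (m * d) = (1::'b)"
proof -
  have "\<not> p dvd d" using assms by (auto dest: dvd_imp_le)
  then have "gcd d p = 1"
    using prime_imp_coprime[OF assms(1)] by (simp add: coprime_iff_gcd_eq_1 gcd.commute)
  then obtain x y where "d * x = p * y + 1"
    using bezout_nat[of d p] assms by auto
  then have "of_nat (x * d) = of_nat p * of_nat y + (1::'b)"
    by (metis mult.commute of_nat_1 of_nat_add of_nat_mult)
  then show ?thesis using assms(2) of_nat_CHAR[where 'a = 'b] by (metis add_0 mult_zero_left)
qed

context subring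
begin

definition apoly :: "'b poly \<Rightarrow> bool" where
  "apoly q \<longleftrightarrow> (\<forall>k. coeff q k \<in> A)"

lemma apoly_add: "apoly f \<Longrightarrow> apoly g \<Longrightarrow> apoly (f + g)"
  by (simp add: apoly_def add)

lemma apoly_diff: "apoly f \<Longrightarrow> apoly g \<Longrightarrow> apoly (f - g)"
  by (simp add: apoly_def diff)

lemma apoly_smult: "a \<in> A \<Longrightarrow> apoly g \<Longrightarrow> apoly (smult a g)"
  by (simp add: apoly_def mult)

lemma apoly_pCons: "a \<in> A \<Longrightarrow> apoly g \<Longrightarrow> apoly (pCons a g)"
  by (auto simp: apoly_def coeff_pCons split: nat.splits)

lemma apoly_0: "apoly 0"
  by (simp add: apoly_def zero)

text \<open>Dividing monomials is enough: the dividend of interest is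
  \<open>(Y - \<beta>)^p\<close>, which in characteristic \<open>p\<close> differs from
  \<open>Y^p\<close> by a constant. Powers of the leading coefficient replace division in
  \<open>A\<close>.\<close>

lemma apoly_pseudo_division:
  assumes g: "apoly g" and d: "0 < degree g"
  shows "\<exists>e Q R. apoly R \<and> degree R < degree g \<and> smult (lead_coeff g ^ e) (monom 1 n) = g * Q + R"
proof (induction n)
  case 0
  show ?case
    by (rule exI[of _ 0], rule exI[of _ 0], rule exI[of _ 1])
       (use d in \<open>auto simp: apoly_def one zero coeff_1\<close>)
next
  case (Suc n)
  then obtain e Q R where R: "apoly R" "degree R < degree g"
    and eq: "smult (lead_coeff g ^ e) (monom 1 n) = g * Q + R" by blast
  define l where "l = lead_coeff g"
  define R1 where "R1 = pCons 0 R"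
  define c where "c = coeff R1 (degree g)"
  define R' where "R' = smult l R1 - smult c g"
  have lA: "l \<in> A" using g by (simp add: apoly_def l_def)
  have R1: "apoly R1" using R by (simp add: R1_def apoly_pCons zero)
  then have cA: "c \<in> A" by (simp add: apoly_def c_def)
  have dR1: "degree R1 \<le> degree g" using R by (auto simp: R1_def)
  have "coeff R' k = 0" if "degree g \<le> k" for k
    using that dR1 by (cases "k = degree g") (auto simp: R'_def l_def c_def coeff_eq_0)
  then have "degree R' < degree g" using d by (metis degree_lessI leI)
  moreover have "apoly R'" using lA cA R1 g by (simp add: R'_def apoly_diff apoly_smult)
  moreover have "smult (l ^ Suc e) (monom 1 (Suc n)) = g * (smult l (pCons 0 Q) + [:c:]) + R'"
  proof -
    have "smult (l ^ Suc e) (monom 1 (Suc n)) = smult l (pCons 0 (smult (l ^ e) (monom 1 n)))"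
      by (simp add: monom_Suc)
    also have "\<dots> = smult l (pCons 0 (g * Q + R))" using eq by (simp add: l_def)
    also have "\<dots> = smult l (pCons 0 (g * Q)) + smult l R1"
      using add_pCons[of 0 "g * Q" 0 R] by (simp add: R1_def smult_add_right)
    also have "\<dots> = g * (smult l (pCons 0 Q)) + smult c g + R'"
      by (simp add: R'_def)
    also have "\<dots> = g * (smult l (pCons 0 Q) + [:c:]) + R'"
      by (simp add: distrib_left mult.commute)
    finally show ?thesis .
  qed
  ultimately show ?case unfolding l_def by blast
qed

text \<open>The minimal polynomial of \<open>\<beta>\<close> divides \<open>(Y - \<beta>)\<^sup>p\<close>, so it is \<open>(Y - \<beta>)\<^sup>d\<close>, and its second
  coefficient \<open>- d \<beta>\<close> forces \<open>\<beta>\<close> into the field of fractions of \<open>A\<close> unless \<open>d = p\<close>.\<close>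

lemma purely_inseparable_dependence:
  assumes p: "prime p" "CHAR('b) = p" and \<beta>: "\<beta> ^ p \<in> A"
    and c: "\<And>k. k < p \<Longrightarrow> c k \<in> A" "k0 < p" "c k0 \<noteq> 0" and rel: "(\<Sum>k<p. c k * \<beta> ^ k) = 0"
  shows "\<exists>a\<in>A. a \<noteq> 0 \<and> a * \<beta> \<in> A"
proof -
  let ?S = "\<lambda>g. apoly g \<and> g \<noteq> 0 \<and> poly g \<beta> = 0"
  define g0 where "g0 = (\<Sum>k<p. monom (c k) k)"
  have cg0: "coeff g0 k = (if k < p then c k else 0)" for k
    by (auto simp: g0_def coeff_sum)
  have "apoly g0" using c by (simp add: apoly_def cg0 zero)
  moreover have "g0 \<noteq> 0" using c cg0[of k0] by auto
  moreover have "poly g0 \<beta> = 0" using rel by (simp add: g0_def poly_sum poly_monom)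
  ultimately have "?S g0" by blast
  then obtain g where g: "?S g" and min: "\<And>q. ?S q \<Longrightarrow> degree g \<le> degree q"
    using ex_has_least_nat[of ?S g0 degree] by blast
  have "degree g0 < p"
    using c by (intro degree_lessI) (auto simp: cg0)
  with min \<open>?S g0\<close> have dp: "degree g < p" by fastforce
  have d0: "0 < degree g"
    using g by (auto elim!: degree_eq_zeroE intro!: Nat.gr0I)
  obtain e Q R where R: "apoly R" "degree R < degree g"
    and eq: "smult (lead_coeff g ^ e) (monom 1 p) = g * Q + R"
    using apoly_pseudo_division[of g p] g d0 by blast
  define l where "l = lead_coeff g ^ e"
  have lA: "l \<in> A" and l0: "l \<noteq> 0" using g by (auto simp: l_def apoly_def power)
  have char_poly: "CHAR('b poly) = p" using p by simp
  have "[:- \<beta>, 1:] = [:0, 1:] + [:- \<beta>:]" by simp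
  then have "[:- \<beta>, 1:] ^ p = [:0, 1:] ^ p + [:- \<beta>:] ^ p"
    using freshmans_dream[where 'a = "'b poly"] p(1) char_poly by metis
  also have "\<dots> = monom 1 p + [:(- \<beta>) ^ p:]"
    by (simp add: monom_altdef poly_const_pow)
  finally have F: "[:- \<beta>, 1:] ^ p = monom 1 p + [:(- \<beta>) ^ p:]" .
  define R' where "R' = R + smult l [:(- \<beta>) ^ p:]"
  have gQ: "smult l ([:- \<beta>, 1:] ^ p) = g * Q + R'"
    using eq by (simp add: F R'_def smult_add_right l_def)
  have mb: "(- \<beta>) ^ p \<in> A"
    using \<beta> uminus[OF one] power[of "- 1" p] mult[of "(- 1) ^ p" "\<beta> ^ p"]
    by (simp add: power_minus[of \<beta>])
  have "apoly R'"
    unfolding R'_def using R mb lA by (intro apoly_add apoly_smult apoly_pCons apoly_0)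
  moreover have "poly R' \<beta> = 0"
  proof -
    have "poly (g * Q + R') \<beta> = 0" using p by (simp add: prime_gt_0_nat flip: gQ)
    then show ?thesis using g by simp
  qed
  moreover have "degree R' < degree g"
    unfolding R'_def using R d0 by (intro degree_add_less) auto
  ultimately have "R' = 0" using min[of R'] by force
  with gQ have gQ: "g * Q = smult l ([:- \<beta>, 1:] ^ p)" by simp
  then have gQ0: "g * Q \<noteq> 0" using l0 by simp
  \<comment> \<open>Degrees and orders at \<open>\<beta>\<close> both add up to \<open>p\<close>,
    and an order never exceeds the degree. Hence both are equal for \<open>g\<close>, which is a
    constant times a power of \<open>Y - \<beta>\<close>.\<close>
  have "degree g + degree Q = p"
    using arg_cong[OF gQ, of degree] gQ0 l0 by (simp add: degree_mult_eq degree_linear_power)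
  moreover have "order \<beta> g + order \<beta> Q = p"
    using arg_cong[OF gQ, of "order \<beta>"] order_mult[OF gQ0] l0
    by (simp add: order_smult order_power_n_n)
  moreover have "order \<beta> Q \<le> degree Q" using gQ0 by (auto intro!: order_degree)
  moreover have "order \<beta> g \<le> degree g" using g by (auto intro!: order_degree)
  ultimately have og: "order \<beta> g = degree g" by linarith
  obtain g1 where g1: "g = [:- \<beta>, 1:] ^ order \<beta> g * g1"
    using order_decomp[of g \<beta>] g by blast
  from g1 g have "g1 \<noteq> 0" by auto
  then have "degree ([:- \<beta>, 1:] ^ order \<beta> g * g1) = order \<beta> g + degree g1"
    by (subst degree_mult_eq) (auto simp: degree_linear_power)
  then have "degree g = order \<beta> g + degree g1" using g1 by simp
  with og have "degree g1 = 0" by simp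
  then obtain b where "g1 = [:b:]" by (rule degree_eq_zeroE)
  with g1 og have gb: "g = smult b ([:- \<beta>, 1:] ^ degree g)" by (simp add: mult.commute)
  have co: "coeff g k = b * (of_nat (degree g choose k) * (- \<beta>) ^ (degree g - k))"
    if "k \<le> degree g" for k
    using that by (subst gb) (simp add: coeff_linear_poly_power)
  have gA: "coeff g k \<in> A" for k using g by (simp add: apoly_def)
  have cd: "coeff g (degree g) = b" using co[of "degree g"] by simp
  have b: "b \<in> A" "b \<noteq> 0"
    using gA[of "degree g"] cd g by (auto dest: leading_coeff_neq_0)
  have "degree g choose (degree g - 1) = degree g"
    using d0 binomial_symmetric[of 1 "degree g"] by simp
  then have "b * (of_nat (degree g) * (- \<beta>)) \<in> A"
    using gA[of "degree g - 1"] co[of "degree g - 1"] d0 by simp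
  moreover obtain m where m: "of_nat (m * degree g) = (1::'b)"
    using of_nat_inverse_mod_char[OF p d0 dp] by blast
  ultimately have "- (of_nat m * (b * (of_nat (degree g) * (- \<beta>)))) \<in> A"
    by (blast intro: uminus mult of_nat)
  also have "- (of_nat m * (b * (of_nat (degree g) * (- \<beta>)))) = of_nat (m * degree g) * (b * \<beta>)"
    by (simp add: mult_ac)
  finally show ?thesis using b m by auto
qed

end

section \<open>Coefficientwise Frobenius\<close>

definition cf :: "'a::comm_ring_1 set \<Rightarrow> 'a mpoly set" where
  "cf k = {P. \<forall>m. Poly_Mapping.lookup P m \<in> k}"

text \<open>Linear independence over the field of \<open>p\<close>-th powers; equivalently,
  anisotropy of the diagonal form with coefficients \<open>w j\<close>.\<close>

definition pindep :: "nat \<Rightarrow> 'i set \<Rightarrow> ('i \<Rightarrow> 'a::field) \<Rightarrow> bool" where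
  "pindep p J w \<longleftrightarrow> (\<forall>c. (\<Sum>j\<in>J. c j ^ p * w j) = 0 \<longrightarrow> (\<forall>j\<in>J. c j = 0))"

lemma pindepD: "pindep p J w \<Longrightarrow> (\<Sum>j\<in>J. c j ^ p * w j) = 0 \<Longrightarrow> j \<in> J \<Longrightarrow> c j = 0"
  unfolding pindep_def by blast

lemma pindep_subset:
  assumes "pindep p J w" "finite J" "I \<subseteq> J" "0 < p"
  shows "pindep p I w"
  unfolding pindep_def
proof (intro allI impI ballI)
  fix c j assume c: "(\<Sum>j\<in>I. c j ^ p * w j) = 0" and j: "j \<in> I"
  have "(\<Sum>j\<in>J. (if j \<in> I then c j else 0) ^ p * w j) = (\<Sum>j\<in>I. c j ^ p * w j)"
    using assms by (intro sum.mono_neutral_cong_right) auto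
  then have "(if j \<in> I then c j else 0) = 0"
    using c j assms by (intro pindepD[OF assms(1), of "\<lambda>j. if j \<in> I then c j else 0"]) auto
  with j show "c j = 0" by simp
qed

lemma cf_mconst_iff: "0 \<in> k \<Longrightarrow> mconst a \<in> cf k \<longleftrightarrow> a \<in> k"
  by (auto simp: cf_def lookup_mconst when_def)

lemma subring_cf:
  fixes k :: "'a::field set"
  assumes "subring k"
  shows "subring (cf k \<inter> mpolys I)"
proof
  interpret k: subring k by fact
  show "1 \<in> cf k \<inter> mpolys I"
    by (auto simp: cf_def lookup_one when_def k.one k.zero)
  fix P Q assume P: "P \<in> cf k \<inter> mpolys I" and Q: "Q \<in> cf k \<inter> mpolys I"
  then show "P - Q \<in> cf k \<inter> mpolys I"
    by (auto simp: cf_def lookup_minus intro!: k.diff mpolys_diff)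
  have "P * Q = (\<Sum>m\<in>Poly_Mapping.keys P. \<Sum>n\<in>Poly_Mapping.keys Q.
      Poly_Mapping.single (m + n) (Poly_Mapping.lookup P m * Poly_Mapping.lookup Q n))"
    by (subst (1) mpoly_sum_single[of P], subst (1) mpoly_sum_single[of Q])
       (simp add: sum_product mult_single)
  then have "Poly_Mapping.lookup (P * Q) l \<in> k" for l
    using P Q by (auto simp: lookup_sum lookup_single when_def cf_def intro!: k.sum k.mult k.zero)
  then show "P * Q \<in> cf k \<inter> mpolys I"
    using P Q by (auto simp: cf_def mpolys_mult)
qed

locale frobenius =
  fixes p :: nat and F :: "'a::field itself"
  assumes prime_p: "prime p" and char_p: "CHAR('a) = p"
begin

lemma p_ge_2: "2 \<le> p"
  using prime_p by (rule prime_ge_2_nat)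

lemma p_pos: "0 < p"
  using p_ge_2 by simp

lemma char_mpoly: "CHAR('a mpoly) = p"
  by (simp add: CHAR_mpoly char_p)

lemma rhom_pow: "rhom (\<lambda>c::'a. c ^ p)"
  using freshmans_dream[where 'a = 'a] prime_p char_p
  by unfold_locales (auto simp: power_mult_distrib)

lemma rhom_pow_mpoly: "rhom (\<lambda>P::'a mpoly. P ^ p)"
  using freshmans_dream[where 'a = "'a mpoly"] prime_p char_mpoly
  by unfold_locales (auto simp: power_mult_distrib)

definition fr :: "'a mpoly \<Rightarrow> 'a mpoly" where
  "fr = mp_eval (\<lambda>c. mconst (c ^ p)) mvar"

lemma rhom_fr: "rhom fr"
  unfolding fr_def by (rule rhom_mp_eval, rule rhom_comp[OF rhom_mconst rhom_pow])

lemmas fr_simps = rhom.zero[OF rhom_fr] rhom.one[OF rhom_fr] rhom.add[OF rhom_fr]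
  rhom.diff[OF rhom_fr] rhom.mult[OF rhom_fr] rhom.sum[OF rhom_fr] rhom.power[OF rhom_fr]
  rhom.uminus[OF rhom_fr] rhom.of_nat[OF rhom_fr]

lemma fr_mconst [simp]: "fr (mconst c) = mconst (c ^ p)"
  unfolding fr_def by (rule mp_eval_mconst, rule rhom_comp[OF rhom_mconst rhom_pow])

lemma fr_mvar [simp]: "fr (mvar i) = mvar i"
  unfolding fr_def by (rule mp_eval_mvar, rule rhom_comp[OF rhom_mconst rhom_pow])

lemma lookup_fr: "Poly_Mapping.lookup (fr P) m = Poly_Mapping.lookup P m ^ p"
proof -
  have "Poly_Mapping.single n a = mconst a * mon mvar n" for n and a :: 'a
    by (simp add: single_eq_prod mon_def)
  then have "fr P = (\<Sum>n\<in>Poly_Mapping.keys P. Poly_Mapping.single n (Poly_Mapping.lookup P n ^ p))"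
    by (simp add: fr_def mp_eval_def)
  then show ?thesis
    using p_pos by (auto simp: lookup_sum lookup_single when_def in_keys_iff)
qed

lemma fr_eq_0_iff [simp]: "fr P = 0 \<longleftrightarrow> P = 0"
proof
  assume "fr P = 0"
  then have "Poly_Mapping.lookup P m ^ p = 0" for m by (metis lookup_fr lookup_zero)
  then show "P = 0" by (intro poly_mapping_eqI) auto
qed (simp add: fr_simps)

lemma mpolys_fr: "P \<in> mpolys I \<Longrightarrow> fr P \<in> mpolys I"
  by (auto simp: mpolys_def in_keys_iff lookup_fr p_pos)

lemma fr_psubst: "fr (psubst g P) = psubst (\<lambda>i. fr (g i)) (fr P)"
  by (rule mpoly_hom_eqI[OF rhom_comp[OF rhom_fr rhom_psubst] rhom_comp[OF rhom_psubst rhom_fr]])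
     simp_all

lemma fr_pdiff: "fr (pdiff i P) = pdiff i (fr P)"
  by (induction P rule: mpoly_induct)
     (simp_all add: pdiff_mvar pdiff_add pdiff_mult fr_simps)

text \<open>The source of all inversions below: a \<open>p\<close>-th power always lies in the image
  of \<open>fr\<close>.\<close>

lemma power_p_eq_fr: "P ^ p = fr (psubst (\<lambda>i. mvar i ^ p) P)"
  by (rule mpoly_hom_eqI[OF rhom_pow_mpoly rhom_comp[OF rhom_fr rhom_psubst]])
     (simp_all add: fr_simps flip: rhom.power[OF rhom_mconst])

text \<open>\<open>fr\<close> raises each coefficient to its \<open>p\<close>-th power, so every
  monomial of the relation is an instance of \<open>pindep\<close>.\<close>

lemma pindep_fr:
  assumes "pindep p J w" "(\<Sum>j\<in>J. mconst (w j) * fr (c j)) = 0" "j \<in> J"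
  shows "c j = 0"
proof (rule poly_mapping_eqI)
  fix m
  have "(\<Sum>j\<in>J. Poly_Mapping.lookup (c j) m ^ p * w j) = 0"
    using arg_cong[OF assms(2), of "\<lambda>P. Poly_Mapping.lookup P m"]
    by (simp add: lookup_sum lookup_mconst_mult lookup_fr mult.commute)
  from pindepD[OF assms(1) this assms(3)]
  show "Poly_Mapping.lookup (c j) m = Poly_Mapping.lookup 0 m" by simp
qed

lemma uminus_pow: "(- x) ^ p = - (x ^ p :: 'a)"
  using rhom.uminus[OF rhom_pow] by simp

end

text \<open>A ring between the \<open>p\<close>-th powers and the field is a field, since \<open>1/x = x\<^bsup>p-1\<^esup> (1/x)\<^sup>p\<close>.\<close>

locale pfield = frobenius p F + subring k
  for p and F :: "'a::field itself" and k :: "'a set" +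
  assumes pow_mem: "x ^ p \<in> k"
begin

lemma divide:
  assumes "x \<in> k" "y \<in> k"
  shows "x / y \<in> k"
proof (cases "y = 0")
  case False
  have "x / y = x * y ^ (p - 1) * (1 / y) ^ p"
    using False p_pos power_minus_mult[of p y] by (simp add: field_simps)
  with assms show ?thesis by (auto intro: mult power pow_mem)
qed (simp add: zero)

lemma fr_cf: "fr P \<in> cf k"
  by (simp add: cf_def lookup_fr pow_mem)

text \<open>Says that a linear form with a coefficient outside \<open>k\<close> is not a quotient of
  polynomials over \<open>k\<close>; this will be applied to \<open>\<beta>\<close>.\<close>

lemma cf_times_linear_form:
  assumes "finite I" and c: "c \<in> cf k" "c \<noteq> 0" and b: "c * (\<Sum>i\<in>I. mconst (u i) * mvar i) \<in> cf k"
    and i0: "i0 \<in> I"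
  shows "u i0 \<in> k"
proof (rule ccontr)
  assume not: "u i0 \<notin> k"
  interpret cf: subring "cf k" using subring_cf[OF subring_axioms, of UNIV] by simp
  define J where "J = {i\<in>I. u i \<notin> k}"
  have J: "finite J" "i0 \<in> J" "J \<subseteq> I" using assms not by (auto simp: J_def)
  have v: "mvar i \<in> cf k" for i
    by (auto simp: cf_def mvar_def lookup_single when_def zero one)
  have "c * (\<Sum>i\<in>I. mconst (u i) * mvar i) - c * (\<Sum>i\<in>I-J. mconst (u i) * mvar i) \<in> cf k"
    by (intro cf.diff b cf.mult c cf.sum v) (auto simp: J_def cf_mconst_iff zero)
  also have "c * (\<Sum>i\<in>I. mconst (u i) * mvar i) - c * (\<Sum>i\<in>I-J. mconst (u i) * mvar i) =
      c * (\<Sum>i\<in>J. mconst (u i) * mvar i)"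
    using J assms(1) by (simp add: sum_diff algebra_simps)
  finally have in_cf: "c * (\<Sum>i\<in>J. mconst (u i) * mvar i) \<in> cf k" .
  define e where "e = (\<lambda>m :: nat \<Rightarrow>\<^sub>0 nat. Poly_Mapping.lookup m i0)"
  have ne: "Poly_Mapping.keys c \<noteq> {}" using c by simp
  \<comment> \<open>Multiplication by \<open>mvar i0\<close> raises the largest exponent of this
    variable in \<open>c\<close> to \<open>M + 1\<close>, which no other summand reaches. The
    coefficient at \<open>n\<close> therefore isolates \<open>u i0\<close>.\<close>
  define M where "M = Max (e ` Poly_Mapping.keys c)"
  obtain m0 where m0: "m0 \<in> Poly_Mapping.keys c" "e m0 = M"
    using Max_in[of "e ` Poly_Mapping.keys c"] ne unfolding M_def by fastforce
  have max: "e m \<le> M" if "m \<in> Poly_Mapping.keys c" for m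
    unfolding M_def using that by simp
  define n where "n = Poly_Mapping.single i0 1 + m0"
  have "Poly_Mapping.lookup (mvar i * c) n = (if i = i0 then Poly_Mapping.lookup c m0 else 0)" for i
  proof (cases "i = i0")
    case True
    then show ?thesis using lookup_mult_single[of "Poly_Mapping.single i0 1" 1 c m0]
      by (simp add: n_def mvar_def)
  next
    case False
    have "n \<notin> Poly_Mapping.keys (mvar i * c)"
    proof
      assume "n \<in> Poly_Mapping.keys (mvar i * c)"
      then obtain a b where ab: "n = a + b" "a \<in> Poly_Mapping.keys (mvar i :: 'a mpoly)"
          "b \<in> Poly_Mapping.keys c"
        using keys_mult[of "mvar i" c] by blast
      then have "a = Poly_Mapping.single i 1" by (simp add: mvar_def)
      then have "e b = e n" using False ab by (simp add: e_def lookup_add lookup_single)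
      also have "\<dots> = Suc M" using m0 by (simp add: e_def n_def lookup_add)
      finally show False using max[OF ab(3)] by simp
    qed
    with False show ?thesis by (simp add: in_keys_iff)
  qed
  moreover have "c * (\<Sum>i\<in>J. mconst (u i) * mvar i) = (\<Sum>i\<in>J. mconst (u i) * (mvar i * c))"
    by (simp add: sum_distrib_left mult_ac)
  ultimately have "Poly_Mapping.lookup (c * (\<Sum>i\<in>J. mconst (u i) * mvar i)) n =
      (\<Sum>i\<in>J. if i = i0 then u i0 * Poly_Mapping.lookup c m0 else 0)"
    by (auto simp: lookup_sum lookup_mconst_mult intro!: sum.cong)
  also have "\<dots> = u i0 * Poly_Mapping.lookup c m0" using J by simp
  finally have "Poly_Mapping.lookup (c * (\<Sum>i\<in>J. mconst (u i) * mvar i)) n =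
      u i0 * Poly_Mapping.lookup c m0" .
  then have "u i0 * Poly_Mapping.lookup c m0 \<in> k"
    using in_cf by (metis (mono_tags, lifting) cf_def mem_Collect_eq)
  then have "u i0 * Poly_Mapping.lookup c m0 / Poly_Mapping.lookup c m0 \<in> k"
    using c by (intro divide) (auto simp: cf_def)
  then show False using m0 not by (auto simp: in_keys_iff)
qed

end


context frobenius
begin

lemma subring_powers: "subring (range (\<lambda>x::'a. x ^ p))"
proof
  interpret h: rhom "\<lambda>x::'a. x ^ p" by (rule rhom_pow)
  show "1 \<in> range (\<lambda>x::'a. x ^ p)" by (rule range_eqI[of _ _ 1]) simp
  fix x y :: 'a assume "x \<in> range (\<lambda>x. x ^ p)" "y \<in> range (\<lambda>x. x ^ p)"
  then obtain a b where "x = a ^ p" "y = b ^ p" by auto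
  then show "x - y \<in> range (\<lambda>x. x ^ p)" "x * y \<in> range (\<lambda>x. x ^ p)"
    by (auto intro: range_eqI[of _ _ "a - b"] range_eqI[of _ _ "a * b"] simp: h.diff power_mult_distrib)
qed

lemma pfield_range: "pfield p (range (\<lambda>x::'a. x ^ p))"
  using subring_powers by (intro pfield.intro) (auto simp: pfield_axioms_def frobenius_axioms)

end


section \<open>The coordinate ring of a quasilinear hypersurface\<close>

text \<open>
  The form is \<open>\<Phi> = x\<^sub>0\<^sup>p + u\<^sub>1 x\<^sub>1\<^sup>p + \<dots>\<close>. The Frobenius twist of \<open>\<Phi>\<close> is the \<open>p\<close>-th power of the
  linear form \<open>lam = x\<^sub>0 - \<beta>\<close>, hence \<open>\<sigma>\<close>, the twist followed by \<open>x\<^sub>0 \<mapsto> \<beta>\<close>, kills \<open>\<Phi>\<close>. Its kernel is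
  exactly the ideal of the hypersurface, whose coordinate ring is thus embedded in a polynomial
  ring.
\<close>

locale qform = frobenius p F
  for p and F :: "'a::field itself" +
  fixes r :: nat and u :: "nat \<Rightarrow> 'a"
  assumes r_ge_2: "2 \<le> r" and u_0: "u 0 = 1" and aniso: "pindep p {..<r} u"
begin

definition \<beta> :: "'a mpoly" where
  "\<beta> = - (\<Sum>i\<in>{1..<r}. mconst (u i) * mvar i)"

definition \<tau> :: "'a mpoly \<Rightarrow> 'a mpoly" where
  "\<tau> = psubst (\<lambda>i. if i = 0 then \<beta> else mvar i)"

definition lam :: "'a mpoly" where
  "lam = (\<Sum>i<r. mconst (u i) * mvar i)"

definition \<sigma> :: "'a mpoly \<Rightarrow> 'a mpoly" where
  "\<sigma> P = \<tau> (fr P)"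

definition \<Phi> :: "'a mpoly" where
  "\<Phi> = (\<Sum>i<r. mconst (u i) * mvar i ^ p)"

lemma lessThan_r: "{..<r} = insert 0 {1..<r}"
  using r_ge_2 by auto

lemma lam_eq: "lam = mvar 0 - \<beta>"
  by (simp add: lam_def \<beta>_def lessThan_r u_0 mconst_1)

lemma rhom_\<tau>: "rhom \<tau>"
  unfolding \<tau>_def by (rule rhom_psubst)

lemma rhom_\<sigma>: "rhom \<sigma>"
  unfolding \<sigma>_def by (rule rhom_comp[OF rhom_\<tau> rhom_fr])

lemmas \<tau>_simps = rhom.zero[OF rhom_\<tau>] rhom.one[OF rhom_\<tau>] rhom.add[OF rhom_\<tau>]
  rhom.diff[OF rhom_\<tau>] rhom.mult[OF rhom_\<tau>] rhom.sum[OF rhom_\<tau>] rhom.power[OF rhom_\<tau>]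
  rhom.uminus[OF rhom_\<tau>] rhom.of_nat[OF rhom_\<tau>]

lemmas \<sigma>_simps = rhom.zero[OF rhom_\<sigma>] rhom.one[OF rhom_\<sigma>] rhom.add[OF rhom_\<sigma>]
  rhom.diff[OF rhom_\<sigma>] rhom.mult[OF rhom_\<sigma>] rhom.sum[OF rhom_\<sigma>] rhom.power[OF rhom_\<sigma>]
  rhom.uminus[OF rhom_\<sigma>] rhom.of_nat[OF rhom_\<sigma>]

lemma \<tau>_mconst [simp]: "\<tau> (mconst c) = mconst c"
  by (simp add: \<tau>_def)

lemma \<tau>_mvar: "\<tau> (mvar i) = (if i = 0 then \<beta> else mvar i)"
  by (simp add: \<tau>_def)

lemma \<sigma>_mvar: "\<sigma> (mvar i) = (if i = 0 then \<beta> else mvar i)"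
  by (simp add: \<sigma>_def \<tau>_mvar)

lemma \<sigma>_mconst [simp]: "\<sigma> (mconst c) = mconst (c ^ p)"
  by (simp add: \<sigma>_def)

lemma \<beta>_mpolys: "\<beta> \<in> mpolys {1..<r}"
  unfolding \<beta>_def by (intro mpolys_uminus mpolys_sum mpolys_mult) auto

lemma \<tau>_mpolys: "P \<in> mpolys {..<r} \<Longrightarrow> \<tau> P \<in> mpolys {1..<r}"
  unfolding \<tau>_def by (erule mpolys_psubst) (use \<beta>_mpolys in auto)

lemma \<sigma>_mpolys: "P \<in> mpolys {..<r} \<Longrightarrow> \<sigma> P \<in> mpolys {1..<r}"
  unfolding \<sigma>_def by (intro \<tau>_mpolys mpolys_fr)

lemma \<tau>_id: "P \<in> mpolys {1..<r} \<Longrightarrow> \<tau> P = P"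
  unfolding \<tau>_def by (subst psubst_cong[where g = mvar]) (auto simp: psubst_id)

lemma \<sigma>_id: "P \<in> mpolys {1..<r} \<Longrightarrow> \<sigma> P = fr P"
  unfolding \<sigma>_def by (intro \<tau>_id mpolys_fr)

lemma \<tau>_lam: "\<tau> lam = 0"
  by (simp add: lam_eq \<tau>_simps \<tau>_mvar \<tau>_id[OF \<beta>_mpolys])

lemma lam_dvd_diff: "lam dvd P - \<tau> P"
proof (induction P rule: mpoly_induct)
  case (var i)
  show ?case by (simp add: \<tau>_mvar lam_eq)
next
  case (add P R)
  then have "lam dvd (P - \<tau> P) + (R - \<tau> R)" by (rule dvd_add)
  then show ?case by (simp add: \<tau>_simps algebra_simps)
next
  case (mult P R)
  then have "lam dvd (P - \<tau> P) * R + \<tau> P * (R - \<tau> R)" by (auto intro: dvd_add dvd_mult dvd_mult2)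
  then show ?case by (simp add: \<tau>_simps algebra_simps)
qed simp

lemma \<tau>_eq_0_iff: "\<tau> P = 0 \<longleftrightarrow> lam dvd P"
proof
  assume "\<tau> P = 0"
  then show "lam dvd P" using lam_dvd_diff[of P] by simp
qed (auto simp: dvd_def \<tau>_simps \<tau>_lam)

lemma fr_\<Phi>: "fr \<Phi> = lam ^ p"
proof -
  have "fr \<Phi> = (\<Sum>i<r. (mconst (u i) * mvar i) ^ p)"
    by (simp add: \<Phi>_def fr_simps power_mult_distrib rhom.power[OF rhom_mconst])
  then show ?thesis by (simp add: lam_def rhom.sum[OF rhom_pow_mpoly])
qed

lemma \<sigma>_\<Phi>: "\<sigma> \<Phi> = 0"
  using p_pos by (simp add: \<sigma>_def fr_\<Phi> \<tau>_simps \<tau>_lam)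

lemma \<Phi>_mpolys: "\<Phi> \<in> mpolys {..<r}"
  unfolding \<Phi>_def by (intro mpolys_sum mpolys_mult mpolys_power) auto

lemma \<Phi>_dvd_\<sigma>: "\<Phi> dvd P \<Longrightarrow> \<sigma> P = 0"
  by (auto simp: dvd_def \<sigma>_simps \<sigma>_\<Phi>)

text \<open>Division with remainder by \<open>\<Phi>\<close>, which is monic of degree
  \<open>p\<close> in \<open>x_0\<close> because \<open>u 0 = 1\<close>. It is a relation: only
  existence of a remainder is proved here, and independence of the powers of \<open>\<beta>\<close>
  supplies uniqueness.\<close>

definition reduces_to :: "'a mpoly \<Rightarrow> (nat \<Rightarrow> 'a mpoly) \<Rightarrow> bool" where
  "reduces_to f c \<longleftrightarrow> (\<forall>k. c k \<in> mpolys {1..<r}) \<and> \<Phi> dvd f - (\<Sum>k<p. c k * mvar 0 ^ k)"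

lemma reduces_to_add:
  assumes "reduces_to f c" "reduces_to g d"
  shows "reduces_to (f + g) (\<lambda>k. c k + d k)"
proof -
  have "\<Phi> dvd (f - (\<Sum>k<p. c k * mvar 0 ^ k)) + (g - (\<Sum>k<p. d k * mvar 0 ^ k))"
    using assms unfolding reduces_to_def by (blast intro: dvd_add)
  then show ?thesis using assms
    by (simp add: reduces_to_def mpolys_add algebra_simps sum.distrib)
qed

lemma reduces_to_scale:
  assumes "reduces_to f c" "a \<in> mpolys {1..<r}"
  shows "reduces_to (a * f) (\<lambda>k. a * c k)"
proof -
  have "\<Phi> dvd a * (f - (\<Sum>k<p. c k * mvar 0 ^ k))"
    using assms unfolding reduces_to_def by (intro dvd_mult) blast
  then show ?thesis using assms
    by (simp add: reduces_to_def mpolys_mult algebra_simps sum_distrib_left)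
qed

lemma reduces_to_mvar_0:
  assumes "reduces_to f c"
  shows "\<exists>d. reduces_to (mvar 0 * f) d"
proof -
  obtain q where q: "p = Suc q" using p_pos by (cases p) auto
  define \<theta> where "\<theta> = (\<Sum>i\<in>{1..<r}. mconst (u i) * mvar i ^ p)"
  have \<theta>: "\<theta> \<in> mpolys {1..<r}" unfolding \<theta>_def by (intro mpolys_sum mpolys_mult mpolys_power) auto
  have \<Phi>: "\<Phi> = mvar 0 ^ p + \<theta>" by (simp add: \<Phi>_def \<theta>_def lessThan_r u_0 mconst_1)
  \<comment> \<open>Coefficients move up by one place; the top one would meet \<open>x_0^p\<close>,
    which is \<open>- \<theta>\<close> modulo \<open>\<Phi>\<close>, and wraps around to place
    0.\<close>
  define d where "d = (\<lambda>k. case k of 0 \<Rightarrow> - (c q * \<theta>) | Suc k \<Rightarrow> c k)"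
  have "(\<Sum>k<p. d k * mvar 0 ^ k) = - (c q * \<theta>) + (\<Sum>k<q. c k * mvar 0 ^ Suc k)"
    by (simp add: q sum.lessThan_Suc_shift d_def del: sum.lessThan_Suc)
  moreover have "mvar 0 * (\<Sum>k<p. c k * mvar 0 ^ k) = c q * mvar 0 ^ p + (\<Sum>k<q. c k * mvar 0 ^ Suc k)"
    by (simp add: q distrib_left sum_distrib_left mult_ac)
  ultimately have "mvar 0 * f - (\<Sum>k<p. d k * mvar 0 ^ k) =
      mvar 0 * (f - (\<Sum>k<p. c k * mvar 0 ^ k)) + \<Phi> * c q"
    by (simp add: \<Phi> algebra_simps)
  then have "\<Phi> dvd mvar 0 * f - (\<Sum>k<p. d k * mvar 0 ^ k)"
    using assms by (simp add: reduces_to_def)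
  moreover have "d k \<in> mpolys {1..<r}" for k
    using assms \<theta> by (auto simp: d_def reduces_to_def split: nat.split intro!: mpolys_uminus mpolys_mult)
  ultimately show ?thesis unfolding reduces_to_def by blast
qed

lemma ex_reduces_to:
  assumes "f \<in> mpolys {..<r}"
  shows "\<exists>c. reduces_to f c"
proof -
  \<comment> \<open>Strengthened to multiplication by \<open>f\<close> on all reducible
    \<open>h\<close>, so that the product case becomes a composition.\<close>
  have "\<forall>h c. reduces_to h c \<longrightarrow> (\<exists>d. reduces_to (f * h) d)"
    using assms
  proof (induction rule: mpolys_induct)
    case (const a)
    then show ?case using reduces_to_scale[of _ _ "mconst a"] by auto
  next
    case (var i)
    then show ?case using reduces_to_scale[of _ _ "mvar i"] reduces_to_mvar_0
      by (cases "i = 0") auto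
  next
    case (add P R)
    show ?case unfolding distrib_right using add reduces_to_add by blast
  next
    case (mult P R)
    show ?case unfolding mult.assoc using mult by blast
  qed
  moreover have "reduces_to 1 (\<lambda>k. if k = 0 then 1 else 0)"
    using p_pos by (auto simp: reduces_to_def if_distrib[of "\<lambda>x. x * _"] cong: if_cong)
  ultimately show ?thesis by (metis mult.right_neutral)
qed

lemma \<sigma>_reduces_to: "reduces_to f c \<Longrightarrow> \<sigma> f = (\<Sum>k<p. fr (c k) * \<beta> ^ k)"
proof -
  assume f: "reduces_to f c"
  then have "\<sigma> (f - (\<Sum>k<p. c k * mvar 0 ^ k)) = 0"
    by (intro \<Phi>_dvd_\<sigma>) (simp add: reduces_to_def)
  moreover have "\<sigma> (c k) = fr (c k)" for k using f by (intro \<sigma>_id) (simp add: reduces_to_def)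
  ultimately show ?thesis by (simp add: \<sigma>_simps \<sigma>_mvar)
qed

lemma \<beta>_pow_p: "\<beta> ^ p = fr (- (\<Sum>i\<in>{1..<r}. mconst (u i) * mvar i ^ p))"
  by (subst power_p_eq_fr)
     (simp add: \<beta>_def rhom.uminus[OF rhom_psubst] rhom.sum[OF rhom_psubst] rhom.mult[OF rhom_psubst])

text \<open>\<open>\<beta>^p\<close> has its coefficients in \<open>k\<close>, so a nontrivial
  relation of length \<open>p\<close> would make \<open>\<beta>\<close> a quotient of polynomials
  over \<open>k\<close>, and then the coefficient \<open>u i\<close> would lie in
  \<open>k\<close>.\<close>

lemma \<beta>_powers_indep:
  assumes k: "pfield p k" and i: "i \<in> {1..<r}" "u i \<notin> k"
    and c: "\<And>j. j < p \<Longrightarrow> c j \<in> cf k" and rel: "(\<Sum>j<p. c j * \<beta> ^ j) = 0" and j: "j < p"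
  shows "c j = 0"
proof (rule ccontr)
  assume nz: "c j \<noteq> 0"
  interpret k: pfield p F k by fact
  interpret cf: subring "cf k" using subring_cf[OF k.subring_axioms, of UNIV] by simp
  have "\<beta> ^ p \<in> cf k" unfolding \<beta>_pow_p by (rule k.fr_cf)
  then have "\<exists>a\<in>cf k. a \<noteq> 0 \<and> a * \<beta> \<in> cf k"
    using cf.purely_inseparable_dependence[OF prime_p char_mpoly _ _ j nz rel] c by blast
  then obtain a where a: "a \<in> cf k" "a \<noteq> 0" "a * \<beta> \<in> cf k" by blast
  have "a * (\<Sum>i\<in>{1..<r}. mconst (u i) * mvar i) = - (a * \<beta>)" by (simp add: \<beta>_def)
  with a(3) have "a * (\<Sum>i\<in>{1..<r}. mconst (u i) * mvar i) \<in> cf k" by (metis cf.uminus)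
  then have "u i \<in> k" using k.cf_times_linear_form[of "{1..<r}" a u i] a i by auto
  with i show False by simp
qed

text \<open>\<open>u 0 = 1\<close> and \<open>u 1\<close> are independent over the
  \<open>p\<close>-th powers. This is the coefficient outside \<open>k\<close> that
  \<open>\<beta>_powers_indep\<close> asks for when \<open>k\<close> is the field of
  \<open>p\<close>-th powers.\<close>

lemma u_1_not_pow: "u 1 \<notin> range (\<lambda>x. x ^ p)"
proof
  assume "u 1 \<in> range (\<lambda>x. x ^ p)"
  then obtain x where x: "u 1 = x ^ p" by auto
  define c where "c = (\<lambda>i::nat. if i = 0 then - x else if i = 1 then 1 else 0)"
  have "(\<Sum>i<r. c i ^ p * u i) = (\<Sum>i\<in>{0,1}. c i ^ p * u i)"
    using r_ge_2 p_pos by (intro sum.mono_neutral_right) (auto simp: c_def)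
  also have "\<dots> = 0" by (simp add: c_def u_0 uminus_pow x[unfolded One_nat_def])
  finally have "c 1 = 0" using r_ge_2 pindepD[OF aniso, of c 1] by simp
  then show False by (simp add: c_def)
qed

lemma \<beta>_powers_indep_fr:
  assumes "(\<Sum>j<p. fr (c j) * \<beta> ^ j) = 0" "j < p"
  shows "c j = 0"
proof -
  have "fr (c j) = 0"
    by (rule \<beta>_powers_indep[OF pfield_range _ u_1_not_pow _ assms])
       (use r_ge_2 pfield.fr_cf[OF pfield_range] in auto)
  then show ?thesis by simp
qed

lemma \<sigma>_eq_0_iff:
  assumes "f \<in> mpolys {..<r}"
  shows "\<sigma> f = 0 \<longleftrightarrow> \<Phi> dvd f"
proof
  assume f: "\<sigma> f = 0"
  obtain c where c: "reduces_to f c" using ex_reduces_to[OF assms] by blast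
  have "c k = 0" if "k < p" for k
    by (rule \<beta>_powers_indep_fr[OF _ that]) (use f c \<sigma>_reduces_to in auto)
  with c show "\<Phi> dvd f" by (simp add: reduces_to_def)
qed (rule \<Phi>_dvd_\<sigma>)

end

section \<open>Multiplicities along the hyperplane and partial derivatives\<close>

context qform
begin

text \<open>Lift, to the full polynomial ring, of a combination of the \<open>w j\<close> over the
  coordinate ring. A relation is a lift divisible by \<open>lam\<close>; its multiplicity along
  \<open>lam\<close> is the information that \<open>\<tau>\<close> forgets.\<close>

definition tw :: "nat set \<Rightarrow> (nat \<Rightarrow> 'a) \<Rightarrow> (nat \<Rightarrow> 'a mpoly) \<Rightarrow> 'a mpoly" where
  "tw J w P = (\<Sum>j\<in>J. mconst (w j) * fr (P j))"

lemma \<tau>_tw: "\<tau> (tw J w P) = (\<Sum>j\<in>J. mconst (w j) * \<sigma> (P j))"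
  by (simp add: tw_def \<tau>_simps \<sigma>_def)

lemma pdiff_tw: "pdiff i (tw J w P) = tw J w (\<lambda>j. pdiff i (P j))"
  by (simp add: tw_def pdiff_sum pdiff_mconst_mult fr_pdiff)

lemma pdiff_lam: "i < r \<Longrightarrow> pdiff i lam = mconst (u i)"
  by (simp add: lam_def pdiff_sum pdiff_mconst_mult pdiff_mvar if_distrib[of "\<lambda>x. _ * x"] cong: if_cong)

lemma lam_neq_0: "lam \<noteq> 0"
proof
  assume "lam = 0"
  then have "pdiff 0 lam = 0" by simp
  then show False using r_ge_2 by (simp add: pdiff_lam u_0)
qed

text \<open>As a polynomial in \<open>x_0\<close>, \<open>lam\<close> is
  \<open>x_0 - \<beta>\<close>, so \<open>lam ^ p\<close> is monic of degree \<open>p\<close> and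
  cannot divide a nonzero polynomial of smaller degree.\<close>

lemma lam_pow_dvd:
  assumes C: "\<And>k. k < p \<Longrightarrow> C k \<in> mpolys {1..<r}" and dvd: "lam ^ p dvd (\<Sum>k<p. C k * mvar 0 ^ k)"
    and k: "k < p"
  shows "C k = 0"
proof -
  define \<xi> :: "'a mpoly \<Rightarrow> 'a mpoly poly"
    where "\<xi> = mp_eval (\<lambda>c. [:mconst c:]) (\<lambda>i. if i = 0 then [:0, 1:] else [:mvar i:])"
  have c: "rhom (\<lambda>c::'a. [:mconst c:])" by (rule rhom_comp[OF rhom_pconst rhom_mconst])
  interpret \<xi>: rhom \<xi> unfolding \<xi>_def by (rule rhom_mp_eval[OF c])
  have \<xi>_const: "\<xi> P = [:P:]" if "P \<in> mpolys {1..<r}" for P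
    using that \<xi>.rhom_axioms rhom_pconst
    by (rule mpolys_hom_eqI) (auto simp: \<xi>_def mp_eval_mconst[OF c] mp_eval_mvar[OF c])
  have \<xi>_0: "\<xi> (mvar 0) = [:0, 1:]"
    by (simp add: \<xi>_def mp_eval_mvar[OF c])
  have "\<xi> lam = [:- \<beta>, 1:]"
    by (simp add: lam_eq \<xi>.diff \<xi>_0 \<xi>_const[OF \<beta>_mpolys])
  then have dvd': "[:- \<beta>, 1:] ^ p dvd \<xi> (\<Sum>k<p. C k * mvar 0 ^ k)"
    using \<xi>.dvd[OF dvd] by (simp add: \<xi>.power)
  have eq: "\<xi> (\<Sum>k<p. C k * mvar 0 ^ k) = (\<Sum>k<p. monom (C k) k)"
    unfolding \<xi>.sum using C by (intro sum.cong) (auto simp: \<xi>.mult \<xi>.power \<xi>_0 \<xi>_const monom_altdef)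
  have co: "coeff (\<Sum>k<p. monom (C k) k) j = (if j < p then C j else 0)" for j
    by (auto simp: coeff_sum)
  have "degree (\<Sum>k<p. monom (C k) k) < p"
    using p_pos by (intro degree_lessI) (auto simp: co)
  then have "(\<Sum>k<p. monom (C k) k) = 0"
    using dvd_imp_degree_le[OF dvd'] by (auto simp: eq degree_linear_power)
  then show ?thesis using co[of k] k by simp
qed

text \<open>Since \<open>fr \<Phi> = lam ^ p\<close>, each \<open>P j\<close> may be replaced by its
  remainder modulo \<open>\<Phi>\<close>. Divisibility then kills all coefficients in
  \<open>x_0\<close>, and independence of \<open>w\<close> kills the remainders themselves.\<close>

lemma lam_pow_not_dvd_tw:
  assumes w: "pindep p J w" and P: "\<And>j. j \<in> J \<Longrightarrow> P j \<in> mpolys {..<r}"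
    and j0: "j0 \<in> J" "\<sigma> (P j0) \<noteq> 0"
  shows "\<not> lam ^ p dvd tw J w P"
proof
  assume dvd: "lam ^ p dvd tw J w P"
  have "\<forall>j\<in>J. \<exists>c. reduces_to (P j) c" using P ex_reduces_to by blast
  then obtain c where c: "\<And>j. j \<in> J \<Longrightarrow> reduces_to (P j) (c j)" by metis
  define C where "C = (\<lambda>k. \<Sum>j\<in>J. mconst (w j) * fr (c j k))"
  have "lam ^ p dvd fr (P j) - (\<Sum>k<p. fr (c j k) * mvar 0 ^ k)" if "j \<in> J" for j
  proof -
    have "\<Phi> dvd P j - (\<Sum>k<p. c j k * mvar 0 ^ k)" using c[OF that] by (simp add: reduces_to_def)
    then have "fr \<Phi> dvd fr (P j - (\<Sum>k<p. c j k * mvar 0 ^ k))" by (rule rhom.dvd[OF rhom_fr])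
    then show ?thesis by (simp add: fr_\<Phi> fr_simps)
  qed
  then have "lam ^ p dvd (\<Sum>j\<in>J. mconst (w j) * (fr (P j) - (\<Sum>k<p. fr (c j k) * mvar 0 ^ k)))"
    by (intro dvd_sum dvd_mult)
  also have "(\<Sum>j\<in>J. mconst (w j) * (fr (P j) - (\<Sum>k<p. fr (c j k) * mvar 0 ^ k))) =
      tw J w P - (\<Sum>j\<in>J. \<Sum>k<p. mconst (w j) * fr (c j k) * mvar 0 ^ k)"
    by (simp add: tw_def sum_subtractf right_diff_distrib sum_distrib_left mult.assoc)
  also have "(\<Sum>j\<in>J. \<Sum>k<p. mconst (w j) * fr (c j k) * mvar 0 ^ k) = (\<Sum>k<p. C k * mvar 0 ^ k)"
    by (subst sum.swap) (simp add: C_def sum_distrib_right)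
  finally have "lam ^ p dvd tw J w P - (\<Sum>k<p. C k * mvar 0 ^ k)" .
  from dvd_diff[OF dvd this] have dvd': "lam ^ p dvd (\<Sum>k<p. C k * mvar 0 ^ k)" by simp
  have "C k \<in> mpolys {1..<r}" for k
    unfolding C_def using c by (intro mpolys_sum mpolys_mult mpolys_fr) (auto simp: reduces_to_def)
  then have "C k = 0" if "k < p" for k
    using lam_pow_dvd[OF _ dvd' that] by blast
  then have "c j k = 0" if "k < p" "j \<in> J" for j k
    using pindep_fr[OF w, of "\<lambda>j. c j k" j] that by (simp add: C_def)
  then have "\<sigma> (P j0) = 0" using \<sigma>_reduces_to[OF c[OF j0(1)]] j0 by (simp add: fr_simps)
  with j0 show False by simp
qed

lemma tw_multiplicity:
  assumes "pindep p J w" "\<And>j. j \<in> J \<Longrightarrow> P j \<in> mpolys {..<r}" "j0 \<in> J" "\<sigma> (P j0) \<noteq> 0"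
  obtains k R where "k < p" "tw J w P = lam ^ k * R" "\<tau> R \<noteq> 0"
proof -
  have nd: "\<not> lam ^ p dvd tw J w P" using lam_pow_not_dvd_tw[where P = P, OF assms(1,2,3,4)] .
  define n where "n = (LEAST n. \<not> lam ^ n dvd tw J w P)"
  have n: "\<not> lam ^ n dvd tw J w P" unfolding n_def
    using nd by (rule LeastI[of "\<lambda>n. \<not> lam ^ n dvd tw J w P"])
  have "n \<le> p" unfolding n_def
    using nd by (rule Least_le[of "\<lambda>n. \<not> lam ^ n dvd tw J w P"])
  obtain k where k: "n = Suc k" using n by (cases n) auto
  then have "lam ^ k dvd tw J w P" using not_less_Least[of k "\<lambda>n. \<not> lam ^ n dvd tw J w P"]
    unfolding n_def by simp
  then obtain R where R: "tw J w P = lam ^ k * R" by (auto simp: dvd_def)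
  have "\<tau> R \<noteq> 0"
  proof
    assume "\<tau> R = 0"
    then have "lam dvd R" by (simp add: \<tau>_eq_0_iff)
    then have "lam ^ n dvd tw J w P" unfolding R k by (auto simp: dvd_def)
    with n show False by simp
  qed
  with that[of k R] R \<open>n \<le> p\<close> k show ?thesis by simp
qed

lemma of_nat_neq_0: "0 < k \<Longrightarrow> k < p \<Longrightarrow> (of_nat k :: 'a mpoly) \<noteq> 0"
  by (auto simp: of_nat_eq_0_iff_char_dvd char_mpoly dest: dvd_imp_le)

lemma pdiff_lam_power:
  assumes "i < r" "G = lam ^ Suc k * R"
  shows "pdiff i G = lam ^ k * (of_nat (Suc k) * mconst (u i) * R + lam * pdiff i R)"
  by (simp add: assms pdiff_mult pdiff_power[of i lam "Suc k"] pdiff_lam algebra_simps del: power_Suc)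
     (simp add: algebra_simps)

text \<open>The derivative along \<open>x_0\<close> lowers the multiplicity by exactly one as long
  as it is positive and below \<open>p\<close>: the factor it produces is the multiplicity itself,
  times \<open>u 0 = 1\<close>.\<close>

lemma tw_lower_multiplicity:
  assumes "tw J w P = lam ^ k * R" "\<tau> R \<noteq> 0" "k < p" "t \<le> k" "\<And>j. j \<in> J \<Longrightarrow> P j \<in> mpolys {..<r}"
  shows "\<exists>P' R'. tw J w P' = lam ^ t * R' \<and> \<tau> R' \<noteq> 0 \<and> (\<forall>j\<in>J. P' j \<in> mpolys {..<r})"
  using assms
proof (induction k arbitrary: P R)
  case 0
  then show ?case by blast
next
  case (Suc k)
  show ?case
  proof (cases "t = Suc k")
    case True
    with Suc.prems show ?thesis by blast
  next
    case False
    define R' where "R' = of_nat (Suc k) * mconst (u 0) * R + lam * pdiff 0 R"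
    have "tw J w (\<lambda>j. pdiff 0 (P j)) = lam ^ k * R'"
      using pdiff_lam_power[OF _ Suc.prems(1), of 0] r_ge_2 by (simp add: pdiff_tw R'_def)
    moreover have "\<tau> R' = of_nat (Suc k) * \<tau> R"
      by (simp only: R'_def \<tau>_simps \<tau>_lam u_0 mconst_1 \<tau>_mconst) simp
    then have "\<tau> R' \<noteq> 0" using of_nat_neq_0[of "Suc k"] Suc.prems by simp
    ultimately show ?thesis
      using Suc.IH[of "\<lambda>j. pdiff 0 (P j)" R'] Suc.prems False mpolys_pdiff by force
  qed
qed

text \<open>On the hyperplane the product rule leaves only the derivative of \<open>lam\<close>.
  Thus one element, the normal derivative \<open>\<tau> R\<close>, multiplies every
  \<open>u i\<close> into the span of the \<open>w j\<close>.\<close>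

lemma tw_multiplicity_1:
  assumes "tw J w P = lam * R" "i < r"
  shows "mconst (u i) * \<tau> R = (\<Sum>j\<in>J. mconst (w j) * \<sigma> (pdiff i (P j)))"
proof -
  have "pdiff i (tw J w P) = mconst (u i) * R + lam * pdiff i R"
    using pdiff_lam_power[OF assms(2), of "tw J w P" 0 R] assms(1) by simp
  then have "\<tau> (tw J w (\<lambda>j. pdiff i (P j))) = mconst (u i) * \<tau> R"
    by (simp add: pdiff_tw \<tau>_simps \<tau>_lam)
  then show ?thesis by (simp add: \<tau>_tw)
qed

text \<open>The same with two derivatives; the 2 comes from the second derivative of
  \<open>lam ^ 2\<close>. For \<open>p = 2\<close> the left side vanishes, but a multiplicity 2
  below \<open>p\<close> excludes this case.\<close>

lemma tw_multiplicity_2: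
  assumes "tw J w P = lam ^ 2 * R" "i < r" "l < r"
  shows "mconst (u i) * mconst (u l) * (2 * \<tau> R) = (\<Sum>j\<in>J. mconst (w j) * \<sigma> (pdiff i (pdiff l (P j))))"
proof -
  define R' where "R' = 2 * mconst (u l) * R + lam * pdiff l R"
  have "tw J w (\<lambda>j. pdiff l (P j)) = lam * R'"
    using pdiff_lam_power[OF assms(3), of "tw J w P" 1 R] assms(1)
    by (simp add: R'_def power2_eq_square flip: pdiff_tw)
  from tw_multiplicity_1[OF this assms(2)]
  have "mconst (u i) * \<tau> R' = (\<Sum>j\<in>J. mconst (w j) * \<sigma> (pdiff i (pdiff l (P j))))" .
  moreover have "\<tau> R' = 2 * mconst (u l) * \<tau> R"
    using \<tau>_simps(9)[of 2] by (simp add: R'_def \<tau>_simps \<tau>_lam)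
  ultimately show ?thesis by (simp add: mult_ac)
qed

end

section \<open>Forms with values in a finite extension of the field of \<open>p\<close>-th powers\<close>

text \<open>
  \<open>KK\<close> is the coordinate ring of the hypersurface and \<open>MM\<close> is its compositum with \<open>L\<close>. With
  \<open>[L : F\<^sup>p] = N\<close>, the fraction field of \<open>MM\<close> has degree \<open>N\<close> over the functions in
  \<open>x\<^sub>1, \<dots>, x\<^bsub>r-1\<^esub>\<close> with coefficients in \<open>F\<^sup>p\<close>, and that of \<open>KK\<close> has degree \<open>p\<close>.
\<close>

locale value_field = qform p F r u + L: pfield p F L
  for p and F :: "'a::field itself" and r u and L :: "'a set" +
  fixes e :: "nat \<Rightarrow> 'a" and N :: nat
  assumes u_L: "i < r \<Longrightarrow> u i \<in> L" and e_L: "l < N \<Longrightarrow> e l \<in> L"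
    and e_indep: "pindep p {..<N} e" and e_span: "x \<in> L \<Longrightarrow> \<exists>c. x = (\<Sum>l<N. c l ^ p * e l)"
    and N_less: "N < p * r"
begin

definition KK :: "'a mpoly set" where "KK = \<sigma> ` mpolys {..<r}"

definition MM :: "'a mpoly set" where "MM = cf L \<inter> mpolys {1..<r}"

definition AA :: "'a mpoly set" where "AA = fr ` mpolys {1..<r}"

abbreviation U :: "nat \<Rightarrow> 'a mpoly" where "U \<equiv> \<lambda>i. mconst (u i)"

lemma subring_hom_image:
  assumes "rhom h"
  shows "subring (h ` mpolys I :: 'a mpoly set)"
proof
  interpret h: rhom h by fact
  show "1 \<in> h ` mpolys I" using h.one by (metis image_eqI mpolys_1)
  fix x y assume "x \<in> h ` mpolys I" "y \<in> h ` mpolys I"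
  then obtain a b where "x = h a" "y = h b" "a \<in> mpolys I" "b \<in> mpolys I" by auto
  then show "x - y \<in> h ` mpolys I" "x * y \<in> h ` mpolys I"
    by (auto intro: image_eqI[of _ _ "a - b"] image_eqI[of _ _ "a * b"] simp: h.diff h.mult
        mpolys_diff mpolys_mult)
qed

sublocale K: subring KK
  unfolding KK_def by (rule subring_hom_image[OF rhom_\<sigma>])

sublocale M: subring MM
  unfolding MM_def by (rule subring_cf[OF L.subring_axioms])

sublocale A: subring AA
  unfolding AA_def by (rule subring_hom_image[OF rhom_fr])

lemma AA_KK: "AA \<subseteq> KK"
proof
  fix x assume "x \<in> AA"
  then obtain a where "a \<in> mpolys {1..<r}" "x = fr a" by (auto simp: AA_def)
  moreover have "mpolys {1..<r} \<subseteq> (mpolys {..<r} :: 'a mpoly set)" by (rule mpolys_mono) auto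
  ultimately show "x \<in> KK" by (auto simp: KK_def \<sigma>_id intro!: image_eqI[of _ _ a])
qed

lemma cf_psubst:
  assumes "P \<in> cf L" "\<And>i. f i \<in> cf L"
  shows "psubst f P \<in> cf L"
proof -
  interpret c: subring "cf L" using subring_cf[OF L.subring_axioms, of UNIV] by simp
  show ?thesis unfolding psubst_eq_mp_eval mp_eval_def mon_def
    using assms by (intro c.sum c.mult c.prod c.power) (simp_all add: cf_mconst_iff L.zero, simp add: cf_def)
qed

lemma mconst_MM: "a \<in> L \<Longrightarrow> mconst a \<in> MM"
  by (simp add: MM_def cf_mconst_iff L.zero)

lemma mvar_cf: "mvar i \<in> cf L"
  by (auto simp: cf_def mvar_def lookup_single when_def L.zero L.one)

lemma \<beta>_cf: "\<beta> \<in> cf L"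
proof -
  interpret c: subring "cf L" using subring_cf[OF L.subring_axioms, of UNIV] by simp
  show ?thesis unfolding \<beta>_def
    by (intro c.uminus c.sum c.mult mvar_cf) (auto simp: cf_mconst_iff L.zero u_L)
qed

lemma \<beta>_MM: "\<beta> \<in> MM"
  by (simp add: MM_def \<beta>_cf \<beta>_mpolys[simplified])

lemma \<tau>_cf: "P \<in> cf L \<Longrightarrow> \<tau> P \<in> cf L"
  unfolding \<tau>_def by (rule cf_psubst) (auto simp: \<beta>_cf mvar_cf)

lemma KK_MM: "KK \<subseteq> MM"
  using \<tau>_cf[OF L.fr_cf] \<sigma>_mpolys by (auto simp: KK_def MM_def \<sigma>_def)

lemma \<beta>_KK: "\<beta> \<in> KK"
  unfolding KK_def by (rule image_eqI[of _ _ "mvar 0"]) (use r_ge_2 in \<open>auto simp: \<sigma>_mvar\<close>)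

lemma \<sigma>_KK: "P \<in> mpolys {..<r} \<Longrightarrow> \<sigma> P \<in> KK"
  by (simp add: KK_def)

text \<open>Makes nonzero elements of \<open>MM\<close> invertible up to scalars:
  \<open>z^(p-1)\<close> times \<open>z\<close> is a nonzero element of \<open>AA\<close>, hence of
  \<open>KK\<close>.\<close>

lemma power_p_AA:
  assumes "z \<in> MM"
  shows "z ^ p \<in> AA"
proof -
  have "psubst (\<lambda>i. mvar i ^ p) z \<in> mpolys {1..<r}"
    by (rule mpolys_psubst) (use assms in \<open>auto simp: MM_def intro!: mpolys_power\<close>)
  then show ?thesis unfolding AA_def by (subst power_p_eq_fr) (rule imageI)
qed

lemma coordinates:
  assumes "P \<in> cf L" "P \<in> mpolys I"
  shows "\<exists>c. (\<forall>l. c l \<in> mpolys I) \<and> P = (\<Sum>l<N. mconst (e l) * fr (c l))"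
proof -
  have "\<forall>x\<in>L. \<exists>c. x = (\<Sum>l<N. c l ^ p * e l)" using e_span by blast
  then obtain C where C: "\<And>x. x \<in> L \<Longrightarrow> x = (\<Sum>l<N. C x l ^ p * e l)" by metis
  define c where "c = (\<lambda>l. \<Sum>m\<in>Poly_Mapping.keys P. Poly_Mapping.single m (C (Poly_Mapping.lookup P m) l))"
  have lc: "Poly_Mapping.lookup (c l) m = (if m \<in> Poly_Mapping.keys P then C (Poly_Mapping.lookup P m) l else 0)" for l m
    by (auto simp: c_def lookup_sum lookup_single when_def)
  have "c l \<in> mpolys I" for l
    using assms by (auto simp: mpolys_def in_keys_iff lc split: if_splits)
  moreover have "P = (\<Sum>l<N. mconst (e l) * fr (c l))"
  proof (rule poly_mapping_eqI)
    fix m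
    have "Poly_Mapping.lookup P m \<in> L" using assms by (simp add: cf_def)
    from C[OF this] show "Poly_Mapping.lookup P m = Poly_Mapping.lookup (\<Sum>l<N. mconst (e l) * fr (c l)) m"
      by (cases "m \<in> Poly_Mapping.keys P")
         (simp_all add: lookup_sum lookup_mconst_mult lookup_fr lc in_keys_iff mult.commute
           zero_power[OF p_pos])
  qed
  ultimately show ?thesis by blast
qed

text \<open>The products of the \<open>m i\<close> with the first \<open>p\<close> powers of
  \<open>\<beta>\<close> are independent over \<open>AA\<close>, and \<open>MM\<close> has only
  \<open>N\<close> coordinates over \<open>AA\<close>.\<close>

lemma indep_card_le:
  assumes I: "finite I" and m: "\<And>i. i \<in> I \<Longrightarrow> m i \<in> MM" and ind: "K.indep I m"
  shows "p * card I \<le> N"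
proof (rule ccontr)
  assume "\<not> ?thesis"
  then have less: "card {..<N} < card (I \<times> {..<p})" by (simp add: card_cartesian_product mult.commute)
  have "\<forall>x\<in>I \<times> {..<p}. \<exists>c. (\<forall>l. c l \<in> mpolys {1..<r}) \<and>
      m (fst x) * \<beta> ^ snd x = (\<Sum>l<N. mconst (e l) * fr (c l))"
  proof
    fix x assume "x \<in> I \<times> {..<p}"
    then have "m (fst x) * \<beta> ^ snd x \<in> MM" using m \<beta>_MM by (auto intro!: M.mult M.power)
    then show "\<exists>c. (\<forall>l. c l \<in> mpolys {1..<r}) \<and>
        m (fst x) * \<beta> ^ snd x = (\<Sum>l<N. mconst (e l) * fr (c l))"
      by (intro coordinates) (auto simp: MM_def)
  qed
  from bchoice[OF this] obtain c where c: "\<forall>x\<in>I \<times> {..<p}. (\<forall>l. c x l \<in> mpolys {1..<r}) \<and>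
      m (fst x) * \<beta> ^ snd x = (\<Sum>l<N. mconst (e l) * fr (c x l))" ..
  obtain a where a: "\<forall>x\<in>I \<times> {..<p}. a x \<in> AA" "\<exists>x\<in>I \<times> {..<p}. a x \<noteq> 0"
      "\<forall>l\<in>{..<N}. (\<Sum>x\<in>I \<times> {..<p}. a x * fr (c x l)) = 0"
  proof -
    have "fr (c x l) \<in> AA" if "x \<in> I \<times> {..<p}" for x l using c that by (auto simp: AA_def)
    with A.ex_linear_dependence[OF _ _ less, of "\<lambda>x l. fr (c x l)"] I that show thesis by blast
  qed
  have "(\<Sum>i\<in>I. (\<Sum>k<p. a (i, k) * \<beta> ^ k) * m i) = (\<Sum>x\<in>I \<times> {..<p}. a x * (m (fst x) * \<beta> ^ snd x))"
    by (simp add: sum_distrib_right sum.cartesian_product case_prod_beta mult.assoc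
        mult.commute[of "m _"])
  also have "\<dots> = (\<Sum>x\<in>I \<times> {..<p}. \<Sum>l<N. mconst (e l) * (a x * fr (c x l)))"
    using c by (intro sum.cong) (auto simp: sum_distrib_left mult_ac)
  also have "\<dots> = (\<Sum>l<N. mconst (e l) * (\<Sum>x\<in>I \<times> {..<p}. a x * fr (c x l)))"
    by (subst sum.swap) (simp add: sum_distrib_left)
  also have "\<dots> = 0" using a by simp
  finally have rel: "(\<Sum>i\<in>I. (\<Sum>k<p. a (i, k) * \<beta> ^ k) * m i) = 0" .
  have aK: "a (i, k) \<in> KK" if "i \<in> I" "k < p" for i k using a(1) AA_KK that by auto
  have zero: "(\<Sum>k<p. a (i, k) * \<beta> ^ k) = 0" if "i \<in> I" for i
    using aK \<beta>_KK by (intro K.indepD[OF ind _ rel that] K.sum K.mult K.power) auto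
  have "\<forall>x\<in>I \<times> {..<p}. \<exists>y. a x = fr y" using a(1) by (auto simp: AA_def)
  from bchoice[OF this] obtain b where b: "\<forall>x\<in>I \<times> {..<p}. a x = fr (b x)" ..
  have "(\<Sum>k<p. fr (b (i, k)) * \<beta> ^ k) = 0" if "i \<in> I" for i
  proof -
    have "(\<Sum>k<p. fr (b (i, k)) * \<beta> ^ k) = (\<Sum>k<p. a (i, k) * \<beta> ^ k)"
      using b that by (intro sum.cong) auto
    with zero[OF that] show ?thesis by simp
  qed
  then have "b (i, k) = 0" if "i \<in> I" "k < p" for i k
    using \<beta>_powers_indep_fr[of "\<lambda>k. b (i, k)" k] that by blast
  with a(2) b show False by (auto simp: fr_simps)
qed

text \<open>If the \<open>m i\<close> were too few, their products with the powers of
  \<open>\<beta>\<close> would be fewer than \<open>N\<close> and would still span all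
  \<open>e l\<close> over \<open>AA\<close>, up to denominators, against the independence of
  \<open>e\<close>.\<close>

lemma span_card_ge:
  assumes I: "finite I" and m: "\<And>i. i \<in> I \<Longrightarrow> m i \<in> MM" and span: "MM \<subseteq> K.rspan I m"
  shows "N \<le> p * card I"
proof (rule ccontr)
  assume "\<not> ?thesis"
  then have less: "card (I \<times> {..<p}) < card {..<N}"
    by (simp add: card_cartesian_product mult.commute)
  have "\<forall>l\<in>{..<N}. \<exists>d c. d \<in> KK \<and> d \<noteq> 0 \<and> (\<forall>i\<in>I. c i \<in> KK) \<and> d * mconst (e l) = (\<Sum>i\<in>I. c i * m i)"
    using span mconst_MM e_L unfolding K.rspan_def by blast
  from bchoice[OF this] obtain d where "\<forall>l\<in>{..<N}. \<exists>c. d l \<in> KK \<and> d l \<noteq> 0 \<and>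
      (\<forall>i\<in>I. c i \<in> KK) \<and> d l * mconst (e l) = (\<Sum>i\<in>I. c i * m i)" ..
  from bchoice[OF this] obtain c where "\<forall>l\<in>{..<N}. d l \<in> KK \<and> d l \<noteq> 0 \<and>
      (\<forall>i\<in>I. c l i \<in> KK) \<and> d l * mconst (e l) = (\<Sum>i\<in>I. c l i * m i)" ..
  then have dc: "d l \<in> KK \<and> d l \<noteq> 0 \<and> (\<forall>i\<in>I. c l i \<in> KK) \<and>
      d l * mconst (e l) = (\<Sum>i\<in>I. c l i * m i)" if "l < N" for l using that by blast
  have "\<exists>b. \<forall>k. b k \<in> mpolys {1..<r} \<and> (x = (\<Sum>k<p. fr (b k) * \<beta> ^ k))" if "x \<in> KK" for x
  proof -
    obtain f where f: "f \<in> mpolys {..<r}" "x = \<sigma> f" using \<open>x \<in> KK\<close> by (auto simp: KK_def)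
    then obtain b where "reduces_to f b" using ex_reduces_to by blast
    with f \<sigma>_reduces_to show ?thesis unfolding reduces_to_def by (intro exI[of _ b]) auto
  qed
  \<comment> \<open>The extra factor turns the denominator \<open>d l\<close> in \<open>KK\<close>
    into \<open>d l ^ p\<close>, which lies in \<open>AA\<close>.\<close>
  moreover have "d l ^ (p - 1) * c l i \<in> KK" if "l < N" "i \<in> I" for l i
    using dc that by (auto intro!: K.mult K.power)
  ultimately have "\<forall>x\<in>{..<N} \<times> I. \<exists>b. \<forall>k. b k \<in> mpolys {1..<r} \<and>
      d (fst x) ^ (p - 1) * c (fst x) (snd x) = (\<Sum>k<p. fr (b k) * \<beta> ^ k)" by auto
  from bchoice[OF this] obtain b' where b': "\<forall>x\<in>{..<N} \<times> I. \<forall>k. b' x k \<in> mpolys {1..<r} \<and>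
      d (fst x) ^ (p - 1) * c (fst x) (snd x) = (\<Sum>k<p. fr (b' x k) * \<beta> ^ k)" ..
  define b where "b = (\<lambda>l i. b' (l, i))"
  have b: "b l i k \<in> mpolys {1..<r} \<and> d l ^ (p - 1) * c l i = (\<Sum>k<p. fr (b l i k) * \<beta> ^ k)"
    if "l < N" "i \<in> I" for l i k
    using bspec[OF b', of "(l, i)"] that by (simp add: b_def)
  obtain a where a: "\<forall>l\<in>{..<N}. a l \<in> AA" "\<exists>l\<in>{..<N}. a l \<noteq> 0"
      "\<forall>x\<in>I \<times> {..<p}. (\<Sum>l<N. a l * fr (b l (fst x) (snd x))) = 0"
  proof -
    have "fr (b l (fst x) (snd x)) \<in> AA" if "l < N" "x \<in> I \<times> {..<p}" for l x
      using b that by (auto simp: AA_def)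
    with A.ex_linear_dependence[OF _ _ less, of "\<lambda>l x. fr (b l (fst x) (snd x))"] I that
    show thesis by blast
  qed
  have dA: "a l * d l ^ p \<in> AA" if "l < N" for l
    using a dc[OF that] that KK_MM by (auto intro!: A.mult power_p_AA)
  have "(\<Sum>l<N. mconst (e l) * (a l * d l ^ p)) = (\<Sum>l<N. a l * d l ^ (p - 1) * (d l * mconst (e l)))"
  proof (rule sum.cong[OF refl])
    fix l
    have "d l ^ p = d l ^ (p - 1) * d l" using power_minus_mult[OF p_pos, of "d l"] by simp
    then show "mconst (e l) * (a l * d l ^ p) = a l * d l ^ (p - 1) * (d l * mconst (e l))"
      by (simp only: mult_ac)
  qed
  also have "\<dots> = (\<Sum>l<N. \<Sum>i\<in>I. a l * (d l ^ (p - 1) * c l i) * m i)"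
    using dc by (intro sum.cong) (auto simp: sum_distrib_left mult_ac)
  also have "\<dots> = (\<Sum>l<N. \<Sum>i\<in>I. \<Sum>k<p. a l * fr (b l i k) * (\<beta> ^ k * m i))"
    using b by (intro sum.cong) (auto simp: sum_distrib_left sum_distrib_right mult.assoc)
  also have "\<dots> = (\<Sum>i\<in>I. \<Sum>k<p. \<Sum>l<N. a l * fr (b l i k) * (\<beta> ^ k * m i))"
    by (subst sum.swap) (rule sum.cong, simp, subst sum.swap, simp)
  also have "\<dots> = (\<Sum>i\<in>I. \<Sum>k<p. (\<Sum>l<N. a l * fr (b l i k)) * (\<beta> ^ k * m i))"
    by (simp add: sum_distrib_right)
  also have "\<dots> = 0" using a(3) by (intro sum.neutral ballI) auto
  finally have rel: "(\<Sum>l<N. mconst (e l) * (a l * d l ^ p)) = 0" .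
  have "\<forall>l\<in>{..<N}. \<exists>x. a l * d l ^ p = fr x" using dA by (auto simp: AA_def)
  from bchoice[OF this] obtain x where "\<forall>l\<in>{..<N}. a l * d l ^ p = fr (x l)" ..
  then have x: "a l * d l ^ p = fr (x l)" if "l < N" for l using that by blast
  have "(\<Sum>l<N. mconst (e l) * fr (x l)) = 0" using rel x by simp
  then have "x l = 0" if "l < N" for l using pindep_fr[OF e_indep] that by blast
  then have "a l = 0" if "l < N" for l using x[OF that] dc[OF that] that by (simp add: fr_simps)
  with a(2) show False by auto
qed

section \<open>The relative degree of \<open>MM\<close> over \<open>KK\<close>\<close>

definition \<kappa> :: nat where "\<kappa> = N div p"

lemma MM_coordinates: "z \<in> MM \<Longrightarrow> z \<in> K.rspan {..<N} (\<lambda>l. mconst (e l))"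
proof -
  assume "z \<in> MM"
  then obtain c where c: "\<forall>l. c l \<in> mpolys {1..<r}" "z = (\<Sum>l<N. mconst (e l) * fr (c l))"
    using coordinates[of z "{1..<r}"] by (auto simp: MM_def)
  have "(\<Sum>l<N. fr (c l) * mconst (e l)) \<in> K.rspan {..<N} (\<lambda>l. mconst (e l))"
    using c AA_KK by (intro K.rspan_sumI) (auto simp: AA_def)
  then show ?thesis using c by (simp add: mult.commute)
qed

lemma basis_card:
  assumes "finite I" "\<And>i. i \<in> I \<Longrightarrow> m i \<in> MM" "K.indep I m" "MM \<subseteq> K.rspan I m"
  shows "N = p * card I"
  using indep_card_le[OF assms(1-3)] span_card_ge[OF assms(1,2,4)] by simp

text \<open>A basis over \<open>KK\<close> extracted from the \<open>e l\<close> satisfies both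
  counts, so \<open>p\<close> divides \<open>N\<close> and the division in \<open>\<kappa>\<close>
  is exact.\<close>

lemma N_eq: "p * \<kappa> = N"
proof -
  obtain I where I: "I \<subseteq> {..<N}" "K.indep I (\<lambda>l. mconst (e l))"
      "\<forall>l\<in>{..<N}. mconst (e l) \<in> K.rspan I (\<lambda>l. mconst (e l))"
    using K.ex_basis[of "{..<N}" "\<lambda>l. mconst (e l)"] by auto
  have "N = p * card I"
  proof (rule basis_card)
    show "finite I" using I by (auto intro: finite_subset)
    show "MM \<subseteq> K.rspan I (\<lambda>l. mconst (e l))"
      using I(3) K.rspan_trans[OF _ MM_coordinates] by blast
  qed (use I e_L mconst_MM in auto)
  then have "\<kappa> = card I"
    unfolding \<kappa>_def using p_pos by (metis nonzero_mult_div_cancel_left less_not_refl)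
  then show ?thesis using \<open>N = p * card I\<close> by metis
qed

lemma \<kappa>_less: "\<kappa> < r"
  using N_less N_eq by (metis nat_mult_less_cancel_disj)

lemma spanning_card:
  assumes J: "finite J" and m: "\<And>j. j \<in> J \<Longrightarrow> m j \<in> MM" and span: "MM \<subseteq> K.rspan J m" and "card J \<le> \<kappa>"
  shows "K.indep J m"
proof -
  obtain I where I: "I \<subseteq> J" "K.indep I m" "\<forall>j\<in>J. m j \<in> K.rspan I m"
    using K.ex_basis[OF J] by blast
  have fin: "finite I" using I J by (auto intro: finite_subset)
  have "MM \<subseteq> K.rspan I m" using span I(3) K.rspan_trans[of J m I m] by blast
  then have "N = p * card I" using I m fin by (intro basis_card) auto
  then have "card I = \<kappa>" using N_eq p_pos by (metis mult_cancel1 not_less_zero)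
  then have "I = J" using I J assms(4) by (simp add: card_seteq)
  with I show ?thesis by simp
qed

lemma indep_spans:
  fixes I :: "nat set"
  assumes I: "finite I" and m: "\<And>i. i \<in> I \<Longrightarrow> m i \<in> MM" and ind: "K.indep I m" and "card I = \<kappa>"
  shows "MM \<subseteq> K.rspan I m"
proof
  fix z assume z: "z \<in> MM"
  show "z \<in> K.rspan I m"
  proof (rule ccontr)
    assume nz: "z \<notin> K.rspan I m"
    obtain k where k: "k \<notin> I" using ex_new_if_finite[OF infinite_UNIV_nat I] by blast
    let ?m = "m(k := z)"
    have eq: "(\<Sum>i\<in>I. c i * ?m i) = (\<Sum>i\<in>I. c i * m i)" for c
      using k by (intro sum.cong) auto
    have "K.indep I ?m" "K.rspan I ?m = K.rspan I m"
      using ind by (simp_all only: K.indep_def K.rspan_def eq)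
    then have "K.indep (insert k I) ?m"
      using I k nz by (intro K.indep_insert) auto
    then have "p * card (insert k I) \<le> N"
      using I m z k by (intro indep_card_le) auto
    then show False using I k assms(4) N_eq p_pos by simp
  qed
qed

text \<open>The \<open>r\<close> values \<open>u\<^sub>i\<close> are too many for a proper subextension.\<close>

lemma values_generate:
  assumes S: "pfield p S" and SL: "S \<subseteq> L" and uS: "\<And>i. i < r \<Longrightarrow> u i \<in> S"
  shows "L \<subseteq> S"
proof
  interpret S: pfield p F S by fact
  fix a assume aL: "a \<in> L"
  show "a \<in> S"
  proof (rule ccontr)
    assume aS: "a \<notin> S"
    have less: "card {..<N} < card ({..<r} \<times> {..<p})" using N_less
      by (simp add: card_cartesian_product mult.commute)
    have "\<forall>x\<in>{..<r} \<times> {..<p}. \<exists>c. u (fst x) * a ^ snd x = (\<Sum>l<N. c l ^ p * e l)"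
      using u_L aL by (auto intro!: e_span L.mult L.power)
    from bchoice[OF this] obtain c
      where c: "\<forall>x\<in>{..<r} \<times> {..<p}. u (fst x) * a ^ snd x = (\<Sum>l<N. c x l ^ p * e l)" ..
    \<comment> \<open>The dependence is sought among the \<open>p\<close>-th roots
      \<open>c x l\<close> of the coordinates, over the whole field. Raising it to the
      \<open>p\<close>-th power yields a relation whose coefficients are \<open>p\<close>-th
      powers.\<close>
    interpret UN: subring "UNIV :: 'a set" by unfold_locales auto
    obtain b where b: "\<exists>x\<in>{..<r} \<times> {..<p}. b x \<noteq> 0" "\<forall>l\<in>{..<N}. (\<Sum>x\<in>{..<r} \<times> {..<p}. b x * c x l) = 0"
      using UN.ex_linear_dependence[OF _ _ less, of c] by auto
    have "(\<Sum>k<p. (\<Sum>i<r. b (i, k) ^ p * u i) * a ^ k) = (\<Sum>i<r. \<Sum>k<p. b (i, k) ^ p * (u i * a ^ k))"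
      by (subst sum.swap) (simp add: sum_distrib_right mult.assoc)
    also have "\<dots> = (\<Sum>x\<in>{..<r} \<times> {..<p}. b x ^ p * (u (fst x) * a ^ snd x))"
      by (simp add: sum.cartesian_product case_prod_beta)
    also have "\<dots> = (\<Sum>x\<in>{..<r} \<times> {..<p}. \<Sum>l<N. (b x * c x l) ^ p * e l)"
      using c by (intro sum.cong) (auto simp: sum_distrib_left power_mult_distrib mult.assoc)
    also have "\<dots> = (\<Sum>l<N. (\<Sum>x\<in>{..<r} \<times> {..<p}. b x * c x l) ^ p * e l)"
      by (subst sum.swap) (simp add: rhom.sum[OF rhom_pow] sum_distrib_right)
    also have "\<dots> = 0" using b by (simp add: zero_power[OF p_pos])
    finally have rel: "(\<Sum>k<p. (\<Sum>i<r. b (i, k) ^ p * u i) * a ^ k) = 0" .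
    have zero: "(\<Sum>i<r. b (i, k) ^ p * u i) = 0" if "k < p" for k
    proof (rule ccontr)
      assume nz: "(\<Sum>i<r. b (i, k) ^ p * u i) \<noteq> 0"
      have "\<exists>d\<in>S. d \<noteq> 0 \<and> d * a \<in> S"
        using S.purely_inseparable_dependence[OF prime_p char_p S.pow_mem _ that nz rel] uS
        by (auto intro: S.sum S.mult S.pow_mem)
      then obtain d where "d \<in> S" "d \<noteq> 0" "d * a \<in> S" by blast
      then have "d * a / d \<in> S" by (intro S.divide)
      with aS \<open>d \<noteq> 0\<close> show False by simp
    qed
    have "b (i, k) = 0" if "i < r" "k < p" for i k
      using pindepD[OF aniso, of "\<lambda>i. b (i, k)" i] zero that by simp
    with b(1) show False by auto
  qed
qed

text \<open>Repeated multiplication by \<open>z\<close> stays in the span and arrives at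
  \<open>z ^ p * x\<close>, where \<open>z ^ p\<close> is a scalar that can be cancelled.\<close>

lemma values_span_stable:
  assumes z: "z \<in> MM" "z \<noteq> 0" and zx: "z * x \<in> K.rspan J m"
    and stable: "\<And>y. y \<in> K.rspan J m \<Longrightarrow> z * y \<in> K.rspan J m"
  shows "x \<in> K.rspan J m"
proof (rule K.rspan_cancel)
  show "z ^ p \<in> KK" using power_p_AA[OF z(1)] AA_KK by blast
  show "z ^ p \<noteq> 0" using z by simp
  have "z ^ n * (z * x) \<in> K.rspan J m" for n
    by (induction n) (auto simp: zx mult.assoc intro: stable)
  from this[of "p - 1"] show "z ^ p * x \<in> K.rspan J m"
    using power_minus_mult[OF p_pos, of z] by (simp flip: mult.assoc)
qed

lemma mult_rspan:
  assumes "\<And>j. j \<in> J \<Longrightarrow> z * m j \<in> K.rspan J' m'" "y \<in> K.rspan J m"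
  shows "z * y \<in> K.rspan J' m'"
proof -
  obtain d c where dc: "d \<in> KK" "d \<noteq> 0" "\<forall>j\<in>J. c j \<in> KK" "d * y = (\<Sum>j\<in>J. c j * m j)"
    using assms(2) by (rule K.rspanE)
  have "d * (z * y) = (\<Sum>j\<in>J. c j * (z * m j))"
    by (simp add: mult.left_commute[of _ z] dc(4) flip: sum_distrib_left)
  also have "\<dots> \<in> K.rspan J' m'"
  proof (rule K.rspan_sum)
    fix j assume "j \<in> J"
    then show "c j * (z * m j) \<in> K.rspan J' m'" using dc(3) assms(1)[of j] K.rspan_scale[of "c j" "z * m j"] by blast
  qed
  finally show ?thesis using dc K.rspan_cancel by blast
qed

lemma U_MM: "i < r \<Longrightarrow> U i \<in> MM"
  by (simp add: mconst_MM u_L)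

lemma tw_sum_MM:
  assumes "\<And>j. j \<in> J \<Longrightarrow> w j \<in> L" "\<And>j. j \<in> J \<Longrightarrow> P j \<in> mpolys {..<r}"
  shows "(\<Sum>j\<in>J. mconst (w j) * \<sigma> (P j)) \<in> MM"
  using assms KK_MM \<sigma>_KK by (intro M.sum M.mult mconst_MM) auto

lemma tw_sum_rspan:
  assumes "\<And>j. j \<in> J \<Longrightarrow> P j \<in> mpolys {..<r}"
  shows "(\<Sum>j\<in>J. mconst (w j) * \<sigma> (P j)) \<in> K.rspan J (\<lambda>j. mconst (w j))"
  using K.rspan_sumI[of J "\<lambda>j. \<sigma> (P j)"] assms by (simp add: \<sigma>_KK mult.commute)

lemma relation_multiplicity_1:
  assumes "tw J w P = lam * R" "\<And>j. j \<in> J \<Longrightarrow> P j \<in> mpolys {..<r}" "\<And>j. j \<in> J \<Longrightarrow> w j \<in> L"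
  shows "\<tau> R \<in> MM" "\<And>i. i < r \<Longrightarrow> \<tau> R * U i \<in> K.rspan J (\<lambda>j. mconst (w j))"
proof -
  show "\<tau> R \<in> MM"
    using tw_multiplicity_1[OF assms(1), of 0] tw_sum_MM[of J w "\<lambda>j. pdiff 0 (P j)"] assms r_ge_2
    by (simp add: u_0 mconst_1 mpolys_pdiff)
  show "\<tau> R * U i \<in> K.rspan J (\<lambda>j. mconst (w j))" if "i < r" for i
    using tw_multiplicity_1[OF assms(1) that] tw_sum_rspan[of J "\<lambda>j. pdiff i (P j)" w] assms
    by (simp add: mpolys_pdiff mult.commute)
qed

lemma relation_multiplicity_2:
  assumes "tw J w P = lam ^ 2 * R" "\<And>j. j \<in> J \<Longrightarrow> P j \<in> mpolys {..<r}" "\<And>j. j \<in> J \<Longrightarrow> w j \<in> L"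
  shows "2 * \<tau> R \<in> MM"
    "\<And>i l. i < r \<Longrightarrow> l < r \<Longrightarrow> 2 * \<tau> R * (U i * U l) \<in> K.rspan J (\<lambda>j. mconst (w j))"
proof -
  show "2 * \<tau> R \<in> MM"
    using tw_multiplicity_2[OF assms(1), of 0 0] tw_sum_MM[of J w "\<lambda>j. pdiff 0 (pdiff 0 (P j))"]
      assms r_ge_2
    by (simp add: u_0 mconst_1 mpolys_pdiff)
  show "2 * \<tau> R * (U i * U l) \<in> K.rspan J (\<lambda>j. mconst (w j))" if "i < r" "l < r" for i l
    using tw_multiplicity_2[OF assms(1) that] tw_sum_rspan[of J "\<lambda>j. pdiff i (pdiff l (P j))" w] assms
    by (simp add: mpolys_pdiff mult_ac)
qed

text \<open>As \<open>u 0 = 1\<close>, the hypothesis makes \<open>z\<close> and all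
  \<open>z * U i\<close>, hence all \<open>U i\<close>, stabilise the span. The elements of
  \<open>L\<close> that stabilise it form a field over the \<open>p\<close>-th powers which contains
  the \<open>u i\<close>, so it is \<open>L\<close>; and 1 lies in the span.\<close>

lemma stable_span_total:
  assumes z: "z \<in> MM" "z \<noteq> 0"
    and zU: "\<And>i l. i < r \<Longrightarrow> l < r \<Longrightarrow> z * (U i * U l) \<in> K.rspan {..<r} U"
  shows "MM \<subseteq> K.rspan {..<r} U"
proof
  let ?\<Lambda> = "K.rspan {..<r} U"
  have zUi: "z * U i * y \<in> ?\<Lambda>" if "i < r" "y \<in> ?\<Lambda>" for i y
    using that zU by (intro mult_rspan[OF _ that(2)]) (simp add: mult.assoc)
  have z\<Lambda>: "z * y \<in> ?\<Lambda>" if "y \<in> ?\<Lambda>" for y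
    using zUi[of 0 y] that r_ge_2 by (simp add: u_0 mconst_1)
  define S where "S = {a \<in> L. \<forall>y\<in>?\<Lambda>. mconst a * y \<in> ?\<Lambda>}"
  have sub: "subring S"
  proof
    show "1 \<in> S" by (simp add: S_def L.one mconst_1)
    fix a b assume ab: "a \<in> S" "b \<in> S"
    then show "a - b \<in> S"
      by (auto simp: S_def rhom.diff[OF rhom_mconst] left_diff_distrib intro: L.diff K.rspan_diff)
    from ab show "a * b \<in> S"
      by (auto simp: S_def rhom.mult[OF rhom_mconst] mult.assoc intro: L.mult)
  qed
  have S: "pfield p S"
  proof -
    have "x ^ p \<in> S" for x
    proof -
      have "mconst (x ^ p) \<in> KK" using \<sigma>_KK[of "mconst x"] by simp
      then show ?thesis by (auto simp: S_def L.pow_mem intro: K.rspan_scale)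
    qed
    then show ?thesis using sub by (intro pfield.intro) (auto simp: pfield_axioms_def frobenius_axioms)
  qed
  have uS: "u i \<in> S" if "i < r" for i
  proof -
    have "U i * y \<in> ?\<Lambda>" if "y \<in> ?\<Lambda>" for y
      by (rule values_span_stable[OF z _ z\<Lambda>]) (use zUi[OF \<open>i < r\<close> that] in \<open>simp_all add: mult.assoc\<close>)
    then show ?thesis using that by (simp add: S_def u_L)
  qed
  have LS: "L \<subseteq> S" using S uS by (intro values_generate) (auto simp: S_def)
  have "1 \<in> ?\<Lambda>" using K.rspan_base[of "{..<r}" 0 U] r_ge_2 by (simp add: u_0 mconst_1)
  then have L\<Lambda>: "mconst a \<in> ?\<Lambda>" if "a \<in> L" for a
    using LS that unfolding S_def by (force dest: bspec[where x = 1])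
  fix x assume "x \<in> MM"
  from MM_coordinates[OF this] show "x \<in> ?\<Lambda>"
    by (rule K.rspan_trans[rotated]) (use L\<Lambda> e_L in auto)
qed

text \<open>
  Let \<open>I\<close> index a basis of the span \<open>\<Lambda>\<close> of the \<open>u\<^sub>i\<close>. Every \<open>i \<notin> I\<close> gives a relation, vanishing on the
  hyperplane; let \<open>\<rho>\<^sub>i\<close> be its normal derivative. If no combination of these relations has
  multiplicity \<open>\<ge> 2\<close>, the \<open>\<rho>\<^sub>i\<close> are independent elements of the field stabilising \<open>\<Lambda>\<close>, and some \<open>m\<close>
  outside \<open>\<Lambda>\<close> would yield the \<open>r > \<kappa>\<close> independent elements \<open>u\<^sub>i\<close> \<open>(i \<in> I)\<close>, \<open>\<rho>\<^sub>i m\<close> \<open>(i \<notin> I)\<close>.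
  A combination of multiplicity \<open>\<ge> 2\<close> makes the \<open>u\<^sub>i\<close>, hence all of \<open>L\<close>, stabilise \<open>\<Lambda>\<close>.
\<close>

theorem values_span: "MM \<subseteq> K.rspan {..<r} U"
proof (rule ccontr)
  let ?\<Lambda> = "K.rspan {..<r} U"
  assume not: "\<not> MM \<subseteq> ?\<Lambda>"
  then obtain m where m: "m \<in> MM" "m \<notin> ?\<Lambda>" by blast
  obtain I where I: "I \<subseteq> {..<r}" "K.indep I U" "\<forall>j\<in>{..<r}. U j \<in> K.rspan I U"
    using K.ex_basis[of "{..<r}" U] by auto
  define I' where "I' = {..<r} - I"
  have split: "{..<r} = I \<union> I'" "I \<inter> I' = {}" "finite I" "finite I'"
    using I by (auto simp: I'_def intro: finite_subset)
  \<comment> \<open>Among the indices outside \<open>I\<close>, the relation belonging to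
    \<open>i\<close> involves \<open>i\<close> alone. This diagonal shape makes the coefficients of
    a combination visible in its entries \<open>Q j\<close>.\<close>
  have "\<exists>P. (\<forall>j. P j \<in> mpolys {..<r}) \<and> \<sigma> (P i) \<noteq> 0 \<and> (\<forall>j\<in>I' - {i}. P j = 0) \<and>
      (\<Sum>j<r. U j * \<sigma> (P j)) = 0" if i: "i \<in> I'" for i
  proof -
    have "U i \<in> K.rspan I U" using I i by (auto simp: I'_def)
    then obtain d c where dc: "d \<in> KK" "d \<noteq> 0" "\<forall>j\<in>I. c j \<in> KK" "d * U i = (\<Sum>j\<in>I. c j * U j)"
      by (rule K.rspanE)
    obtain D where D: "D \<in> mpolys {..<r}" "d = \<sigma> D" using dc by (auto simp: KK_def)
    have "\<forall>j\<in>I. \<exists>f. f \<in> mpolys {..<r} \<and> c j = \<sigma> f" using dc by (auto simp: KK_def)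
    from bchoice[OF this] obtain C where C: "\<forall>j\<in>I. C j \<in> mpolys {..<r} \<and> c j = \<sigma> (C j)" ..
    define P where "P = (\<lambda>j. if j = i then D else if j \<in> I then - C j else 0)"
    have iI: "i \<notin> I" using i by (simp add: I'_def)
    have "(\<Sum>j<r. U j * \<sigma> (P j)) = (\<Sum>j\<in>insert i I. U j * \<sigma> (P j))"
      using i I by (intro sum.mono_neutral_right) (auto simp: P_def I'_def \<sigma>_simps)
    also have "\<dots> = U i * d + (\<Sum>j\<in>I. U j * \<sigma> (P j))"
      using iI split by (simp add: P_def D)
    also have "(\<Sum>j\<in>I. U j * \<sigma> (P j)) = - (\<Sum>j\<in>I. c j * U j)"
      unfolding sum_negf[symmetric] using C iI by (intro sum.cong) (auto simp: P_def \<sigma>_simps)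
    finally have "(\<Sum>j<r. U j * \<sigma> (P j)) = 0" using dc(4) by (simp add: mult.commute)
    moreover have "\<forall>j. P j \<in> mpolys {..<r}" using D C by (auto simp: P_def intro: mpolys_uminus)
    moreover have "\<forall>j\<in>I' - {i}. P j = 0" by (auto simp: P_def I'_def)
    ultimately show ?thesis using D dc by (intro exI[of _ P]) (simp add: P_def)
  qed
  then have "\<forall>i\<in>I'. \<exists>P. (\<forall>j. P j \<in> mpolys {..<r}) \<and> \<sigma> (P i) \<noteq> 0 \<and> (\<forall>j\<in>I' - {i}. P j = 0) \<and>
      (\<Sum>j<r. U j * \<sigma> (P j)) = 0" by blast
  from bchoice[OF this] obtain P where P: "\<forall>i\<in>I'. (\<forall>j. P i j \<in> mpolys {..<r}) \<and> \<sigma> (P i i) \<noteq> 0 \<and>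
      (\<forall>j\<in>I' - {i}. P i j = 0) \<and> (\<Sum>j<r. U j * \<sigma> (P i j)) = 0" ..
  have "\<forall>i\<in>I'. \<exists>R. tw {..<r} u (P i) = lam * R"
  proof
    fix i assume "i \<in> I'"
    then have "\<tau> (tw {..<r} u (P i)) = 0" using P by (simp add: \<tau>_tw)
    then show "\<exists>R. tw {..<r} u (P i) = lam * R" by (simp add: \<tau>_eq_0_iff dvd_def)
  qed
  from bchoice[OF this] obtain R where R: "\<forall>i\<in>I'. tw {..<r} u (P i) = lam * R i" ..
  define v where "v = (\<lambda>i. if i \<in> I then U i else \<tau> (R i) * m)"
  have "K.indep {..<r} v"
    unfolding K.indep_def
  proof (intro allI impI; elim conjE)
    fix c assume c: "\<forall>j\<in>{..<r}. c j \<in> KK" and rel: "(\<Sum>j<r. c j * v j) = 0"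
    have "\<forall>j\<in>{..<r}. \<exists>f. f \<in> mpolys {..<r} \<and> c j = \<sigma> f" using c by (auto simp: KK_def)
    from bchoice[OF this] obtain A where A: "\<forall>j\<in>{..<r}. A j \<in> mpolys {..<r} \<and> c j = \<sigma> (A j)" ..
    define Q where "Q = (\<lambda>j. \<Sum>i\<in>I'. A i * P i j)"
    define T where "T = (\<Sum>i\<in>I'. fr (A i) * R i)"
    have Q: "Q j \<in> mpolys {..<r}" for j
      unfolding Q_def using A P split by (intro mpolys_sum mpolys_mult) auto
    have twQ: "tw {..<r} u Q = lam * T"
    proof -
      have "tw {..<r} u Q = (\<Sum>j<r. \<Sum>i\<in>I'. fr (A i) * (mconst (u j) * fr (P i j)))"
        by (simp add: tw_def Q_def fr_simps sum_distrib_left mult_ac)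
      also have "\<dots> = (\<Sum>i\<in>I'. fr (A i) * tw {..<r} u (P i))"
        by (subst sum.swap) (simp add: tw_def sum_distrib_left)
      also have "\<dots> = (\<Sum>i\<in>I'. fr (A i) * (lam * R i))" using R by simp
      also have "\<dots> = lam * T" by (simp add: T_def sum_distrib_left mult_ac)
      finally show ?thesis .
    qed
    note T1 = relation_multiplicity_1[OF twQ Q u_L, simplified]
    have TZ: "\<tau> T = (\<Sum>i\<in>I'. c i * \<tau> (R i))"
      using A split by (simp add: T_def \<tau>_simps \<sigma>_def)
    have rel': "(\<Sum>j\<in>I. c j * U j) + \<tau> T * m = 0"
    proof -
      have "(\<Sum>j<r. c j * v j) = (\<Sum>j\<in>I. c j * v j) + (\<Sum>j\<in>I'. c j * v j)"
        unfolding split(1) using split by (intro sum.union_disjoint) auto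
      also have "(\<Sum>j\<in>I. c j * v j) = (\<Sum>j\<in>I. c j * U j)" by (simp add: v_def)
      also have "(\<Sum>j\<in>I'. c j * v j) = \<tau> T * m"
        unfolding TZ sum_distrib_right by (intro sum.cong) (auto simp: v_def I'_def)
      finally show ?thesis using rel by simp
    qed
    \<comment> \<open>A nonzero \<open>\<tau> T\<close> would stabilise the span and multiply
      \<open>m\<close> into it, so \<open>m\<close> itself would belong to it.\<close>
    have T0: "\<tau> T = 0"
    proof (rule ccontr)
      assume nz: "\<tau> T \<noteq> 0"
      have "(\<Sum>j\<in>I. c j * U j) \<in> K.rspan I U"
        using c I by (intro K.rspan_sumI) auto
      then have "(\<Sum>j\<in>I. c j * U j) \<in> ?\<Lambda>" using K.rspan_mono[of "{..<r}" I] I by auto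
      moreover have "\<tau> T * m = - (\<Sum>j\<in>I. c j * U j)" using rel' by (simp add: eq_neg_iff_add_eq_0 add.commute)
      ultimately have "\<tau> T * m \<in> ?\<Lambda>" by (simp add: K.rspan_uminus)
      moreover have "\<tau> T * y \<in> ?\<Lambda>" if "y \<in> ?\<Lambda>" for y
        by (rule mult_rspan[OF _ that]) (use T1(2) in simp)
      ultimately have "m \<in> ?\<Lambda>" using T1(1) nz values_span_stable by blast
      with m show False by simp
    qed
    have cI: "c j = 0" if "j \<in> I" for j
      using K.indepD[OF I(2) _ _ that, of c] rel' T0 c I by auto
    have "c j = 0" if j: "j \<in> I'" for j
    proof (rule ccontr)
      assume nz: "c j \<noteq> 0"
      have jr: "j < r" using j by (simp add: I'_def)
      have "Q j = A j * P j j"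
      proof -
        have "Q j = (\<Sum>i\<in>{j}. A i * P i j)"
          unfolding Q_def using j P split by (intro sum.mono_neutral_right) auto
        then show ?thesis by simp
      qed
      then have "\<sigma> (Q j) \<noteq> 0" using A P j jr nz by (simp add: \<sigma>_simps)
      then obtain k R' where k: "k < p" "tw {..<r} u Q = lam ^ k * R'" "\<tau> R' \<noteq> 0"
        using tw_multiplicity[OF aniso, of Q j] Q jr by auto
      \<comment> \<open>\<open>\<tau> T = 0\<close> supplies a second factor \<open>lam\<close>,
        while a nonzero entry \<open>Q j\<close> keeps the multiplicity below
        \<open>p\<close>.\<close>
      have "lam dvd T" using T0 by (simp add: \<tau>_eq_0_iff)
      then have dvd2: "lam ^ 2 dvd lam ^ k * R'"
        unfolding k(2)[symmetric] twQ power2_eq_square by (rule mult_dvd_mono[OF dvd_refl])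
      have "2 \<le> k"
      proof (rule ccontr)
        assume "\<not> 2 \<le> k"
        then have "2 = k + (2 - k)" "0 < 2 - k" by auto
        then have "lam ^ k * lam ^ (2 - k) dvd lam ^ k * R'" using dvd2 by (metis power_add)
        then have "lam ^ (2 - k) dvd R'" using lam_neq_0 by simp
        then have "lam dvd R'" using \<open>0 < 2 - k\<close> by (metis dvd_power dvd_trans)
        then show False using k by (simp add: \<tau>_eq_0_iff)
      qed
      then obtain Q' R'' where Q': "tw {..<r} u Q' = lam ^ 2 * R''" "\<tau> R'' \<noteq> 0"
          "\<forall>j\<in>{..<r}. Q' j \<in> mpolys {..<r}"
        using tw_lower_multiplicity[OF k(2,3,1), of 2] Q by blast
      \<comment> \<open>2 is invertible because the multiplicity \<open>k\<close> satisfies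
        \<open>2 \<le> k < p\<close>.\<close>
      have "2 * \<tau> R'' \<noteq> 0"
        using Q' of_nat_neq_0[of 2] \<open>2 \<le> k\<close> k(1) by simp
      moreover have "2 * \<tau> R'' \<in> MM" "\<And>i l. i < r \<Longrightarrow> l < r \<Longrightarrow> 2 * \<tau> R'' * (U i * U l) \<in> ?\<Lambda>"
        using relation_multiplicity_2[OF Q'(1)] Q' u_L by auto
      ultimately have "MM \<subseteq> ?\<Lambda>" by (intro stable_span_total[of "2 * \<tau> R''"])
      with not show False ..
    qed
    with cI show "\<forall>j\<in>{..<r}. c j = 0" unfolding split(1) by blast
  qed
  moreover have "v i \<in> MM" if "i < r" for i
  proof (cases "i \<in> I")
    case False
    then have "i \<in> I'" using that by (simp add: I'_def)
    then have "\<tau> (R i) \<in> MM" using relation_multiplicity_1(1)[of "{..<r}" u "P i" "R i"] R P u_L by auto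
    with False m show ?thesis by (simp add: v_def M.mult)
  qed (use that U_MM in \<open>simp add: v_def\<close>)
  ultimately have "p * card {..<r} \<le> N" by (intro indep_card_le) auto
  with N_less show False by simp
qed

text \<open>Hoffmann's separation theorem for forms with values in \<open>L\<close>.\<close>

theorem separation:
  assumes w: "pindep p {..<\<kappa>} w" and wL: "\<And>j. j < \<kappa> \<Longrightarrow> w j \<in> L"
  shows "K.indep {..<\<kappa>} (\<lambda>j. mconst (w j))"
proof (rule ccontr)
  let ?\<Omega> = "K.rspan {..<\<kappa>} (\<lambda>j. mconst (w j))"
  assume not: "\<not> ?thesis"
  then obtain c j0 where c: "\<forall>j\<in>{..<\<kappa>}. c j \<in> KK" "(\<Sum>j<\<kappa>. c j * mconst (w j)) = 0"
      "j0 < \<kappa>" "c j0 \<noteq> 0" unfolding K.indep_def by auto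
  have "\<forall>j\<in>{..<\<kappa>}. \<exists>f. f \<in> mpolys {..<r} \<and> c j = \<sigma> f" using c by (auto simp: KK_def)
  from bchoice[OF this] obtain P where P: "\<forall>j\<in>{..<\<kappa>}. P j \<in> mpolys {..<r} \<and> c j = \<sigma> (P j)" ..
  have "\<sigma> (P j0) \<noteq> 0" using c P by auto
  then obtain k R where k: "k < p" "tw {..<\<kappa>} w P = lam ^ k * R" "\<tau> R \<noteq> 0"
    using tw_multiplicity[OF w, of P j0] P c(3) by auto
  have "\<tau> (tw {..<\<kappa>} w P) = 0" using c P by (simp add: \<tau>_tw mult.commute)
  then have "1 \<le> k" using k by (cases k) auto
  then obtain P' R' where P': "tw {..<\<kappa>} w P' = lam * R'" "\<tau> R' \<noteq> 0"
      "\<forall>j\<in>{..<\<kappa>}. P' j \<in> mpolys {..<r}"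
    using tw_lower_multiplicity[OF k(2,3,1), of 1] P by auto
  \<comment> \<open>The normal derivative of the relation multiplies all \<open>U i\<close> into the
    span of the \<open>w j\<close>, hence all of \<open>MM\<close> by \<open>values_span\<close>.
    Inverting \<open>z\<close> shows that the \<open>\<kappa>\<close> elements \<open>w j\<close>
    span \<open>MM\<close>, which forces them to be independent.\<close>
  define z where "z = \<tau> R'"
  have z: "z \<in> MM" "z \<noteq> 0" and zU: "\<And>i. i < r \<Longrightarrow> z * U i \<in> ?\<Omega>"
    using relation_multiplicity_1[OF P'(1)] P' wL by (auto simp: z_def)
  have zM: "z * y \<in> ?\<Omega>" if "y \<in> MM" for y
  proof (rule mult_rspan)
    show "y \<in> K.rspan {..<r} U" using values_span that by blast
  qed (simp add: zU)
  have "MM \<subseteq> ?\<Omega>"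
  proof
    fix y assume y: "y \<in> MM"
    have "z * (z ^ (p - 1) * y) \<in> ?\<Omega>" using y z by (intro zM M.mult M.power)
    also have "z * (z ^ (p - 1) * y) = z ^ p * y"
      using power_minus_mult[OF p_pos, of z] by (metis mult.assoc mult.commute)
    finally have "z ^ p * y \<in> ?\<Omega>" .
    then show "y \<in> ?\<Omega>" using K.rspan_cancel[of "z ^ p" y] z power_p_AA[of z] AA_KK by auto
  qed
  then have "K.indep {..<\<kappa>} (\<lambda>j. mconst (w j))"
    by (intro spanning_card) (auto intro: mconst_MM wL)
  with not show False ..
qed

lemma separation_spans:
  assumes "pindep p {..<\<kappa>} w" "\<And>j. j < \<kappa> \<Longrightarrow> w j \<in> L"
  shows "MM \<subseteq> K.rspan {..<\<kappa>} (\<lambda>j. mconst (w j))"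
  using assms by (intro indep_spans separation) (auto intro: mconst_MM)

end

section \<open>Birational maps between forms with the same field of values\<close>

context qform
begin

text \<open>The \<open>x_0\<close>-derivative of \<open>\<Phi>\<close> vanishes in characteristic
  \<open>p\<close>, so the derivation passes to the coordinate ring and acts formally on
  remainders.\<close>

lemma reduces_to_pdiff_0:
  assumes "reduces_to f c"
  shows "reduces_to (pdiff 0 f) (\<lambda>k. if Suc k < p then of_nat (Suc k) * c (Suc k) else 0)"
proof -
  obtain q where q: "p = Suc q" using p_pos by (cases p) auto
  obtain Q where Q: "f - (\<Sum>k<p. c k * mvar 0 ^ k) = \<Phi> * Q" and c: "\<And>k. c k \<in> mpolys {1..<r}"
    using assms by (auto simp: reduces_to_def dvd_def)
  have of_nat_p: "(of_nat p :: 'a mpoly) = 0"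
    using of_nat_CHAR[where 'a = "'a mpoly"] char_mpoly by simp
  have d\<Phi>: "pdiff 0 \<Phi> = 0"
    by (simp add: \<Phi>_def pdiff_sum pdiff_mconst_mult pdiff_power of_nat_p)
  have dc: "pdiff 0 (c k) = 0" for k
    using c[of k]
    by (induction rule: mpolys_induct) (auto simp: pdiff_mvar pdiff_add pdiff_mult)
  have "f = \<Phi> * Q + (\<Sum>k<p. c k * mvar 0 ^ k)" using Q by (simp add: algebra_simps)
  then have "pdiff 0 f = \<Phi> * pdiff 0 Q + (\<Sum>k<p. c k * (of_nat k * mvar 0 ^ (k - 1)))"
    by (simp add: pdiff_add d\<Phi> pdiff_sum pdiff_mult dc pdiff_power pdiff_mvar)
  also have "(\<Sum>k<p. c k * (of_nat k * mvar 0 ^ (k - 1))) = (\<Sum>k<q. of_nat (Suc k) * c (Suc k) * mvar 0 ^ k)"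
    unfolding q sum.lessThan_Suc_shift by (simp add: mult_ac)
  also have "\<dots> = (\<Sum>k<p. (if Suc k < p then of_nat (Suc k) * c (Suc k) else 0) * mvar 0 ^ k)"
    by (simp add: q)
  finally have "\<Phi> dvd pdiff 0 f - (\<Sum>k<p. (if Suc k < p then of_nat (Suc k) * c (Suc k) else 0) * mvar 0 ^ k)"
    by simp
  moreover have "(of_nat n :: 'a mpoly) \<in> mpolys I" for n I
    using mpolys_mconst[of "of_nat n"] by (simp add: rhom.of_nat[OF rhom_mconst])
  ultimately show ?thesis using c by (auto simp: reduces_to_def simp del: of_nat_Suc intro!: mpolys_mult)
qed

text \<open>A remainder with zero derivative has no terms in \<open>x_0^k\<close> for
  \<open>0 < k < p\<close>, since such \<open>k\<close> are invertible.\<close>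

lemma \<sigma>_constant:
  assumes "f \<in> mpolys {..<r}" "\<sigma> (pdiff 0 f) = 0"
  shows "\<exists>c. \<sigma> f = fr c"
proof -
  obtain c where c: "reduces_to f c" using ex_reduces_to[OF assms(1)] by blast
  have c0: "c k = 0" if k: "k \<in> {1..<p}" for k
  proof -
    obtain l where l: "k = Suc l" using k by (cases k) auto
    have "(\<Sum>j<p. fr (if Suc j < p then of_nat (Suc j) * c (Suc j) else 0) * \<beta> ^ j) = 0"
      using \<sigma>_reduces_to[OF reduces_to_pdiff_0[OF c]] assms(2) by simp
    from \<beta>_powers_indep_fr[OF this, of l] have "of_nat (Suc l) * c (Suc l) = 0"
      using k l by (simp del: of_nat_Suc)
    then show ?thesis using of_nat_neq_0[of k] k l by (simp del: of_nat_Suc)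
  qed
  have "\<sigma> f = (\<Sum>k<p. fr (c k) * \<beta> ^ k)" by (rule \<sigma>_reduces_to[OF c])
  also have "\<dots> = (\<Sum>k\<in>{0}. fr (c k) * \<beta> ^ k)"
    using c0 p_pos by (intro sum.mono_neutral_right) (auto simp: fr_simps)
  finally show ?thesis by auto
qed

lemma keys_lam: "m \<in> Poly_Mapping.keys lam \<Longrightarrow> mdeg m = 1"
proof -
  have "mconst (u i) * mvar i \<in> homogeneous r 1" if "i < r" for i
  proof -
    have "mconst (u i) \<in> homogeneous r 0"
      by (auto simp: homogeneous_def' polys_eq_mpolys) (auto simp: mconst_def mdeg_def split: if_splits)
    from homogeneous_mult[OF this homogeneous_mvar[OF that]] show ?thesis by simp
  qed
  then have "(\<Sum>i\<in>I. mconst (u i) * mvar i) \<in> homogeneous r 1" if "I \<subseteq> {..<r}" for I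
    using that
    by (induction I rule: infinite_finite_induct) (auto simp: homogeneous_0 intro!: homogeneous_add)
  then have "lam \<in> homogeneous r 1" by (simp add: lam_def)
  then show "m \<in> Poly_Mapping.keys lam \<Longrightarrow> mdeg m = 1" by (simp add: homogeneous_def')
qed

lemma hcomp_fr: "hcomp d (fr P) = fr (hcomp d P)"
  by (rule poly_mapping_eqI) (auto simp: lookup_hcomp lookup_fr when_def zero_power[OF p_pos])

lemma hcomp_mconst_mult: "hcomp d (mconst a * P) = mconst a * hcomp d P"
  by (rule poly_mapping_eqI) (auto simp: lookup_hcomp lookup_mconst_mult when_def)

text \<open>A relation is a multiple of \<open>lam\<close>, and \<open>lam\<close> is homogeneous,
  so components are again multiples of \<open>lam\<close>. \<open>Suc d\<close> is the degree of the
  cofactor plus that of \<open>lam\<close>.\<close>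

lemma hcomp_relation:
  fixes J :: "nat set"
  assumes "(\<Sum>j\<in>J. mconst (w j) * \<sigma> (f j)) = 0"
  shows "(\<Sum>j\<in>J. mconst (w j) * \<sigma> (hcomp (Suc d) (f j))) = 0"
proof -
  have "\<tau> (tw J w f) = 0" using assms by (simp add: \<tau>_tw)
  then obtain Q where "tw J w f = lam * Q" by (auto simp: \<tau>_eq_0_iff dvd_def)
  then have "hcomp (d + 1) (tw J w f) = lam * hcomp d Q"
    using hcomp_mult[of lam 1 d Q] keys_lam by simp
  moreover have "hcomp (d + 1) (tw J w f) = tw J w (\<lambda>j. hcomp (d + 1) (f j))"
    by (simp add: tw_def hcomp_sum hcomp_mconst_mult hcomp_fr)
  ultimately have "tw J w (\<lambda>j. hcomp (d + 1) (f j)) = lam * hcomp d Q" by simp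
  then have "\<tau> (tw J w (\<lambda>j. hcomp (d + 1) (f j))) = 0" by (simp add: \<tau>_simps \<tau>_lam)
  then show ?thesis by (simp add: \<tau>_tw)
qed

lemma \<sigma>_psubst_cong:
  assumes "P \<in> mpolys {..<r}" "\<And>j. j < r \<Longrightarrow> \<sigma> (k j) = \<sigma> (k' j)"
  shows "\<sigma> (psubst k P) = \<sigma> (psubst k' P)"
  by (rule mpolys_hom_eqI[OF assms(1) rhom_comp[OF rhom_\<sigma> rhom_psubst] rhom_comp[OF rhom_\<sigma> rhom_psubst]])
     (use assms(2) in auto)

lemma \<sigma>_mvar_relation: "(\<Sum>i<r. mconst (u i) * \<sigma> (mvar i)) = 0"
  using \<tau>_lam by (simp add: lam_def \<tau>_simps \<sigma>_def)

definition ideal :: "'a mpoly set" where "ideal = {\<Phi> * Q |Q. Q \<in> polys r}"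

lemma ideal_iff: "P \<in> ideal \<longleftrightarrow> P \<in> mpolys {..<r} \<and> \<sigma> P = 0"
proof
  assume "P \<in> ideal"
  then obtain Q where "Q \<in> mpolys {..<r}" "P = \<Phi> * Q" by (auto simp: ideal_def polys_eq_mpolys)
  then show "P \<in> mpolys {..<r} \<and> \<sigma> P = 0" by (simp add: mpolys_mult \<Phi>_mpolys \<sigma>_simps \<sigma>_\<Phi>)
next
  assume P: "P \<in> mpolys {..<r} \<and> \<sigma> P = 0"
  then obtain Q where Q: "P = \<Phi> * Q" using \<sigma>_eq_0_iff by (auto simp: dvd_def)
  \<comment> \<open>The cofactor might contain foreign variables; setting them to 0 changes neither
    \<open>P\<close> nor \<open>\<Phi>\<close>.\<close>
  let ?\<pi> = "psubst (\<lambda>i. if i < r then mvar i else 0)"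
  have \<pi>: "?\<pi> X = X" if "X \<in> mpolys {..<r}" for X
    using psubst_cong[OF that, of "\<lambda>i. if i < r then mvar i else 0" mvar] by (simp add: psubst_id)
  have "P = \<Phi> * ?\<pi> Q"
    using \<pi>[of P] \<pi>[OF \<Phi>_mpolys] P Q by (metis rhom.mult[OF rhom_psubst])
  moreover have "?\<pi> Q \<in> mpolys {..<r}"
    by (rule mpolys_psubst[of Q UNIV]) auto
  ultimately show "P \<in> ideal" by (auto simp: ideal_def polys_eq_mpolys)
qed

end

context value_field
begin

lemma \<kappa>_pos: "0 < \<kappa>"
proof (rule ccontr)
  assume "\<not> 0 < \<kappa>"
  then have "N = 0" using N_eq by (metis mult_0_right neq0_conv)
  moreover obtain c where "1 = (\<Sum>l<N. c l ^ p * e l)" using e_span[OF L.one] by blast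
  ultimately show False by simp
qed

text \<open>\<open>lam\<close> is \<open>x_0 - \<beta>\<close> with \<open>\<beta>\<close> over
  \<open>L\<close>, so the cofactor can be kept over \<open>L\<close>, where it has coordinates with
  respect to \<open>e\<close>. The polynomials with this property form a subring containing the
  constants from \<open>L\<close> and the variables.\<close>

lemma lam_quotient_cf:
  assumes "P \<in> cf L"
  shows "\<exists>Q\<in>cf L. P - \<tau> P = lam * Q"
proof -
  interpret c: subring "cf L" using subring_cf[OF L.subring_axioms, of UNIV] by simp
  define S where "S = {P \<in> cf L. \<exists>Q\<in>cf L. P - \<tau> P = lam * Q}"
  interpret S: subring S
  proof
    show "1 \<in> S" by (auto simp: S_def c.one \<tau>_simps intro: bexI[of _ 0] c.zero)
    fix x y assume "x \<in> S" "y \<in> S"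
    then obtain Q R where Q: "Q \<in> cf L" "x - \<tau> x = lam * Q" "x \<in> cf L"
      and R: "R \<in> cf L" "y - \<tau> y = lam * R" "y \<in> cf L" by (auto simp: S_def)
    have "(x - y) - \<tau> (x - y) = lam * (Q - R)" using Q R by (simp add: \<tau>_simps algebra_simps)
    then show "x - y \<in> S" using Q R by (auto simp: S_def intro!: c.diff bexI[of _ "Q - R"])
    have "x * y - \<tau> (x * y) = (x - \<tau> x) * y + \<tau> x * (y - \<tau> y)" by (simp add: \<tau>_simps algebra_simps)
    also have "\<dots> = lam * (Q * y + \<tau> x * R)" unfolding Q R by (simp add: algebra_simps)
    finally show "x * y \<in> S"
      using Q R by (auto simp: S_def intro!: c.mult c.add \<tau>_cf bexI[of _ "Q * y + \<tau> x * R"])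
  qed
  have "mconst a \<in> S" if "a \<in> L" for a
    using that by (auto simp: S_def cf_mconst_iff L.zero c.zero intro: bexI[of _ 0])
  moreover have "mvar i \<in> S" for i
    using mvar_cf[of i] c.one c.zero
    by (auto simp: S_def \<tau>_mvar lam_eq intro: bexI[of _ 1] bexI[of _ 0])
  ultimately have "Poly_Mapping.single m (Poly_Mapping.lookup P m) \<in> S" for m
    unfolding single_eq_prod using assms by (intro S.mult S.prod S.power) (auto simp: cf_def)
  then have "(\<Sum>m\<in>Poly_Mapping.keys P. Poly_Mapping.single m (Poly_Mapping.lookup P m)) \<in> S"
    by (intro S.sum)
  then have "P \<in> S" by (simp flip: mpoly_sum_single)
  then show ?thesis by (simp add: S_def)
qed

end

locale value_field_pair =
  V: value_field p F r u L e N + W: value_field p F r w L e N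
  for p and F :: "'a::field itself" and r u w L e N
begin

text \<open>The \<open>f\<^sub>j\<close> with \<open>j < \<kappa>\<close> are determined on the hypersurface by \<open>D\<close>, because any \<open>\<kappa>\<close> of the values
  stay independent.\<close>

definition level_map :: "(nat \<Rightarrow> 'a mpoly) \<Rightarrow> 'a mpoly \<Rightarrow> nat \<Rightarrow> bool" where
  "level_map f D d \<longleftrightarrow> D \<in> homogeneous r d \<and> (\<forall>j<r. f j \<in> homogeneous r (Suc d)) \<and>
     (\<forall>j\<in>{V.\<kappa>..<r}. f j = D * mvar j) \<and> (\<Sum>j<r. mconst (w j) * V.\<sigma> (f j)) = 0"

lemma level_map_homogenize:
  assumes "D \<in> mpolys {..<r}" "\<And>j. j < r \<Longrightarrow> f j \<in> mpolys {..<r}"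
    and "\<And>j. j \<in> {V.\<kappa>..<r} \<Longrightarrow> f j = D * mvar j"
    and "(\<Sum>j<r. mconst (w j) * V.\<sigma> (f j)) = 0"
  shows "level_map (\<lambda>j. hcomp (Suc d) (f j)) (hcomp d D) d"
  unfolding level_map_def
proof (intro conjI allI ballI impI)
  show "hcomp d D \<in> homogeneous r d" "\<And>j. j < r \<Longrightarrow> hcomp (Suc d) (f j) \<in> homogeneous r (Suc d)"
    using assms by (auto intro!: hcomp_homogeneous simp: polys_eq_mpolys)
  show "(\<Sum>j<r. mconst (w j) * V.\<sigma> (hcomp (Suc d) (f j))) = 0"
    by (rule V.hcomp_relation[OF assms(4)])
  fix j assume j: "j \<in> {V.\<kappa>..<r}"
  have "\<forall>m\<in>Poly_Mapping.keys (mvar j :: 'a mpoly). mdeg m = 1"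
    using homogeneous_mvar[of j r] j by (auto simp: homogeneous_def')
  from hcomp_mult[OF this, of d D] show "hcomp (Suc d) (f j) = hcomp d D * mvar j"
    using assms(3)[OF j] by (simp add: mult.commute)
qed

lemma level_map_mpolys: "level_map f D d \<Longrightarrow> j < r \<Longrightarrow> f j \<in> mpolys {..<r}"
  by (auto simp: level_map_def dest: homogeneousD)

text \<open>The first \<open>\<kappa>\<close> values of \<open>w\<close> span, so the prescribed
  last coordinates can be completed to a point of the second hypersurface with common denominator
  \<open>D\<close>.\<close>

lemma ex_level_map: "\<exists>f D d. level_map f D d \<and> V.\<sigma> D \<noteq> 0"
proof -
  let ?J = "{V.\<kappa>..<r}"
  have split: "{..<r} = {..<V.\<kappa>} \<union> ?J" using V.\<kappa>_less by auto
  define t where "t = (\<Sum>j\<in>?J. mconst (w j) * V.\<sigma> (mvar j))"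
  have "t \<in> V.MM" unfolding t_def using W.u_L by (intro V.tw_sum_MM) auto
  moreover have "pindep p {..<V.\<kappa>} w"
    using V.\<kappa>_less V.p_pos by (intro pindep_subset[OF W.aniso]) auto
  then have "V.MM \<subseteq> V.K.rspan {..<V.\<kappa>} (\<lambda>j. mconst (w j))"
    using V.\<kappa>_less W.u_L by (intro V.separation_spans) auto
  ultimately obtain d c where dc: "d \<in> V.KK" "d \<noteq> 0" "\<forall>j\<in>{..<V.\<kappa>}. c j \<in> V.KK"
      "d * t = (\<Sum>j<V.\<kappa>. c j * mconst (w j))" using V.K.rspanE by blast
  obtain D where D: "D \<in> mpolys {..<r}" "d = V.\<sigma> D" using dc by (auto simp: V.KK_def)
  have "\<forall>j\<in>{..<V.\<kappa>}. \<exists>f. f \<in> mpolys {..<r} \<and> c j = V.\<sigma> f" using dc by (auto simp: V.KK_def)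
  from bchoice[OF this] obtain C where C: "\<forall>j\<in>{..<V.\<kappa>}. C j \<in> mpolys {..<r} \<and> c j = V.\<sigma> (C j)" ..
  define f where "f = (\<lambda>j. if j < V.\<kappa> then - C j else D * mvar j)"
  obtain k where k: "V.\<sigma> (hcomp k D) \<noteq> 0"
    using hom_sum_hcomp[OF V.rhom_\<sigma>, of D] D dc by auto
  have "level_map (\<lambda>j. hcomp (Suc k) (f j)) (hcomp k D) k"
  proof (rule level_map_homogenize[OF D(1)])
    show "f j \<in> mpolys {..<r}" if "j < r" for j
      using C D that by (auto simp: f_def intro!: mpolys_mult mpolys_uminus)
    have "(\<Sum>j<r. mconst (w j) * V.\<sigma> (f j)) =
        (\<Sum>j<V.\<kappa>. mconst (w j) * V.\<sigma> (f j)) + (\<Sum>j\<in>?J. mconst (w j) * V.\<sigma> (f j))"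
      unfolding split by (intro sum.union_disjoint) auto
    also have "(\<Sum>j<V.\<kappa>. mconst (w j) * V.\<sigma> (f j)) = - (\<Sum>j<V.\<kappa>. c j * mconst (w j))"
      unfolding sum_negf[symmetric] using C by (intro sum.cong) (auto simp: f_def V.\<sigma>_simps mult.commute)
    also have "(\<Sum>j\<in>?J. mconst (w j) * V.\<sigma> (f j)) = d * t"
      unfolding t_def sum_distrib_left
      by (intro sum.cong) (auto simp: f_def V.\<sigma>_simps D mult_ac)
    finally show "(\<Sum>j<r. mconst (w j) * V.\<sigma> (f j)) = 0" using dc(4) by simp
  qed (simp add: f_def)
  with k show ?thesis by blast
qed

lemma level_map_kills_ideal:
  assumes "(\<Sum>j<r. mconst (w j) * V.\<sigma> (f j)) = 0" "W.\<Phi> dvd P"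
  shows "V.\<sigma> (psubst f P) = 0"
proof -
  have "V.\<sigma> (psubst f W.\<Phi>) = (\<Sum>j<r. (mconst (w j) * V.\<sigma> (f j)) ^ p)"
    by (simp add: W.\<Phi>_def rhom.sum[OF rhom_psubst] rhom.mult[OF rhom_psubst] rhom.power[OF rhom_psubst]
        V.\<sigma>_simps power_mult_distrib rhom.power[OF rhom_mconst])
  also have "\<dots> = (\<Sum>j<r. mconst (w j) * V.\<sigma> (f j)) ^ p"
    by (simp add: rhom.sum[OF V.rhom_pow_mpoly])
  finally have "V.\<sigma> (psubst f W.\<Phi>) = 0" using assms V.p_pos by simp
  with assms(2) show ?thesis by (auto simp: dvd_def rhom.mult[OF rhom_psubst] V.\<sigma>_simps)
qed

text \<open>The composite and \<open>\<mu>\<close> times the generic point satisfy the same linear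
  relation and agree from \<open>\<kappa>\<close> on. Their difference is a relation among the first
  \<open>\<kappa>\<close> values \<open>u i\<close>, which are independent over
  \<open>KK\<close>.\<close>

lemma level_map_composite:
  assumes f: "level_map f D d" and g: "\<And>i. i < r \<Longrightarrow> g i \<in> mpolys {..<r}" "D' \<in> mpolys {..<r}"
    "\<And>i. i \<in> {V.\<kappa>..<r} \<Longrightarrow> g i = D' * mvar i" "(\<Sum>i<r. mconst (u i) * W.\<sigma> (g i)) = 0"
    and i: "i < r"
  shows "V.\<sigma> (psubst f (g i)) = V.\<sigma> (psubst f D' * D * mvar i)"
proof -
  define \<mu> where "\<mu> = psubst f D' * D"
  have "W.\<tau> (W.tw {..<r} u g) = 0" using g by (simp add: W.\<tau>_tw)
  then obtain H where H: "W.tw {..<r} u g = W.lam * H" by (auto simp: W.\<tau>_eq_0_iff dvd_def)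
  \<comment> \<open>The relation for \<open>g\<close> is transported through its lift: this
    substitution sends \<open>W.lam\<close> to a multiple of \<open>V.lam\<close>, since
    \<open>f\<close> satisfies the equation of its target.\<close>
  let ?s = "psubst (\<lambda>i. V.fr (f i))"
  have "?s (W.tw {..<r} u g) = V.tw {..<r} u (\<lambda>i. psubst f (g i))"
    by (simp add: V.tw_def W.tw_def rhom.sum[OF rhom_psubst] rhom.mult[OF rhom_psubst] V.fr_psubst)
  moreover have "V.\<tau> (?s W.lam) = 0"
    using f by (simp add: W.lam_def rhom.sum[OF rhom_psubst] rhom.mult[OF rhom_psubst] V.\<tau>_simps
        level_map_def flip: V.\<sigma>_def)
  ultimately have "V.\<tau> (V.tw {..<r} u (\<lambda>i. psubst f (g i))) = 0"
    unfolding H by (metis rhom.mult[OF rhom_psubst] V.\<tau>_simps(5) mult_zero_left)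
  then have rel: "(\<Sum>i<r. mconst (u i) * V.\<sigma> (psubst f (g i))) = 0" by (simp add: V.\<tau>_tw)
  have "(\<Sum>i<r. mconst (u i) * V.\<sigma> (\<mu> * mvar i)) = V.\<sigma> \<mu> * (\<Sum>i<r. mconst (u i) * V.\<sigma> (mvar i))"
    by (simp add: V.\<sigma>_simps sum_distrib_left mult_ac)
  then have rel': "(\<Sum>i<r. mconst (u i) * V.\<sigma> (\<mu> * mvar i)) = 0" by (simp add: V.\<sigma>_mvar_relation)
  define c where "c = (\<lambda>i. V.\<sigma> (psubst f (g i)) - V.\<sigma> (\<mu> * mvar i))"
  have c0: "c i = 0" if "i \<in> {V.\<kappa>..<r}" for i
    using g(3)[OF that] f that by (simp add: c_def \<mu>_def level_map_def rhom.mult[OF rhom_psubst] mult_ac)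
  have "(\<Sum>i<r. c i * mconst (u i)) = 0"
    using rel rel' by (simp add: c_def right_diff_distrib sum_subtractf mult.commute[of _ "mconst _"])
  moreover have "(\<Sum>i<r. c i * mconst (u i)) = (\<Sum>i<V.\<kappa>. c i * mconst (u i))"
    using c0 V.\<kappa>_less by (intro sum.mono_neutral_right) auto
  ultimately have rel'': "(\<Sum>i<V.\<kappa>. c i * mconst (u i)) = 0" by simp
  have fP: "psubst f P \<in> mpolys {..<r}" if "P \<in> mpolys {..<r}" for P
    using that level_map_mpolys[OF f] by (rule mpolys_psubst) auto
  have D: "D \<in> mpolys {..<r}" using f by (auto simp: level_map_def dest: homogeneousD)
  have "c i \<in> V.KK" if "i < V.\<kappa>" for i
    unfolding c_def \<mu>_def using that V.\<kappa>_less g D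
    by (intro V.K.diff V.\<sigma>_KK mpolys_mult fP) auto
  moreover have "V.K.indep {..<V.\<kappa>} (\<lambda>i. mconst (u i))"
    using V.\<kappa>_less V.p_pos V.u_L by (intro V.separation pindep_subset[OF V.aniso]) auto
  ultimately have "c i = 0" if "i < V.\<kappa>" for i
    using V.K.indepD[of "{..<V.\<kappa>}" "\<lambda>i. mconst (u i)" c i] rel'' that by auto
  with c0 i have "c i = 0" by (cases "i < V.\<kappa>") auto
  then show ?thesis by (simp add: c_def \<mu>_def)
qed

text \<open>
  The point of \<open>X\<^sub>w\<close> obtained from a level map generates the nilradical of \<open>L \<otimes> KK\<close>: otherwise, after
  clearing denominators by a \<open>p\<close>-th power, its coordinates are constants for \<open>\<partial>/\<partial>x\<^sub>0\<close>, hence lie in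
  the field of fractions of \<open>AA\<close>, over which \<open>w\<close> stays anisotropic.
\<close>

lemma level_map_multiplicity:
  assumes f: "level_map f D d" and D: "V.\<sigma> D \<noteq> 0" and H: "V.tw {..<r} w f = V.lam * H"
  shows "V.\<tau> H \<noteq> 0"
proof
  assume H0: "V.\<tau> H = 0"
  define G where "G = (\<lambda>i. D ^ (p - 1) * f i)"
  have DP: "D \<in> mpolys {..<r}" using f by (auto simp: level_map_def dest: homogeneousD)
  have G: "G i \<in> mpolys {..<r}" if "i < r" for i
    unfolding G_def using level_map_mpolys[OF f that] DP by (intro mpolys_mult mpolys_power)
  have twG: "V.tw {..<r} w G = V.fr (D ^ (p - 1)) * V.lam * H"
  proof -
    have "V.tw {..<r} w G = V.fr (D ^ (p - 1)) * V.tw {..<r} w f"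
      unfolding V.tw_def sum_distrib_left G_def V.fr_simps(5) by (intro sum.cong) (simp_all add: mult_ac)
    then show ?thesis by (simp add: H mult.assoc)
  qed
  have Dp: "D ^ (p - 1) * D = D ^ p" using power_minus_mult[OF V.p_pos, of D] .
  have G1: "G i = D ^ p * mvar i" if "i \<in> {V.\<kappa>..<r}" for i
    using f that by (simp add: G_def level_map_def flip: Dp mult.assoc)
  have of_nat_p: "(of_nat p :: 'a mpoly) = 0"
    using of_nat_CHAR[where 'a = "'a mpoly"] V.char_mpoly by simp
  \<comment> \<open>\<open>D ^ p\<close> has zero derivative, and \<open>0 < \<kappa>\<close> keeps
    \<open>x_0\<close> out of the coordinates that are copied.\<close>
  have dG1: "pdiff 0 (G i) = 0" if "i \<in> {V.\<kappa>..<r}" for i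
    using that V.\<kappa>_pos by (simp add: G1 pdiff_mult pdiff_power of_nat_p pdiff_mvar)
  \<comment> \<open>If \<open>H\<close> vanished on the hyperplane, the relation would vanish there
    to order two, so its derivative would again be a relation.\<close>
  have "V.\<tau> (V.tw {..<r} w (\<lambda>i. pdiff 0 (G i))) = V.\<tau> (pdiff 0 (V.tw {..<r} w G))"
    by (simp add: V.pdiff_tw)
  also have "\<dots> = 0"
    unfolding twG by (simp add: pdiff_mult V.\<tau>_simps V.\<tau>_lam H0)
  finally have rel: "(\<Sum>i<r. mconst (w i) * V.\<sigma> (pdiff 0 (G i))) = 0" by (simp add: V.\<tau>_tw)
  have "(\<Sum>i<V.\<kappa>. V.\<sigma> (pdiff 0 (G i)) * mconst (w i)) = (\<Sum>i<r. mconst (w i) * V.\<sigma> (pdiff 0 (G i)))"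
    using V.\<kappa>_less dG1 by (intro sum.mono_neutral_cong_left) (auto simp: V.\<sigma>_simps)
  with rel have rel': "(\<Sum>i<V.\<kappa>. V.\<sigma> (pdiff 0 (G i)) * mconst (w i)) = 0" by simp
  have ind: "V.K.indep {..<V.\<kappa>} (\<lambda>i. mconst (w i))"
    using V.\<kappa>_less V.p_pos W.u_L by (intro V.separation pindep_subset[OF W.aniso]) auto
  have "V.\<sigma> (pdiff 0 (G i)) = 0" if "i < r" for i
  proof (cases "i < V.\<kappa>")
    case True
    have "V.\<sigma> (pdiff 0 (G j)) \<in> V.KK" if "j < V.\<kappa>" for j
      using that V.\<kappa>_less by (intro V.\<sigma>_KK mpolys_pdiff G) simp
    with V.K.indepD[OF ind _ rel', of i] True show ?thesis by simp
  next
    case False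
    with that show ?thesis by (simp add: dG1 V.\<sigma>_simps)
  qed
  then have "\<forall>i\<in>{..<r}. \<exists>a. V.\<sigma> (G i) = V.fr a" using G V.\<sigma>_constant by blast
  from bchoice[OF this] obtain a where a: "\<forall>i\<in>{..<r}. V.\<sigma> (G i) = V.fr (a i)" ..
  have "V.\<tau> (V.tw {..<r} w G) = 0" by (simp add: twG V.\<tau>_simps V.\<tau>_lam)
  then have "(\<Sum>i<r. mconst (w i) * V.fr (a i)) = 0" using a by (simp add: V.\<tau>_tw)
  from V.pindep_fr[OF W.aniso this] have "V.\<sigma> (G V.\<kappa>) = 0"
    using a V.\<kappa>_less by (simp add: V.fr_simps)
  then have "V.\<sigma> D ^ p * mvar V.\<kappa> = 0"
    using V.\<kappa>_less V.\<kappa>_pos by (simp add: G1 V.\<sigma>_simps V.\<sigma>_mvar)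
  with D mvar_neq_0 show False by (metis mult_eq_0_iff power_eq_0_iff)
qed

text \<open>
  A level map in the direction opposite to \<open>f\<close> whose denominator does not vanish on the image of
  \<open>f\<close>: solve the linear system defining level maps over the polynomial ring. It is solvable after
  specialisation along \<open>f\<close>, since \<open>\<Sum> w\<^sub>i f\<^sub>i\<close> generates the nilradical.
\<close>

lemma ex_opposite_level_map:
  assumes f: "level_map f D d" and D: "V.\<sigma> D \<noteq> 0"
  shows "\<exists>g D' d'. value_field_pair.level_map p r w u N g D' d' \<and> V.\<sigma> (psubst f D') \<noteq> 0"
proof -
  interpret S: value_field_pair p F r w u L e N ..
  let ?h = "\<lambda>P. V.\<sigma> (psubst f P)"
  have h: "rhom ?h" by (rule rhom_comp[OF V.rhom_\<sigma> rhom_psubst])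
  interpret h: rhom ?h by (rule h)
  interpret P: subring "mpolys {..<r} :: 'a mpoly set"
    by unfold_locales (auto intro: mpolys_diff mpolys_mult)
  have "V.\<tau> (V.tw {..<r} w f) = 0" using f by (simp add: V.\<tau>_tw level_map_def)
  moreover have "V.tw {..<r} w f \<in> cf L"
  proof -
    interpret c: subring "cf L" using subring_cf[OF V.L.subring_axioms, of UNIV] by simp
    show ?thesis unfolding V.tw_def
      by (intro c.sum c.mult V.L.fr_cf) (auto simp: cf_mconst_iff V.L.zero W.u_L)
  qed
  ultimately obtain H where H: "V.tw {..<r} w f = V.lam * H" "H \<in> cf L"
    using V.lam_quotient_cf by fastforce
  have H0: "V.\<tau> H \<noteq> 0" by (rule level_map_multiplicity[OF f D H(1)])
  have "\<forall>i\<in>{..<r}. \<exists>c. u i = (\<Sum>l<N. c l ^ p * e l)" using V.e_span V.u_L by blast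
  from bchoice[OF this] obtain \<omega> where \<omega>: "\<forall>i\<in>{..<r}. u i = (\<Sum>l<N. \<omega> i l ^ p * e l)" ..
  have "\<forall>x\<in>{..<r} \<times> {..<N}. \<exists>c. w (fst x) * e (snd x) = (\<Sum>l<N. c l ^ p * e l)"
    using W.u_L V.e_L by (auto intro!: V.e_span V.L.mult)
  from bchoice[OF this] obtain \<gamma>
    where \<gamma>: "\<forall>x\<in>{..<r} \<times> {..<N}. w (fst x) * e (snd x) = (\<Sum>l<N. \<gamma> x l ^ p * e l)" ..
  \<comment> \<open>Coordinates over \<open>e\<close>, before the twist by \<open>fr\<close>:
    \<open>Inl i\<close> stands for \<open>u i\<close>, and \<open>Inr m\<close> for
    \<open>W.lam * e m\<close>. The second family spans the multiples of \<open>W.lam\<close>, so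
    the system encodes an equation modulo \<open>W.lam\<close>. The right-hand side
    \<open>tar\<close> stands for the sum of \<open>u j * x_j\<close> over
    \<open>j \<ge> \<kappa>\<close>.\<close>
  define vec :: "nat + nat \<Rightarrow> nat \<Rightarrow> 'a mpoly" where
    "vec = (\<lambda>k l. case k of Inl i \<Rightarrow> mconst (\<omega> i l) | Inr m \<Rightarrow> \<Sum>i<r. mconst (\<gamma> (i, m) l) * mvar i)"
  define tar where "tar = (\<lambda>l. \<Sum>j\<in>{V.\<kappa>..<r}. mconst (\<omega> j l) * mvar j)"
  let ?I = "{..<V.\<kappa>} <+> {..<N}"
  have vec_Inl: "(\<Sum>l<N. mconst (e l) * V.fr (vec (Inl i) l)) = mconst (u i)" if "i < r" for i
    using \<omega> that by (simp add: vec_def rhom.sum[OF rhom_mconst] rhom.mult[OF rhom_mconst] mult.commute)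
  have vec_Inr: "(\<Sum>l<N. mconst (e l) * V.fr (vec (Inr m) l)) = W.lam * mconst (e m)" if "m < N" for m
  proof -
    have "(\<Sum>l<N. mconst (e l) * V.fr (vec (Inr m) l)) =
        (\<Sum>l<N. \<Sum>i<r. mconst (\<gamma> (i, m) l ^ p * e l) * mvar i)"
      by (simp add: vec_def V.fr_simps sum_distrib_left rhom.mult[OF rhom_mconst] mult_ac)
    also have "\<dots> = (\<Sum>i<r. mconst (w i * e m) * mvar i)"
      using bspec[OF \<gamma>, of "(_, m)"] that
      by (subst sum.swap) (simp add: rhom.sum[OF rhom_mconst] flip: sum_distrib_right)
    also have "\<dots> = W.lam * mconst (e m)"
      unfolding W.lam_def sum_distrib_right
      by (intro sum.cong) (simp_all add: rhom.mult[OF rhom_mconst] mult_ac)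
    finally show ?thesis .
  qed
  have spec: "\<exists>c d. d \<noteq> 0 \<and> (\<forall>l\<in>{..<N}. (\<Sum>k\<in>?I. c k * ?h (vec k l)) = (if l = l0 then d else 0))"
    if l0: "l0 \<in> {..<N}" for l0
  proof -
    have "V.MM \<subseteq> V.K.rspan {..<V.\<kappa>} (\<lambda>j. mconst (u j))"
      using V.\<kappa>_less V.p_pos V.u_L by (intro V.separation_spans pindep_subset[OF V.aniso]) auto
    moreover have "mconst (e l0) \<in> V.MM" using l0 V.e_L V.mconst_MM by auto
    ultimately obtain d0 c0 where dc: "d0 \<in> V.KK" "d0 \<noteq> 0" "\<forall>j\<in>{..<V.\<kappa>}. c0 j \<in> V.KK"
        "d0 * mconst (e l0) = (\<Sum>j<V.\<kappa>. c0 j * mconst (u j))" using V.K.rspanE by blast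
    obtain D0 where D0: "d0 = V.\<sigma> D0" using dc by (auto simp: V.KK_def)
    have "\<forall>j\<in>{..<V.\<kappa>}. \<exists>f. c0 j = V.\<sigma> f" using dc by (auto simp: V.KK_def)
    from bchoice[OF this] obtain C where C: "\<forall>j\<in>{..<V.\<kappa>}. c0 j = V.\<sigma> (C j)" ..
    define B where "B = V.fr D0 * mconst (e l0) - (\<Sum>j<V.\<kappa>. V.fr (C j) * mconst (u j))"
    have "V.\<tau> B = 0" using dc C by (simp add: B_def V.\<tau>_simps D0 flip: V.\<sigma>_def)
    moreover have "B \<in> cf L"
    proof -
      interpret c: subring "cf L" using subring_cf[OF V.L.subring_axioms, of UNIV] by simp
      show ?thesis unfolding B_def using V.\<kappa>_less l0
        by (intro c.diff c.sum c.mult V.L.fr_cf) (auto simp: cf_mconst_iff V.L.zero V.u_L V.e_L)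
    qed
    ultimately obtain Y where Y: "B = V.lam * Y" "Y \<in> cf L" using V.lam_quotient_cf by fastforce
    \<comment> \<open>\<open>H\<close> times \<open>V.lam\<close> is the specialisation of
      \<open>W.lam\<close>. Multiplying \<open>B = V.lam * Y\<close> by \<open>H ^ p\<close> makes
      it a multiple of this specialisation, with cofactor \<open>H ^ (p - 1) * Y\<close> over
      \<open>L\<close>; and \<open>H ^ p\<close> is a twist, hence a legitimate scalar.\<close>
    define \<eta> where "\<eta> = psubst (\<lambda>i. mvar i ^ p) H"
    have \<eta>: "V.fr \<eta> = H ^ p" using V.power_p_eq_fr[of H] by (simp only: \<eta>_def)
    have "H ^ (p - 1) * Y \<in> cf L"
    proof -
      interpret c: subring "cf L" using subring_cf[OF V.L.subring_axioms, of UNIV] by simp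
      show ?thesis using H Y by (intro c.mult c.power)
    qed
    then obtain z where z: "H ^ (p - 1) * Y = (\<Sum>m<N. mconst (e m) * V.fr (z m))"
      using V.coordinates[of _ UNIV] by auto
    \<comment> \<open>Residual of the system at column \<open>l\<close>. Its weighted sum is
      \<open>H ^ p\<close> times the definition of \<open>B\<close> minus \<open>B\<close>, so it
      vanishes by independence of \<open>e\<close>.\<close>
    define X where "X = (\<lambda>l. (if l = l0 then D0 * \<eta> else 0) -
        ((\<Sum>j<V.\<kappa>. C j * \<eta> * psubst f (vec (Inl j) l)) + (\<Sum>m<N. z m * psubst f (vec (Inr m) l))))"
    have s1: "(\<Sum>l<N. mconst (e l) * V.fr (if l = l0 then D0 * \<eta> else 0)) = V.fr D0 * H ^ p * mconst (e l0)"
    proof -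
      have "(\<Sum>l<N. mconst (e l) * V.fr (if l = l0 then D0 * \<eta> else 0)) =
          (\<Sum>l<N. if l = l0 then mconst (e l0) * V.fr (D0 * \<eta>) else 0)"
        by (intro sum.cong) (auto simp: V.fr_simps)
      then show ?thesis using l0 by (simp add: V.fr_simps \<eta> mult_ac)
    qed
    have s2: "(\<Sum>l<N. mconst (e l) * V.fr (\<Sum>j<V.\<kappa>. C j * \<eta> * psubst f (vec (Inl j) l))) =
        H ^ p * (\<Sum>j<V.\<kappa>. V.fr (C j) * mconst (u j))"
    proof -
      have "(\<Sum>l<N. mconst (e l) * V.fr (\<Sum>j<V.\<kappa>. C j * \<eta> * psubst f (vec (Inl j) l))) =
          (\<Sum>l<N. \<Sum>j<V.\<kappa>. V.fr (C j) * H ^ p * (mconst (e l) * V.fr (vec (Inl j) l)))"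
        by (simp add: V.fr_simps \<eta> sum_distrib_left mult_ac vec_def)
      also have "\<dots> = (\<Sum>j<V.\<kappa>. V.fr (C j) * H ^ p * (\<Sum>l<N. mconst (e l) * V.fr (vec (Inl j) l)))"
        by (subst sum.swap) (simp add: sum_distrib_left)
      also have "\<dots> = (\<Sum>j<V.\<kappa>. V.fr (C j) * H ^ p * mconst (u j))"
        using V.\<kappa>_less vec_Inl by (intro sum.cong) auto
      finally show ?thesis by (simp add: sum_distrib_left mult_ac)
    qed
    have "psubst (\<lambda>i. V.fr (f i)) W.lam = V.lam * H"
      by (simp add: H(1)[symmetric] W.lam_def V.tw_def rhom.sum[OF rhom_psubst] rhom.mult[OF rhom_psubst])
    then have fInr: "(\<Sum>l<N. mconst (e l) * V.fr (psubst f (vec (Inr m) l))) = V.lam * H * mconst (e m)"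
      if "m < N" for m
      using arg_cong[OF vec_Inr[OF that], of "psubst (\<lambda>i. V.fr (f i))"]
      by (simp add: rhom.sum[OF rhom_psubst] rhom.mult[OF rhom_psubst] V.fr_psubst)
    have s3: "(\<Sum>l<N. mconst (e l) * V.fr (\<Sum>m<N. z m * psubst f (vec (Inr m) l))) =
        H * H ^ (p - 1) * B"
    proof -
      have "(\<Sum>l<N. mconst (e l) * V.fr (\<Sum>m<N. z m * psubst f (vec (Inr m) l))) =
          (\<Sum>l<N. \<Sum>m<N. V.fr (z m) * (mconst (e l) * V.fr (psubst f (vec (Inr m) l))))"
        by (simp add: V.fr_simps sum_distrib_left mult_ac)
      also have "\<dots> = (\<Sum>m<N. V.fr (z m) * (\<Sum>l<N. mconst (e l) * V.fr (psubst f (vec (Inr m) l))))"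
        by (subst sum.swap) (simp add: sum_distrib_left)
      also have "\<dots> = (\<Sum>m<N. V.fr (z m) * (V.lam * H * mconst (e m)))"
        using fInr by (intro sum.cong) auto
      also have "\<dots> = V.lam * H * (\<Sum>m<N. mconst (e m) * V.fr (z m))"
        by (simp add: sum_distrib_left mult_ac)
      also have "\<dots> = H * H ^ (p - 1) * B"
        unfolding z[symmetric] Y(1) by (simp add: mult_ac)
      finally show ?thesis .
    qed
    have Hp: "H * H ^ (p - 1) = H ^ p" using power_minus_mult[OF V.p_pos, of H] by (simp add: mult.commute)
    have "(\<Sum>l<N. mconst (e l) * V.fr (X l)) = V.fr D0 * H ^ p * mconst (e l0) -
        (H ^ p * (\<Sum>j<V.\<kappa>. V.fr (C j) * mconst (u j)) + H * H ^ (p - 1) * B)"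
      unfolding s1[symmetric] s2[symmetric] s3[symmetric]
      by (simp only: X_def V.fr_simps(3,4) right_diff_distrib distrib_left sum_subtractf sum.distrib)
    also have "\<dots> = 0" unfolding Hp B_def by (simp add: algebra_simps)
    finally have "(\<Sum>l<N. mconst (e l) * V.fr (X l)) = 0" .
    from V.pindep_fr[OF V.e_indep this] have X0: "X l = 0" if "l < N" for l using that by auto
    define c where "c = (\<lambda>k. case k of Inl j \<Rightarrow> V.\<sigma> (C j * \<eta>) | Inr m \<Rightarrow> V.\<sigma> (z m))"
    have "(\<Sum>k\<in>?I. c k * ?h (vec k l)) = (if l = l0 then V.\<sigma> (D0 * \<eta>) else 0)" if "l < N" for l
    proof -
      have "(\<Sum>k\<in>?I. c k * ?h (vec k l)) =
          V.\<sigma> ((\<Sum>j<V.\<kappa>. C j * \<eta> * psubst f (vec (Inl j) l)) + (\<Sum>m<N. z m * psubst f (vec (Inr m) l)))"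
        by (simp add: sum.Plus c_def V.\<sigma>_simps)
      also have "\<dots> = V.\<sigma> (if l = l0 then D0 * \<eta> else 0)"
        using X0[OF that] by (simp add: X_def)
      finally show ?thesis by (simp add: V.\<sigma>_simps)
    qed
    moreover have "V.\<sigma> (D0 * \<eta>) \<noteq> 0"
      using dc(2) H0 by (simp add: V.\<sigma>_simps D0) (simp add: V.\<sigma>_def \<eta> V.\<tau>_simps)
    ultimately show ?thesis by blast
  qed
  have vecP: "vec k l \<in> mpolys {..<r}" for k l
    by (auto simp: vec_def split: sum.split intro!: mpolys_sum mpolys_mult)
  have tarP: "tar l \<in> mpolys {..<r}" for l
    by (auto simp: tar_def intro!: mpolys_sum mpolys_mult)
  obtain E c where E: "E \<in> mpolys {..<r}" "?h E \<noteq> 0" "\<forall>k\<in>?I. c k \<in> mpolys {..<r}"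
      "\<forall>l\<in>{..<N}. E * tar l = (\<Sum>k\<in>?I. c k * vec k l)"
    using P.ex_combination_hom[OF h, of ?I "{..<N}" vec tar, OF _ _ vecP tarP spec] by auto
  define g where "g = (\<lambda>j. if j < V.\<kappa> then - c (Inl j) else E * mvar j)"
  have swap: "(\<Sum>j\<in>J. V.fr (a j) * (\<Sum>l<N. mconst (e l) * V.fr (v j l))) =
      (\<Sum>l<N. mconst (e l) * V.fr (\<Sum>j\<in>J. a j * v j l))" for J :: "nat set" and a v
    unfolding V.fr_simps(6) sum_distrib_left by (subst sum.swap) (simp add: V.fr_simps mult_ac)
  have rel: "(\<Sum>j<r. mconst (u j) * W.\<sigma> (g j)) = 0"
  proof -
    have "W.tw {..<r} u g = (\<Sum>j<V.\<kappa>. mconst (u j) * V.fr (g j)) + (\<Sum>j\<in>{V.\<kappa>..<r}. mconst (u j) * V.fr (g j))"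
    proof -
      have "{..<r} = {..<V.\<kappa>} \<union> {V.\<kappa>..<r}" using V.\<kappa>_less by auto
      then show ?thesis unfolding W.tw_def by (simp add: sum.union_disjoint ivl_disj_int)
    qed
    also have "(\<Sum>j<V.\<kappa>. mconst (u j) * V.fr (g j)) =
        - (\<Sum>j<V.\<kappa>. V.fr (c (Inl j)) * (\<Sum>l<N. mconst (e l) * V.fr (vec (Inl j) l)))"
      unfolding sum_negf[symmetric] using V.\<kappa>_less
      by (intro sum.cong) (auto simp: vec_Inl g_def V.fr_simps)
    also have "\<dots> = - (\<Sum>l<N. mconst (e l) * V.fr (\<Sum>j<V.\<kappa>. c (Inl j) * vec (Inl j) l))"
      unfolding swap ..
    also have "(\<Sum>j\<in>{V.\<kappa>..<r}. mconst (u j) * V.fr (g j)) =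
        (\<Sum>j\<in>{V.\<kappa>..<r}. V.fr (E * mvar j) * (\<Sum>l<N. mconst (e l) * V.fr (vec (Inl j) l)))"
      by (intro sum.cong) (auto simp: vec_Inl g_def V.fr_simps)
    also have "\<dots> = (\<Sum>l<N. mconst (e l) * V.fr (E * tar l))"
      unfolding swap by (simp add: tar_def vec_def sum_distrib_left mult_ac)
    also have "\<dots> = (\<Sum>l<N. mconst (e l) * V.fr (\<Sum>j<V.\<kappa>. c (Inl j) * vec (Inl j) l)) +
        (\<Sum>l<N. mconst (e l) * V.fr (\<Sum>m<N. c (Inr m) * vec (Inr m) l))"
      using E(4) by (simp add: sum.Plus V.fr_simps(3) distrib_left sum.distrib)
    also have "(\<Sum>l<N. mconst (e l) * V.fr (\<Sum>m<N. c (Inr m) * vec (Inr m) l)) =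
        (\<Sum>m<N. V.fr (c (Inr m)) * (\<Sum>l<N. mconst (e l) * V.fr (vec (Inr m) l)))"
      unfolding swap ..
    also have "\<dots> = (\<Sum>m<N. V.fr (c (Inr m)) * (W.lam * mconst (e m)))"
      using vec_Inr by simp
    finally have "W.tw {..<r} u g = (\<Sum>m<N. V.fr (c (Inr m)) * (W.lam * mconst (e m)))" by simp
    then have "W.\<tau> (W.tw {..<r} u g) = 0" by (simp add: W.\<tau>_simps W.\<tau>_lam)
    then show ?thesis by (simp add: W.\<tau>_tw)
  qed
  obtain k where k: "?h (hcomp k E) \<noteq> 0" using hom_sum_hcomp[OF h E(2)] by blast
  have "S.level_map (\<lambda>j. hcomp (Suc k) (g j)) (hcomp k E) k"
    by (rule S.level_map_homogenize)
       (use E rel V.\<kappa>_less in \<open>auto simp: g_def intro!: mpolys_mult mpolys_uminus\<close>)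
  with k show ?thesis by blast
qed

section \<open>From level maps to mutually inverse rational morphisms\<close>

lemma level_map_rational:
  assumes f: "level_map f D d" and D: "V.\<sigma> D \<noteq> 0"
  shows "rational_morphism (r, V.ideal) (r, W.ideal) f"
  unfolding rational_morphism_def fst_conv snd_conv
proof (intro conjI ballI)
  show "\<exists>d. \<forall>j<r. f j \<in> homogeneous r d" using f by (auto simp: level_map_def)
  \<comment> \<open>Coordinate \<open>\<kappa>\<close> is copied, and \<open>0 < \<kappa>\<close>
    means that \<open>\<sigma>\<close> fixes its variable.\<close>
  have "V.\<sigma> (f V.\<kappa>) = V.\<sigma> D * mvar V.\<kappa>"
    using f V.\<kappa>_less V.\<kappa>_pos by (simp add: level_map_def V.\<sigma>_simps V.\<sigma>_mvar)
  with D have "f V.\<kappa> \<notin> V.ideal" by (auto simp: V.ideal_iff mvar_neq_0)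
  then show "\<exists>j<r. f j \<notin> V.ideal" using V.\<kappa>_less by blast
  fix P assume P: "P \<in> W.ideal"
  then have "V.\<sigma> (psubst f P) = 0"
    using f by (intro level_map_kills_ideal) (auto simp: level_map_def W.ideal_def)
  moreover have "psubst f P \<in> mpolys {..<r}"
    using P level_map_mpolys[OF f] by (intro mpolys_psubst[of P "{..<r}"]) (auto simp: W.ideal_iff)
  ultimately show "psubst f P \<in> V.ideal" by (simp add: V.ideal_iff)
qed

lemma \<sigma>_psubst_psubst:
  assumes P: "P \<in> homogeneous r n" and c: "\<And>i. i < r \<Longrightarrow> V.\<sigma> (psubst f (g i)) = V.\<sigma> (\<mu> * mvar i)"
  shows "V.\<sigma> (psubst f (psubst g P)) = V.\<sigma> \<mu> ^ n * V.\<sigma> P"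
proof -
  have "V.\<sigma> (psubst f (psubst g P)) = V.\<sigma> (psubst (\<lambda>i. \<mu> * mvar i) P)"
    unfolding psubst_psubst by (rule V.\<sigma>_psubst_cong[OF homogeneousD[OF P] c])
  then show ?thesis by (simp add: psubst_mult_homogeneous[OF P] psubst_id V.\<sigma>_simps)
qed

text \<open>Dominance of \<open>g\<close> comes for free from the composite: pull the equation back along \<open>f\<close>.\<close>

lemma level_map_dominant:
  assumes f: "level_map f D d" and g: "\<And>i. i < r \<Longrightarrow> g i \<in> mpolys {..<r}"
    and c: "\<And>i. i < r \<Longrightarrow> V.\<sigma> (psubst f (g i)) = V.\<sigma> (\<mu> * mvar i)" and \<mu>: "V.\<sigma> \<mu> \<noteq> 0"
  shows "dominant (r, W.ideal) (r, V.ideal) g"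
  unfolding dominant_def fst_conv snd_conv
proof (intro allI ballI impI)
  fix n P assume P: "P \<in> homogeneous r n" and gP: "psubst g P \<in> W.ideal"
  have "V.\<sigma> (psubst f (psubst g P)) = 0"
    using f gP by (intro level_map_kills_ideal) (auto simp: level_map_def W.ideal_def)
  then have "V.\<sigma> P = 0" using \<sigma>_psubst_psubst[OF P c] \<mu> by simp
  then show "P \<in> V.ideal" using homogeneousD[OF P] by (simp add: V.ideal_iff)
qed

lemma composite_identity:
  assumes f: "\<And>i. i < r \<Longrightarrow> f i \<in> mpolys {..<r}" and g: "\<And>i. i < r \<Longrightarrow> g i \<in> mpolys {..<r}"
    and c: "\<And>i. i < r \<Longrightarrow> V.\<sigma> (psubst f (g i)) = V.\<sigma> (\<mu> * mvar i)"
  shows "same_rational_morphism (r, V.ideal) (r, V.ideal) (composite g f) mvar"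
  unfolding same_rational_morphism_def composite_def fst_conv snd_conv
proof (intro allI impI)
  fix i j assume ij: "i < r" "j < r"
  have "psubst f (g i) \<in> mpolys {..<r}" if "i < r" for i
    using g[OF that] f by (rule mpolys_psubst) auto
  then show "psubst f (g i) * mvar j - psubst f (g j) * mvar i \<in> V.ideal"
    using ij by (auto simp: V.ideal_iff V.\<sigma>_simps c mult_ac intro!: mpolys_diff mpolys_mult)
qed

theorem birational_ideals: "birational (r, V.ideal) (r, W.ideal)"
proof -
  interpret S: value_field_pair p F r w u L e N ..
  obtain f D d where f: "level_map f D d" and D: "V.\<sigma> D \<noteq> 0" using ex_level_map by blast
  obtain g D' d' where g: "S.level_map g D' d'" and D': "V.\<sigma> (psubst f D') \<noteq> 0"
    using ex_opposite_level_map[OF f D] by blast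
  have DP: "D \<in> homogeneous r d" "D' \<in> homogeneous r d'"
    using f g by (auto simp: level_map_def S.level_map_def)
  note fP = level_map_mpolys[OF f] and gP = S.level_map_mpolys[OF g]
  define \<mu> where "\<mu> = psubst f D' * D"
  define \<nu> where "\<nu> = psubst g D * D'"
  have gf: "V.\<sigma> (psubst f (g i)) = V.\<sigma> (\<mu> * mvar i)" if "i < r" for i
    unfolding \<mu>_def
    using level_map_composite[OF f, of g D' i] gP that g DP by (auto simp: S.level_map_def dest: homogeneousD)
  have fg: "W.\<sigma> (psubst g (f i)) = W.\<sigma> (\<nu> * mvar i)" if "i < r" for i
    unfolding \<nu>_def
    using S.level_map_composite[OF g, of f D i] fP that f DP by (auto simp: level_map_def dest: homogeneousD)
  have \<mu>: "V.\<sigma> \<mu> \<noteq> 0" using D D' by (simp add: \<mu>_def V.\<sigma>_simps)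
  have kills: "V.\<sigma> (psubst f P) = 0" if "P \<in> mpolys {..<r}" "W.\<sigma> P = 0" for P
    using that f W.\<sigma>_eq_0_iff by (intro level_map_kills_ideal) (auto simp: level_map_def)
  have D'0: "W.\<sigma> D' \<noteq> 0" using kills[of D'] D' DP by (auto dest: homogeneousD)
  \<comment> \<open>The denominator of \<open>f\<close> survives along \<open>g\<close>, because
    pulled back further along \<open>f\<close> it becomes a power of \<open>\<mu>\<close> times
    \<open>D\<close>.\<close>
  have "V.\<sigma> (psubst f (psubst g D)) \<noteq> 0"
    using \<sigma>_psubst_psubst[OF DP(1) gf] \<mu> D by simp
  moreover have "psubst g D \<in> mpolys {..<r}"
    using homogeneousD[OF DP(1)] gP by (rule mpolys_psubst) auto
  ultimately have "W.\<sigma> (psubst g D) \<noteq> 0" using kills by blast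
  with D'0 have \<nu>: "W.\<sigma> \<nu> \<noteq> 0" by (simp add: \<nu>_def W.\<sigma>_simps)
  show ?thesis
    unfolding birational_def
    using level_map_rational[OF f D] S.level_map_rational[OF g D'0]
      S.level_map_dominant[OF g fP fg \<nu>] level_map_dominant[OF f gP gf \<mu>]
      composite_identity[OF fP gP gf] S.composite_identity[OF gP fP fg]
    by blast
qed

end


section \<open>The field of values of a quasi-Pfister form\<close>

context qform
begin

lemma \<sigma>_psubst_form:
  "\<sigma> (psubst f (\<Sum>j<r. mconst (w j) * mvar j ^ p)) = (\<Sum>j<r. mconst (w j) * \<sigma> (f j)) ^ p"
proof -
  have "\<sigma> (psubst f (\<Sum>j<r. mconst (w j) * mvar j ^ p)) = (\<Sum>j<r. (mconst (w j) * \<sigma> (f j)) ^ p)"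
    by (simp add: rhom.sum[OF rhom_psubst] rhom.mult[OF rhom_psubst] rhom.power[OF rhom_psubst]
        \<sigma>_simps power_mult_distrib rhom.power[OF rhom_mconst])
  then show ?thesis by (simp add: rhom.sum[OF rhom_pow_mpoly])
qed

text \<open>A rational point of the second hypersurface over the function field of the first one is a
  relation between powers of \<open>\<beta>\<close> over \<open>L[x]\<close>, nontrivial as \<open>w\<close> is anisotropic.\<close>

lemma values_in_subfield:
  assumes L: "pfield p L" and w: "pindep p {..<r} w" and wL: "\<And>j. j < r \<Longrightarrow> w j \<in> L"
    and f: "\<And>j. j < r \<Longrightarrow> f j \<in> mpolys {..<r}" and rel: "(\<Sum>j<r. mconst (w j) * \<sigma> (f j)) = 0"
    and j0: "j0 < r" "\<sigma> (f j0) \<noteq> 0" and i: "i < r"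
  shows "u i \<in> L"
proof (rule ccontr)
  assume not: "u i \<notin> L"
  interpret L: pfield p F L by fact
  have i': "i \<in> {1..<r}" using i not L.one u_0 by (cases "i = 0") auto
  have "\<forall>j\<in>{..<r}. \<exists>c. reduces_to (f j) c" using f ex_reduces_to by blast
  from bchoice[OF this] obtain c where c: "\<forall>j\<in>{..<r}. reduces_to (f j) (c j)" ..
  define C where "C = (\<lambda>k. \<Sum>j<r. mconst (w j) * fr (c j k))"
  interpret cf: subring "cf L" using subring_cf[OF L.subring_axioms, of UNIV] by simp
  have "C k \<in> cf L" for k
    unfolding C_def using wL by (intro cf.sum cf.mult L.fr_cf) (auto simp: cf_mconst_iff L.zero)
  moreover have "(\<Sum>k<p. C k * \<beta> ^ k) = 0"
  proof -
    have "(\<Sum>k<p. C k * \<beta> ^ k) = (\<Sum>j<r. mconst (w j) * (\<Sum>k<p. fr (c j k) * \<beta> ^ k))"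
      unfolding C_def sum_distrib_left sum_distrib_right by (subst sum.swap) (simp add: mult_ac)
    also have "\<dots> = (\<Sum>j<r. mconst (w j) * \<sigma> (f j))"
    proof (rule sum.cong[OF refl])
      fix j assume "j \<in> {..<r}"
      then show "mconst (w j) * (\<Sum>k<p. fr (c j k) * \<beta> ^ k) = mconst (w j) * \<sigma> (f j)"
        using c \<sigma>_reduces_to[of "f j" "c j"] by simp
    qed
    finally show ?thesis using rel by simp
  qed
  ultimately have "C k = 0" if "k < p" for k using \<beta>_powers_indep[OF L i' not] that by blast
  then have "c j0 k = 0" if "k < p" for k
    using pindep_fr[OF w, of "\<lambda>j. c j k" j0] that j0 by (simp add: C_def)
  then have "\<sigma> (f j0) = 0" using \<sigma>_reduces_to[of "f j0" "c j0"] c j0 by (simp add: fr_simps)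
  with j0 show False by simp
qed

end

section \<open>The field generated over the \<open>p\<close>-th powers by the slots of a
  quasi-Pfister form\<close>

context frobenius
begin

primrec adjoin :: "'a list \<Rightarrow> 'a set" where
  "adjoin [] = range (\<lambda>x. x ^ p)"
| "adjoin (a # as) = {(\<Sum>k<p. l k * a ^ k) |l. \<forall>k. l k \<in> adjoin as}"

lemma adjoin_Cons_mem:
  assumes "subring (adjoin as)" "x \<in> adjoin as" "k < p"
  shows "x * a ^ k \<in> adjoin (a # as)"
proof -
  interpret subring "adjoin as" by fact
  have "x * a ^ k = (\<Sum>i<p. (if i = k then x else 0) * a ^ i)"
    using assms by (simp add: if_distrib[of "\<lambda>x. x * _"] cong: if_cong)
  then show ?thesis using assms zero by auto
qed

lemma pfield_adjoin: "pfield p (adjoin as)"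
proof (induction as)
  case Nil
  show ?case unfolding adjoin.simps by (rule pfield_range)
next
  case (Cons a as)
  interpret k: pfield p F "adjoin as" by fact
  let ?S = "adjoin (a # as)"
  note mem = adjoin_Cons_mem[OF k.subring_axioms]
  have S_diff: "x - y \<in> ?S" if "x \<in> ?S" "y \<in> ?S" for x y
  proof -
    obtain l m where "x = (\<Sum>k<p. l k * a ^ k)" "y = (\<Sum>k<p. m k * a ^ k)"
        "\<forall>k. l k \<in> adjoin as" "\<forall>k. m k \<in> adjoin as" using \<open>x \<in> ?S\<close> \<open>y \<in> ?S\<close> by auto
    then show ?thesis
      by (auto intro!: exI[of _ "\<lambda>k. l k - m k"] k.diff simp: sum_subtractf left_diff_distrib)
  qed
  have S_1: "x \<in> ?S" if "x \<in> adjoin as" for x using mem[OF that p_pos, of a] by simp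
  have S_0: "0 \<in> ?S" by (rule S_1[OF k.zero])
  have S_add: "x + y \<in> ?S" if "x \<in> ?S" "y \<in> ?S" for x y
    using S_diff[OF that(1) S_diff[OF S_0 that(2)]] by simp
  have S_sum: "sum f I \<in> ?S" if "\<And>i. i \<in> I \<Longrightarrow> f i \<in> ?S" for f :: "nat \<Rightarrow> 'a" and I
    using that by (induction I rule: infinite_finite_induct) (auto simp: S_0 S_add simp del: adjoin.simps)
  have S_pow: "x * a ^ n \<in> ?S" if "x \<in> adjoin as" for x n
  proof -
    \<comment> \<open>\<open>a ^ p\<close> is already a scalar, so exponents may be reduced modulo
      \<open>p\<close>; this gives closure under products.\<close>
    have "a ^ n = (a ^ (n div p)) ^ p * a ^ (n mod p)"
      by (simp flip: power_mult power_add)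
    then have eq: "x * a ^ n = x * (a ^ (n div p)) ^ p * a ^ (n mod p)" by (simp add: mult.assoc)
    show ?thesis unfolding eq
      by (rule mem) (use that p_pos k.pow_mem in \<open>auto intro: k.mult\<close>)
  qed
  have "subring ?S"
  proof
    show "1 \<in> ?S" by (rule S_1[OF k.one])
    fix x y assume xy: "x \<in> ?S" "y \<in> ?S"
    then show "x - y \<in> ?S" by (rule S_diff)
    obtain l m where "x = (\<Sum>k<p. l k * a ^ k)" "y = (\<Sum>k<p. m k * a ^ k)"
        "\<forall>k. l k \<in> adjoin as" "\<forall>k. m k \<in> adjoin as" using xy by auto
    then have "x * y = (\<Sum>i<p. \<Sum>j<p. (l i * m j) * a ^ (i + j))"
      by (simp add: sum_product power_add mult_ac)
    also have "\<dots> \<in> ?S" using \<open>\<forall>k. l k \<in> _\<close> \<open>\<forall>k. m k \<in> _\<close> by (intro S_sum S_pow k.mult) auto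
    finally show "x * y \<in> ?S" .
  qed
  then show ?case
    using S_1[OF k.pow_mem]
    by (intro pfield.intro) (auto simp: pfield_axioms_def frobenius_axioms simp del: adjoin.simps)
qed

lemma set_subset_adjoin: "set as \<subseteq> adjoin as"
proof (induction as)
  case (Cons a as)
  interpret k: pfield p F "adjoin as" by (rule pfield_adjoin)
  note mem = adjoin_Cons_mem[OF k.subring_axioms]
  have "a \<in> adjoin (a # as)" using mem[OF k.one, of 1 a] p_ge_2 by simp
  moreover have "x \<in> adjoin (a # as)" if "x \<in> adjoin as" for x using mem[OF that p_pos, of a] by simp
  ultimately show ?case using Cons by (auto simp del: adjoin.simps)
qed simp

lemma quasi_pfister_in_adjoin: "quasi_pfister p as x \<in> adjoin as"
proof -
  interpret k: pfield p F "adjoin as" by (rule pfield_adjoin)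
  show ?thesis unfolding quasi_pfister_def
    using set_subset_adjoin[of as] by (intro k.sum k.mult k.prod k.power k.pow_mem) auto
qed

lemma adjoin_spanning:
  "\<exists>B. finite B \<and> card B \<le> p ^ length as \<and> B \<subseteq> adjoin as \<and>
     adjoin as \<subseteq> subring.rspan (range (\<lambda>x. x ^ p)) B (\<lambda>b. b)"
proof (induction as)
  case Nil
  interpret Q: subring "range (\<lambda>x::'a. x ^ p)" by (rule subring_powers)
  have "x \<in> Q.rspan {1} (\<lambda>b. b)" if "x \<in> range (\<lambda>x. x ^ p)" for x
    using Q.rspan_scale[OF that Q.rspan_base[of "{1}" 1 "\<lambda>b. b"]] by simp
  then show ?case using Q.one by (intro exI[of _ "{1}"]) auto
next
  case (Cons a as)
  interpret Q: subring "range (\<lambda>x::'a. x ^ p)" by (rule subring_powers)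
  interpret k: pfield p F "adjoin as" by (rule pfield_adjoin)
  obtain B where B: "finite B" "card B \<le> p ^ length as" "B \<subseteq> adjoin as"
    "adjoin as \<subseteq> Q.rspan B (\<lambda>b. b)" using Cons by blast
  define B' where "B' = (\<lambda>(b, k). b * a ^ k) ` (B \<times> {..<p})"
  have fin: "finite B'" using B by (simp add: B'_def)
  have "card B' \<le> card (B \<times> {..<p})" unfolding B'_def using B by (intro card_image_le) auto
  also have "\<dots> \<le> p ^ length (a # as)" using B(2) by (simp add: card_cartesian_product mult.commute)
  finally have card: "card B' \<le> p ^ length (a # as)" .
  have sub: "B' \<subseteq> adjoin (a # as)"
    using adjoin_Cons_mem[OF k.subring_axioms] B(3) by (auto simp: B'_def simp del: adjoin.simps)
  have "x * a ^ j \<in> Q.rspan B' (\<lambda>b. b)" if "x \<in> adjoin as" "j < p" for x j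
  proof -
    have "x \<in> Q.rspan B (\<lambda>b. b)" using B(4) that by blast
    then obtain d c where dc: "d \<in> range (\<lambda>x. x ^ p)" "d \<noteq> 0" "\<forall>b\<in>B. c b \<in> range (\<lambda>x. x ^ p)"
        "d * x = (\<Sum>b\<in>B. c b * b)" by (rule Q.rspanE)
    have "d * (x * a ^ j) = d * x * a ^ j" by (simp only: mult.assoc)
    also have "\<dots> = (\<Sum>b\<in>B. c b * (b * a ^ j))"
      unfolding dc(4) sum_distrib_right by (simp only: mult.assoc)
    also have "\<dots> \<in> Q.rspan B' (\<lambda>b. b)"
    proof (rule Q.rspan_sum)
      fix b assume "b \<in> B"
      then have "b * a ^ j \<in> B'" using that by (force simp: B'_def)
      then show "c b * (b * a ^ j) \<in> Q.rspan B' (\<lambda>b. b)"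
        using Q.rspan_base[OF fin, of "b * a ^ j" "\<lambda>b. b"] dc(3) \<open>b \<in> B\<close> Q.rspan_scale by blast
    qed
    finally show ?thesis using dc Q.rspan_cancel by blast
  qed
  then have "adjoin (a # as) \<subseteq> Q.rspan B' (\<lambda>b. b)" by (auto intro!: Q.rspan_sum)
  with fin card sub show ?case by blast
qed

text \<open>\<open>N\<close> may be smaller than \<open>p ^ length as\<close>: the quasi-Pfister
  form itself may be isotropic, and then the monomials in its slots are dependent.\<close>

lemma adjoin_basis:
  "\<exists>e N. N \<le> p ^ length as \<and> pindep p {..<N} e \<and> (\<forall>l<N. e l \<in> adjoin as) \<and>
     (\<forall>x\<in>adjoin as. \<exists>c. x = (\<Sum>l<N. c l ^ p * e l))"
proof -
  interpret Q: subring "range (\<lambda>x::'a. x ^ p)" by (rule subring_powers)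
  obtain B where B: "finite B" "card B \<le> p ^ length as" "B \<subseteq> adjoin as"
    "adjoin as \<subseteq> Q.rspan B (\<lambda>b. b)" using adjoin_spanning by blast
  obtain I where I: "I \<subseteq> B" "Q.indep I (\<lambda>b. b)" "\<forall>b\<in>B. b \<in> Q.rspan I (\<lambda>b. b)"
    using Q.ex_basis[OF B(1), of "\<lambda>b. b"] by blast
  have fin: "finite I" using I B by (auto intro: finite_subset)
  obtain e where e: "bij_betw e {..<card I} I"
    using ex_bij_betw_nat_finite[OF fin] by (auto simp: atLeast0LessThan)
  have sum_e: "(\<Sum>l<card I. g (e l) * e l) = (\<Sum>b\<in>I. g b * b)" for g
    using sum.reindex_bij_betw[OF e, of "\<lambda>b. g b * b"] .
  define inv where "inv = the_inv_into {..<card I} e"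
  have inv: "inv (e l) = l" if "l < card I" for l
    unfolding inv_def using e that by (intro the_inv_into_f_f) (auto simp: bij_betw_def)
  have eI: "e l \<in> I" if "l < card I" for l using e that by (auto simp: bij_betw_def)
  have "card I \<le> p ^ length as" using I B card_mono[of B I] by simp
  moreover have "pindep p {..<card I} e"
    unfolding pindep_def
  proof (intro allI impI ballI)
    fix c l assume c: "(\<Sum>l<card I. c l ^ p * e l) = 0" and l: "l \<in> {..<card I}"
    have "(\<Sum>b\<in>I. c (inv b) ^ p * b) = (\<Sum>l<card I. c l ^ p * e l)"
      unfolding sum_e[symmetric] by (intro sum.cong) (auto simp: inv)
    then have "(\<Sum>b\<in>I. c (inv b) ^ p * b) = 0" using c by simp
    from Q.indepD[OF I(2) _ this eI[of l]] l have "c (inv (e l)) ^ p = 0" by auto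
    then show "c l = 0" using l by (simp add: inv)
  qed
  moreover have "\<forall>l<card I. e l \<in> adjoin as" using eI I B by blast
  moreover have "\<forall>x\<in>adjoin as. \<exists>c. x = (\<Sum>l<card I. c l ^ p * e l)"
  proof
    fix x assume "x \<in> adjoin as"
    then have "x \<in> Q.rspan B (\<lambda>b. b)" using B by blast
    then have "x \<in> Q.rspan I (\<lambda>b. b)" 
      using I(3) Q.rspan_trans[of B "\<lambda>b. b" I "\<lambda>b. b" x] by blast
    then obtain d c where dc: "d \<in> range (\<lambda>x. x ^ p)" "d \<noteq> 0" "\<forall>b\<in>I. c b \<in> range (\<lambda>x. x ^ p)"
        "d * x = (\<Sum>b\<in>I. c b * b)" by (rule Q.rspanE)
    obtain y where y: "d = y ^ p" using dc by auto
    have "\<forall>b\<in>I. \<exists>z. c b = z ^ p" using dc by auto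
    from bchoice[OF this] obtain z where z: "\<forall>b\<in>I. c b = z b ^ p" ..
    have "x = (\<Sum>b\<in>I. c b * b) / d" using dc by (simp add: field_simps)
    also have "\<dots> = (\<Sum>b\<in>I. (z b / y) ^ p * b)"
      unfolding sum_divide_distrib using z by (intro sum.cong) (auto simp: y power_divide)
    also have "\<dots> = (\<Sum>l<card I. (z (e l) / y) ^ p * e l)" by (rule sum_e[symmetric])
    finally show "\<exists>c. x = (\<Sum>l<card I. c l ^ p * e l)" 
      by (intro exI[of _ "\<lambda>l. z (e l) / y"])
  qed
  ultimately show ?thesis by blast
qed

end


section \<open>Hypersurfaces of quasilinear forms\<close>

lemma form_sum:
  fixes n :: nat
  assumes q: "quasilinear_form p s V \<phi>" and p: "0 < p" and b: "\<And>i. i < n \<Longrightarrow> b i \<in> V"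
  shows "(\<Sum>i<n. s (c i) (b i)) \<in> V \<and> \<phi> (\<Sum>i<n. s (c i) (b i)) = (\<Sum>i<n. c i ^ p * \<phi> (b i))"
proof -
  interpret vector_space s using q by (simp add: quasilinear_form_def)
  have V: "subspace V" and hom: "\<And>c v. v \<in> V \<Longrightarrow> \<phi> (s c v) = c ^ p * \<phi> v"
    and add: "\<And>v w. v \<in> V \<Longrightarrow> w \<in> V \<Longrightarrow> \<phi> (v + w) = \<phi> v + \<phi> w"
    using q by (auto simp: quasilinear_form_def)
  have \<phi>0: "\<phi> 0 = 0" using hom[OF subspace_0[OF V], of 0] p by (simp add: zero_power)
  show ?thesis
    using b by (induction n) (auto simp: \<phi>0 subspace_0[OF V] subspace_add[OF V] subspace_scale[OF V] hom add)
qed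

lemma pindep_basis_values:
  assumes q: "quasilinear_form p s V \<phi>" and p: "0 < p" and "anisotropic V \<phi>"
    and bs: "ordered_basis s V bs"
  shows "pindep p {..<length bs} (\<lambda>i. \<phi> (bs ! i))"
  unfolding pindep_def
proof (intro allI impI ballI)
  interpret vector_space s using q by (simp add: quasilinear_form_def)
  fix c i assume c: "(\<Sum>i<length bs. c i ^ p * \<phi> (bs ! i)) = 0" and i: "i \<in> {..<length bs}"
  have dist: "distinct bs" and ind: "independent (set bs)" and sp: "span (set bs) = V"
    using bs by (auto simp: ordered_basis_def)
  have bV: "bs ! i \<in> V" if "i < length bs" for i using that sp by (auto intro: span_base)
  have "(\<Sum>i<length bs. s (c i) (bs ! i)) = 0"
    using form_sum[OF q p, of "length bs" "(!) bs" c] bV c \<open>anisotropic V \<phi>\<close> by (auto simp: anisotropic_def)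
  moreover have bij: "bij_betw ((!) bs) {..<length bs} (set bs)"
    by (rule bij_betw_nth[OF dist]) auto
  define inv where "inv = the_inv_into {..<length bs} ((!) bs)"
  have inv: "inv (bs ! i) = i" if "i < length bs" for i
    unfolding inv_def using bij that by (intro the_inv_into_f_f) (auto simp: bij_betw_def)
  have "(\<Sum>v\<in>set bs. s (c (inv v)) v) = (\<Sum>i<length bs. s (c i) (bs ! i))"
    unfolding sum.reindex_bij_betw[OF bij, symmetric] by (intro sum.cong) (auto simp: inv)
  ultimately have "(\<Sum>v\<in>set bs. s (c (inv v)) v) = 0" by simp
  then have "c (inv (bs ! i)) = 0"
    using independentD[OF ind, of "set bs" "\<lambda>v. c (inv v)" "bs ! i"] i by auto
  then show "c i = 0" using i by (simp add: inv)
qed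

lemma length_ordered_basis:
  assumes "quasilinear_form p s V \<phi>" "ordered_basis s V bs"
  shows "vector_space.dim s V = length bs"
proof -
  interpret vector_space s using assms by (simp add: quasilinear_form_def)
  have "dim V = card (set bs)"
    using assms by (intro dim_eq_card[of "set bs"]) (auto simp: ordered_basis_def span_span)
  then show ?thesis using assms by (simp add: ordered_basis_def distinct_card)
qed

text \<open>Scaling by the first value, nonzero by anisotropy, normalises the form to
  \<open>u 0 = 1\<close>; the equation changes by a unit, so the ideal stays the same.\<close>

lemma (in frobenius) qform_basis_values:
  fixes \<phi> :: "'v \<Rightarrow> 'a"
  assumes ind: "pindep p {..<length bs} (\<lambda>i. \<phi> (bs ! i))" and r: "2 \<le> length bs"
  shows "\<phi> (bs ! 0) \<noteq> 0" "qform p (length bs) (\<lambda>i. \<phi> (bs ! i) / \<phi> (bs ! 0))"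
    "hypersurface p \<phi> bs = (length bs, qform.ideal p (length bs) (\<lambda>i. \<phi> (bs ! i) / \<phi> (bs ! 0)))"
proof -
  let ?a = "\<phi> (bs ! 0)" and ?u = "\<lambda>i. \<phi> (bs ! i) / \<phi> (bs ! 0)"
  show a: "?a \<noteq> 0"
  proof
    assume "?a = 0"
    define c where "c = (\<lambda>i::nat. if i = 0 then 1 else 0 :: 'a)"
    have "(\<Sum>i<length bs. c i ^ p * \<phi> (bs ! i)) = 0"
      using \<open>?a = 0\<close> p_pos by (intro sum.neutral) (auto simp: c_def)
    moreover have "0 \<in> {..<length bs}" using r by auto
    ultimately have "c 0 = 0" by (rule pindepD[OF ind])
    then show False by (simp add: c_def)
  qed
  interpret q: qform p F "length bs" ?u
  proof
    show "pindep p {..<length bs} ?u"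
      unfolding pindep_def
    proof (intro allI impI)
      fix c assume "(\<Sum>i<length bs. c i ^ p * ?u i) = 0"
      then have "(\<Sum>i<length bs. c i ^ p * \<phi> (bs ! i)) = 0"
        using a by (simp flip: sum_divide_distrib)
      from pindepD[OF ind this] show "\<forall>i\<in>{..<length bs}. c i = 0" by blast
    qed
  qed (use r a in auto)
  show "qform p (length bs) ?u" by (rule q.qform_axioms)
  have fp: "form_poly p \<phi> bs = mconst ?a * q.\<Phi>"
    using a by (simp add: form_poly_def q.\<Phi>_def sum_distrib_left mult.assoc[symmetric]
        flip: rhom.mult[OF rhom_mconst])
  have "{form_poly p \<phi> bs * Q |Q. Q \<in> polys (length bs)} = q.ideal"
  proof (intro equalityI subsetI)
    fix x assume "x \<in> {form_poly p \<phi> bs * Q |Q. Q \<in> polys (length bs)}"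
    then obtain Q where "Q \<in> polys (length bs)" "x = q.\<Phi> * (mconst ?a * Q)" by (auto simp: fp mult_ac)
    then show "x \<in> q.ideal"
      unfolding q.ideal_def by (auto simp: polys_eq_mpolys intro!: exI[of _ "mconst ?a * Q"] mpolys_mult)
  next
    fix x assume "x \<in> q.ideal"
    then obtain Q where Q: "Q \<in> polys (length bs)" "x = q.\<Phi> * Q" by (auto simp: q.ideal_def)
    have "mconst ?a * mconst (1 / ?a) = 1"
      using a by (simp add: mconst_1 flip: rhom.mult[OF rhom_mconst])
    then have "x = form_poly p \<phi> bs * (mconst (1 / ?a) * Q)"
      using Q by (simp add: fp mult_ac)
    then show "x \<in> {form_poly p \<phi> bs * Q |Q. Q \<in> polys (length bs)}"
      using Q by (auto simp: polys_eq_mpolys intro!: exI[of _ "mconst (1 / ?a) * Q"] mpolys_mult)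
  qed
  then show "hypersurface p \<phi> bs = (length bs, q.ideal)" by (simp add: hypersurface_def)
qed

lemma quasi_pfister_neighbour_values:
  assumes "quasi_pfister_neighbour p s V \<phi>"
  obtains as c where "p ^ (length as - 1) < vector_space.dim s V" "0 < length as" "c \<noteq> 0"
    "\<And>v. v \<in> V \<Longrightarrow> \<exists>x. \<phi> v = c * quasi_pfister p as x"
proof -
  obtain as U where "p ^ (length as - 1) < vector_space.dim s V" "0 < length as"
      "proportional s V \<phi> coord_scale U (quasi_pfister p as)"
    using assms by (auto simp: quasi_pfister_neighbour_def)
  moreover from this(3) obtain c h where "c \<noteq> 0" "\<forall>v\<in>V. c * quasi_pfister p as (h v) = \<phi> v"
    by (auto simp: proportional_def isometric_def)
  ultimately show thesis using that[of as c] by metis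
qed

theorem proposition7p9:
  fixes p :: nat
    and s :: "'a::field \<Rightarrow> 'v::ab_group_add \<Rightarrow> 'v" and V :: "'v set" and \<phi> :: "'v \<Rightarrow> 'a"
    and t :: "'a \<Rightarrow> 'w::ab_group_add \<Rightarrow> 'w" and W :: "'w set" and \<psi> :: "'w \<Rightarrow> 'a"
    and bs :: "'v list" and cs :: "'w list"
  assumes "prime p" and "CHAR('a) = p"
    and non_perfect: "\<not> surj (\<lambda>x::'a. x ^ p)"
    and "quasilinear_form p s V \<phi>" and "quasilinear_form p t W \<psi>"
    and "anisotropic V \<phi>" and "anisotropic W \<psi>"
    and "quasi_pfister_neighbour p s V \<phi>" and "quasi_pfister_neighbour p t W \<psi>"
    and "hypersurface_dim s V = hypersurface_dim t W"
    and "ordered_basis s V bs" and "ordered_basis t W cs"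
    and "\<exists>f. rational_morphism (hypersurface p \<phi> bs) (hypersurface p \<psi> cs) f"
    and "\<exists>g. rational_morphism (hypersurface p \<psi> cs) (hypersurface p \<phi> bs) g"
  shows "birational (hypersurface p \<phi> bs) (hypersurface p \<psi> cs)"
proof -
  interpret frobenius p "TYPE('a)" using assms by unfold_locales
  define r where "r = length bs"
  have dims: "vector_space.dim s V = length bs" "vector_space.dim t W = length cs"
    using assms length_ordered_basis by blast+
  have "2 \<le> vector_space.dim s V" "2 \<le> vector_space.dim t W"
    using assms(8,9) by (auto simp: quasi_pfister_neighbour_def)
  with dims assms(10) have r: "2 \<le> r" "length bs = r" "length cs = r"
    by (auto simp: hypersurface_dim_def r_def)
  define u where "u = (\<lambda>i. \<phi> (bs ! i) / \<phi> (bs ! 0))"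
  define w where "w = (\<lambda>i. \<psi> (cs ! i) / \<psi> (cs ! 0))"
  have ind: "pindep p {..<length bs} (\<lambda>i. \<phi> (bs ! i))" "pindep p {..<length cs} (\<lambda>i. \<psi> (cs ! i))"
    using assms p_pos by (auto intro!: pindep_basis_values)
  note V = qform_basis_values[OF ind(1), unfolded r, OF r(1), folded u_def]
  note W = qform_basis_values[OF ind(2), unfolded r, OF r(1), folded w_def]
  interpret V: qform p "TYPE('a)" r u by (rule V(2))
  interpret W: qform p "TYPE('a)" r w by (rule W(2))
  obtain as c where as: "p ^ (length as - 1) < r" "0 < length as" "c \<noteq> 0"
      "\<And>v. v \<in> W \<Longrightarrow> \<exists>x. \<psi> v = c * quasi_pfister p as x"
    using quasi_pfister_neighbour_values[OF assms(9)] dims r by metis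
  interpret L: pfield p "TYPE('a)" "adjoin as" by (rule pfield_adjoin)
  have csW: "cs ! j \<in> W" if "j < r" for j
    using that r module.span_base[of t] assms(5,12)
    by (auto simp: ordered_basis_def quasilinear_form_def module_iff_vector_space)
  have wL: "w j \<in> adjoin as" if j: "j < r" for j
  proof -
    obtain x y where "\<psi> (cs ! j) = c * quasi_pfister p as x" "\<psi> (cs ! 0) = c * quasi_pfister p as y"
      using as(4)[OF csW[OF j]] as(4)[OF csW[of 0]] r by auto
    \<comment> \<open>The proportionality factor \<open>c\<close> cancels in the normalised
      values.\<close>
    then have "w j = quasi_pfister p as x / quasi_pfister p as y" using as(3) by (simp add: w_def)
    then show ?thesis by (simp add: L.divide quasi_pfister_in_adjoin)
  qed
  obtain f where f: "rational_morphism (r, V.ideal) (r, W.ideal) f"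
    using assms(13) unfolding V(3) W(3) by blast
  obtain j0 where j0: "j0 < r" "f j0 \<notin> V.ideal" using f by (auto simp: rational_morphism_def)
  have fP: "f j \<in> mpolys {..<r}" if "j < r" for j
    using f that by (auto simp: rational_morphism_def dest: homogeneousD)
  have "W.\<Phi> \<in> W.ideal" by (simp add: W.ideal_iff W.\<Phi>_mpolys W.\<sigma>_\<Phi>)
  then have "psubst f W.\<Phi> \<in> V.ideal" using f by (simp add: rational_morphism_def)
  then have "V.\<sigma> (psubst f W.\<Phi>) = 0" by (simp add: V.ideal_iff)
  \<comment> \<open>The pulled back equation is the \<open>p\<close>-th power of this linear
    relation.\<close>
  then have rel: "(\<Sum>j<r. mconst (w j) * V.\<sigma> (f j)) = 0"
    unfolding W.\<Phi>_def V.\<sigma>_psubst_form by simp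
  have uL: "u i \<in> adjoin as" if "i < r" for i
    using V.values_in_subfield[OF pfield_adjoin W.aniso wL fP rel j0(1) _ that] j0 fP
    by (auto simp: V.ideal_iff)
  obtain e N where e: "N \<le> p ^ length as" "pindep p {..<N} e" "\<forall>l<N. e l \<in> adjoin as"
      "\<forall>x\<in>adjoin as. \<exists>c. x = (\<Sum>l<N. c l ^ p * e l)" using adjoin_basis by blast
  \<comment> \<open>The neighbour condition \<open>p^(n-1) < r\<close>, multiplied by
    \<open>p\<close>, is exactly the bound on \<open>N\<close>.\<close>
  have "p ^ length as = p * p ^ (length as - 1)" using as(2) by (cases "length as") auto
  also have "\<dots> < p * r" using as(1) p_pos by simp
  finally have N: "N < p * r" using e(1) by simp
  interpret P: value_field_pair p "TYPE('a)" r u w "adjoin as" e N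
    by unfold_locales (use uL wL e N in auto)
  show ?thesis unfolding V(3) W(3) by (rule P.birational_ideals)
qed

end
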